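(* Let $(M,d)$ be a complete metric space, with a distinguished point $0\in M$. Then the following assertions are equivalent: (1) $M$ has property $(Z)$; (2) $M$ is a length space; (3) the unit ball of $\mathcal{F}(M)$ does not have strongly exposed points; (4) the unit ball of $\mathcal{F}(M)$ does not have preserved extreme points; (5) $\mathcal{F}(M)$ has the Daugavet property; (6) $Lip_0(M)$ has the Daugavet property; (7) the norm of $Lip_0(M)$ does not have any point of G\^ateaux differentiability; (8) the norm of $Lip_0(M)$ does not have any point of Fr\'echet differentiability; (9) $\mathcal{F}(M)$ has the slice diameter 2 property; (10) $\mathcal{F}(M)$ has the diameter 2 property; (11) $\mathcal{F}(M)$ has the strong diameter 2 property.
   Context: All Banach spaces are real. For real numbers $a,b$, write $a\vee b=\max\{a,b\}$ and $a\wedge b=\min\{a,b\}$. Property $(Z)$: a pair $(x,y)$ of points of $M$ with $x\neq y$ has property $(Z)$ if for every $\varepsilon>0$ there exists $z\in M\setminus\{x,y\}$ such that $d(x,z)+d(z,y)\leq d(x,y)+\varepsilon\cdot\big(d(x,z)\wedge d(z,y)\big)$. The space $M$ has property $(Z)$ if each pair of distinct points of $M$ has property $(Z)$. Length space: a complete metric space $M$ is a length space if for every $x,y\in M$ and every $\delta>0$ there exists $z\in M$ such that $d(x,z)\vee d(z,y)\leq d(x,y)/2+\delta$. $Lip_0(M)$ is the Banach space of all Lipschitz functions $f:M\to\mathbb{R}$ with $f(0)=0$, with norm $\|f\|=\sup_{x\neq y}\frac{|f(x)-f(y)|}{d(x,y)}$. The Lipschitz-free space $\mathcal{F}(M)$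 is the closed linear span in $Lip_0(M)^*$ of the functionals $\delta_m$, $m\in M$, where $\delta_m(f)=f(m)$ for $f\in Lip_0(M)$; it is a predual of $Lip_0(M)$. Let $X$ be a Banach space with closed unit ball $B_X$. - $X$ has the Daugavet property if $\|I+T\|=1+\|T\|$ for every rank-one bounded linear operator $T:X\to X$, where $I$ is the identity operator of $X$. - A point $x\in B_X$ is a strongly exposed point of $B_X$ if there is $f\in X^*$, $f\neq 0$, with $f(x)=\sup_{B_X} f$ such that every sequence $(x_n)$ in $B_X$ with $f(x_n)\to f(x)$ satisfies $\|x_n-x\|\to 0$. - A point $x\in B_X$ is a preserved extreme point of $B_X$ if it is an extreme point of $B_{X^{**}}$ (under the canonical embedding $X\subset X^{**}$). - The norm of $X$ is G\^ateaux differentiable at $x\in X$ if $\lim_{t\to 0}\frac{\|x+th\|-\|x\|}{t}$ exists for every $h\in X$, and Fr\'echet differentiable at $x$ if moreover this limit is uniform over $h\in B_X$. - A slice of $B_X$ is a set $\{x\in B_X: f(x)>\sup_{B_X} f-\alpha\}$ with $f\in X^*\setminus\{0\}$ and $\alpha>0$. - $X$ has the slice diameter 2 property if every slice of $B_X$ has diameter $2$; the diameter 2 property if every nonempty relatively weakly open subset of $B_X$ has diameter $2$; and the strong diameter 2 property if every convex combination of slices $\sum_{i=1}^n\lambda_i S_i$ (with $n\ge 1$, $\lambda_i\geq 0$, $\sum_i\lambda_i=1$, and $S_i$ slices of $B_X$) has diameter $2$.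
   Formalization: M is assumed to contain a point other than 0; for M={0} the claim is false, since (1) holds vacuously while 0 is an extreme point of the bidual ball {0}, so (4) fails. *)

theory Defs
  imports "HOL-Analysis.Analysis"
begin

section \<open>Metric spaces\<close>

text \<open>
  A pointed metric space is a type of sort \<open>{metric_space, zero}\<close>: the class \<^class>\<open>zero\<close>
  carries no axioms, so \<open>0\<close> is an arbitrary distinguished point.
\<close>

definition property_Z_pair :: "'a::metric_space \<Rightarrow> 'a \<Rightarrow> bool" where
  "property_Z_pair x y \<longleftrightarrow>
     (\<forall>\<epsilon>>0. \<exists>z. z \<notin> {x, y} \<and>
        dist x z + dist z y \<le> dist x y + \<epsilon> * min (dist x z) (dist z y))"

definition property_Z :: "'a::metric_space itself \<Rightarrow> bool" where
  "property_Z _ \<longleftrightarrow> (\<forall>x y::'a. x \<noteq> y \<longrightarrow> property_Z_pair x y)"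

definition length_space :: "'a::complete_space itself \<Rightarrow> bool" where
  "length_space _ \<longleftrightarrow>
     (\<forall>x y::'a. \<forall>\<delta>>0. \<exists>z. max (dist x z) (dist z y) \<le> dist x y / 2 + \<delta>)"


section \<open>The space of Lipschitz functions vanishing at the distinguished point\<close>

typedef (overloaded) 'a lip0 =
  "{f :: 'a::{metric_space, zero} \<Rightarrow> real. (\<exists>L. L-lipschitz_on UNIV f) \<and> f 0 = 0}"
  morphisms lip0_apply Lip0
proof
  show "(\<lambda>_. 0) \<in> {f :: 'a \<Rightarrow> real. (\<exists>L. L-lipschitz_on UNIV f) \<and> f 0 = 0}"
    by (auto intro: lipschitz_on_constant)
qed

setup_lifting type_definition_lip0

lemma lip0_eqI: "(\<And>x. lip0_apply f x = lip0_apply g x) \<Longrightarrow> f = g"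
  by transfer auto

lemma lip0_apply_0 [simp]: "lip0_apply f 0 = 0"
  by transfer auto

lemma lip0_lipschitz:
  obtains L where "L \<ge> 0" "\<And>x y. \<bar>lip0_apply f x - lip0_apply f y\<bar> \<le> L * dist x y"
proof -
  obtain L where "L-lipschitz_on UNIV (lip0_apply f)"
    using lip0_apply[of f] by auto
  then have "L \<ge> 0" "\<And>x y. dist (lip0_apply f x) (lip0_apply f y) \<le> L * dist x y"
    by (auto simp: lipschitz_on_def)
  then show ?thesis
    using that by (auto simp: dist_real_def)
qed

instantiation lip0 :: ("{metric_space, zero}") real_normed_vector
begin

lift_definition zero_lip0 :: "'a lip0" is "\<lambda>_. 0"
  by (auto intro: lipschitz_on_constant)

lift_definition plus_lip0 :: "'a lip0 \<Rightarrow> 'a lip0 \<Rightarrow> 'a lip0" is "\<lambda>f g x. f x + g x"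
  by (auto intro: lipschitz_on_add)

lift_definition uminus_lip0 :: "'a lip0 \<Rightarrow> 'a lip0" is "\<lambda>f x. - f x"
  by (auto simp: lipschitz_on_minus)

lift_definition minus_lip0 :: "'a lip0 \<Rightarrow> 'a lip0 \<Rightarrow> 'a lip0" is "\<lambda>f g x. f x - g x"
  by (auto intro: lipschitz_on_diff)

lift_definition scaleR_lip0 :: "real \<Rightarrow> 'a lip0 \<Rightarrow> 'a lip0" is "\<lambda>c f x. c * f x"
  by (auto intro: lipschitz_on_cmult_real)

text \<open>
  The element \<open>0\<close> is inserted so that the supremum is not taken over the empty set of reals
  when the metric space is a single point; otherwise it does not change the supremum.
\<close>
definition norm_lip0 :: "'a lip0 \<Rightarrow> real" where
  "norm_lip0 f = Sup (insert 0 {\<bar>lip0_apply f x - lip0_apply f y\<bar> / dist x y | x y. x \<noteq> y})"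

definition dist_lip0 :: "'a lip0 \<Rightarrow> 'a lip0 \<Rightarrow> real" where
  "dist_lip0 f g = norm (f - g)"

definition sgn_lip0 :: "'a lip0 \<Rightarrow> 'a lip0" where
  "sgn_lip0 f = scaleR (inverse (norm f)) f"

definition uniformity_lip0 :: "('a lip0 \<times> 'a lip0) filter" where
  "uniformity_lip0 = (INF e\<in>{0 <..}. principal {(f, g). dist f g < e})"

definition open_lip0 :: "'a lip0 set \<Rightarrow> bool" where
  "open_lip0 S = (\<forall>f\<in>S. \<forall>\<^sub>F (f', g) in uniformity. f' = f \<longrightarrow> g \<in> S)"

lemma bdd_above_lip0:
  "bdd_above (insert 0 {\<bar>lip0_apply f x - lip0_apply f y\<bar> / dist x y | x y. x \<noteq> y})"
proof -
  obtain L where "L \<ge> 0" "\<And>x y. \<bar>lip0_apply f x - lip0_apply f y\<bar> \<le> L * dist x y"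
    using lip0_lipschitz[of f] by blast
  then show ?thesis
    by (auto intro!: bdd_aboveI[where M = L] simp: divide_le_eq)
qed

lemma lip0_norm_bound: "\<bar>lip0_apply f x - lip0_apply f y\<bar> \<le> norm f * dist x y"
proof (cases "x = y")
  case False
  then have "\<bar>lip0_apply f x - lip0_apply f y\<bar> / dist x y \<le> norm f"
    unfolding norm_lip0_def by (intro cSup_upper bdd_above_lip0) auto
  with False show ?thesis
    by (simp add: divide_le_eq)
qed simp

lemma lip0_norm_leI:
  assumes "K \<ge> 0" "\<And>x y. \<bar>lip0_apply f x - lip0_apply f y\<bar> \<le> K * dist x y"
  shows "norm f \<le> K"
  unfolding norm_lip0_def using assms
  by (intro cSup_least) (auto simp: divide_le_eq)

lemma lip0_norm_nonneg: "norm (f :: 'a lip0) \<ge> 0"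
  unfolding norm_lip0_def by (intro cSup_upper bdd_above_lip0) auto

lemma lip0_norm_scaleR_le: "norm (c *\<^sub>R (f :: 'a lip0)) \<le> \<bar>c\<bar> * norm f"
proof (rule lip0_norm_leI)
  fix x y
  have "\<bar>lip0_apply (c *\<^sub>R f) x - lip0_apply (c *\<^sub>R f) y\<bar>
      = \<bar>c\<bar> * \<bar>lip0_apply f x - lip0_apply f y\<bar>"
    by (simp add: scaleR_lip0.rep_eq abs_mult flip: right_diff_distrib)
  also have "\<dots> \<le> \<bar>c\<bar> * (norm f * dist x y)"
    by (intro mult_left_mono lip0_norm_bound) auto
  finally show "\<bar>lip0_apply (c *\<^sub>R f) x - lip0_apply (c *\<^sub>R f) y\<bar> \<le> \<bar>c\<bar> * norm f * dist x y"
    by (simp add: mult.assoc)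
qed (simp add: lip0_norm_nonneg)

instance
proof
  fix f g h :: "'a lip0" and a b :: real
  show "f + g + h = f + (g + h)" "f + g = g + f" "0 + f = f" "- f + f = 0" "f - g = f + - g"
    by (simp_all add: lip0_apply_inject[symmetric] fun_eq_iff zero_lip0.rep_eq plus_lip0.rep_eq
        uminus_lip0.rep_eq minus_lip0.rep_eq)
  show "a *\<^sub>R (f + g) = a *\<^sub>R f + a *\<^sub>R g" "(a + b) *\<^sub>R f = a *\<^sub>R f + b *\<^sub>R f"
    "a *\<^sub>R b *\<^sub>R f = (a * b) *\<^sub>R f" "1 *\<^sub>R f = f"
    by (simp_all add: lip0_apply_inject[symmetric] fun_eq_iff plus_lip0.rep_eq scaleR_lip0.rep_eq
        algebra_simps)
  show "dist f g = norm (f - g)" by (rule dist_lip0_def)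
  show "sgn f = scaleR (inverse (norm f)) f" by (rule sgn_lip0_def)
  show "(uniformity :: ('a lip0 \<times> 'a lip0) filter) = (INF e\<in>{0 <..}. principal {(f, g). dist f g < e})"
    by (rule uniformity_lip0_def)
  show "open U = (\<forall>f\<in>U. \<forall>\<^sub>F (f', g) in uniformity. f' = f \<longrightarrow> g \<in> U)" for U :: "'a lip0 set"
    by (rule open_lip0_def)
  show "norm f = 0 \<longleftrightarrow> f = 0"
  proof
    assume "norm f = 0"
    then show "f = 0"
      using lip0_norm_bound[of f _ 0] by (intro lip0_eqI) (simp add: zero_lip0.rep_eq)
  next
    assume "f = 0"
    then have "norm f \<le> 0"
      by (intro lip0_norm_leI) (auto simp: zero_lip0.rep_eq)
    with lip0_norm_nonneg[of f] show "norm f = 0" by simp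
  qed
  show "norm (f + g) \<le> norm f + norm g"
  proof (rule lip0_norm_leI)
    fix x y
    show "\<bar>lip0_apply (f + g) x - lip0_apply (f + g) y\<bar> \<le> (norm f + norm g) * dist x y"
      using lip0_norm_bound[of f x y] lip0_norm_bound[of g x y]
      by (simp add: plus_lip0.rep_eq distrib_right)
  qed (simp add: lip0_norm_nonneg)
  show "norm (a *\<^sub>R f) = \<bar>a\<bar> * norm f"
  proof (cases "a = 0")
    case True
    have "norm (0 *\<^sub>R f) \<le> 0"
      using lip0_norm_scaleR_le[of 0 f] by simp
    with True lip0_norm_nonneg[of "0 *\<^sub>R f"] show ?thesis by simp
  next
    case False
    have "inverse a *\<^sub>R a *\<^sub>R f = f"
      using False by (simp add: lip0_apply_inject[symmetric] fun_eq_iff scaleR_lip0.rep_eq)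
    then have "norm f \<le> \<bar>inverse a\<bar> * norm (a *\<^sub>R f)"
      using lip0_norm_scaleR_le[of "inverse a" "a *\<^sub>R f"] by simp
    then have "\<bar>a\<bar> * norm f \<le> norm (a *\<^sub>R f)"
      using False by (simp add: field_simps)
    with lip0_norm_scaleR_le[of a f] show ?thesis by simp
  qed
qed

end

lemma lip0_apply_bound: "\<bar>lip0_apply f x\<bar> \<le> norm f * dist x 0"
  using lip0_norm_bound[of f x 0] by simp

instance lip0 :: ("{metric_space, zero}") banach
proof
  fix X :: "nat \<Rightarrow> 'a lip0"
  assume X: "Cauchy X"
  have Cauchy_at: "Cauchy (\<lambda>n. lip0_apply (X n) x)" for x
  proof (rule CauchyI)
    fix e :: real
    assume "e > 0"
    then have "e / (dist x 0 + 1) > 0"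
      by (intro divide_pos_pos add_nonneg_pos) auto
    then obtain N where N: "\<And>m n. m \<ge> N \<Longrightarrow> n \<ge> N \<Longrightarrow> norm (X m - X n) < e / (dist x 0 + 1)"
      using CauchyD[OF X] by blast
    have "norm (lip0_apply (X m) x - lip0_apply (X n) x) < e" if "m \<ge> N" "n \<ge> N" for m n
    proof -
      have "\<bar>lip0_apply (X m - X n) x\<bar> \<le> norm (X m - X n) * dist x 0"
        by (rule lip0_apply_bound)
      also have "\<dots> \<le> norm (X m - X n) * (dist x 0 + 1)"
        by (intro mult_left_mono) auto
      also have "\<dots> < e"
        using N[OF that] by (simp add: less_divide_eq add_nonneg_pos)
      finally show ?thesis
        by (simp add: minus_lip0.rep_eq)
    qed
    then show "\<exists>N. \<forall>m\<ge>N. \<forall>n\<ge>N. norm (lip0_apply (X m) x - lip0_apply (X n) x) < e"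
      by blast
  qed
  define F where "F x = lim (\<lambda>n. lip0_apply (X n) x)" for x
  have F: "(\<lambda>n. lip0_apply (X n) x) \<longlonglongrightarrow> F x" for x
    unfolding F_def using Cauchy_at[of x] by (simp add: Cauchy_convergent_iff convergent_LIMSEQ_iff)
  obtain B where "B > 0" and B: "\<And>n. norm (X n) \<le> B"
    using Cauchy_Bseq[OF X] unfolding Bseq_def by blast
  have "\<bar>F x - F y\<bar> \<le> B * dist x y" for x y
  proof (rule tendsto_upperbound)
    show "(\<lambda>n. \<bar>lip0_apply (X n) x - lip0_apply (X n) y\<bar>) \<longlonglongrightarrow> \<bar>F x - F y\<bar>"
      by (intro tendsto_intros F)
    have "\<bar>lip0_apply (X n) x - lip0_apply (X n) y\<bar> \<le> B * dist x y" for n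
      using lip0_norm_bound[of "X n" x y] mult_right_mono[OF B[of n], of "dist x y"] by simp
    then show "\<forall>\<^sub>F n in sequentially. \<bar>lip0_apply (X n) x - lip0_apply (X n) y\<bar> \<le> B * dist x y"
      by simp
  qed simp
  then have "B-lipschitz_on UNIV F"
    using \<open>B > 0\<close> by (auto simp: lipschitz_on_def dist_real_def)
  moreover have "F 0 = 0"
    using F[of 0] by (simp add: LIMSEQ_const_iff)
  ultimately have apply_F: "lip0_apply (Lip0 F) = F"
    by (intro Lip0_inverse) auto
  have "X \<longlonglongrightarrow> Lip0 F"
  proof (rule LIMSEQ_I)
    fix e :: real
    assume "e > 0"
    then have "e / 2 > 0" by simp
    then obtain N where N: "\<And>m n. m \<ge> N \<Longrightarrow> n \<ge> N \<Longrightarrow> norm (X m - X n) < e / 2"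
      using CauchyD[OF X] by blast
    have "norm (X n - Lip0 F) < e" if "n \<ge> N" for n
    proof -
      have "norm (X n - Lip0 F) \<le> e / 2"
      proof (rule lip0_norm_leI)
        fix x y
        show "\<bar>lip0_apply (X n - Lip0 F) x - lip0_apply (X n - Lip0 F) y\<bar> \<le> e / 2 * dist x y"
          unfolding minus_lip0.rep_eq apply_F
        proof (rule tendsto_upperbound)
          show "(\<lambda>m. \<bar>lip0_apply (X n) x - lip0_apply (X m) x - (lip0_apply (X n) y - lip0_apply (X m) y)\<bar>)
            \<longlonglongrightarrow> \<bar>lip0_apply (X n) x - F x - (lip0_apply (X n) y - F y)\<bar>"
            by (intro tendsto_intros F)
          show "\<forall>\<^sub>F m in sequentially. \<bar>lip0_apply (X n) x - lip0_apply (X m) x -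
            (lip0_apply (X n) y - lip0_apply (X m) y)\<bar> \<le> e / 2 * dist x y"
          proof (rule eventually_sequentiallyI)
            fix m assume "m \<ge> N"
            then have "norm (X n - X m) * dist x y \<le> e / 2 * dist x y"
              using less_imp_le[OF N[OF \<open>n \<ge> N\<close> \<open>m \<ge> N\<close>]] by (intro mult_right_mono) auto
            with lip0_norm_bound[of "X n - X m" x y]
            show "\<bar>lip0_apply (X n) x - lip0_apply (X m) x -
              (lip0_apply (X n) y - lip0_apply (X m) y)\<bar> \<le> e / 2 * dist x y"
              by (simp add: minus_lip0.rep_eq)
          qed
        qed simp
      qed (use \<open>e > 0\<close> in simp)
      with \<open>e > 0\<close> show ?thesis by simp
    qed
    then show "\<exists>N. \<forall>n\<ge>N. norm (X n - Lip0 F) < e" by blast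
  qed
  then show "convergent X" by (rule convergentI)
qed


section \<open>The Lipschitz-free space\<close>

lift_definition lip0_delta :: "'a::{metric_space, zero} \<Rightarrow> ('a lip0 \<Rightarrow>\<^sub>L real)"
  is "\<lambda>m f. lip0_apply f m"
proof -
  fix m :: 'a
  show "bounded_linear (\<lambda>f. lip0_apply f m)"
    by (rule bounded_linear_intro[where K = "dist m 0"])
      (auto simp: plus_lip0.rep_eq scaleR_lip0.rep_eq lip0_apply_bound)
qed

typedef (overloaded) 'a lip_free =
  "closure (span (range (lip0_delta :: 'a::{metric_space, zero} \<Rightarrow> 'a lip0 \<Rightarrow>\<^sub>L real)))"
  morphisms lip_free_functional Lip_free
  by (meson closure_subset span_zero subsetD)

setup_lifting type_definition_lip_free

lemma subspace_lip_free:
  "subspace (closure (span (range (lip0_delta :: 'a::{metric_space, zero} \<Rightarrow> _))))"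
proof (rule subspaceI)
  let ?S = "span (range (lip0_delta :: 'a \<Rightarrow> _))"
  show "0 \<in> closure ?S"
    using closure_subset span_zero by blast
  fix x y c
  assume "x \<in> closure ?S"
  then obtain u where u: "\<And>n. u n \<in> ?S" "u \<longlonglongrightarrow> x"
    by (auto simp: closure_sequential)
  show "c *\<^sub>R x \<in> closure ?S"
    unfolding closure_sequential
    using u by (intro exI[of _ "\<lambda>n. c *\<^sub>R u n"]) (auto intro: span_scale tendsto_intros)
  assume "y \<in> closure ?S"
  then obtain v where v: "\<And>n. v n \<in> ?S" "v \<longlonglongrightarrow> y"
    by (auto simp: closure_sequential)
  show "x + y \<in> closure ?S"
    unfolding closure_sequential
    using u v by (intro exI[of _ "\<lambda>n. u n + v n"]) (auto intro: span_add tendsto_intros)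
qed

instantiation lip_free :: ("{metric_space, zero}") real_normed_vector
begin

lift_definition zero_lip_free :: "'a lip_free" is 0
  by (rule subspace_0[OF subspace_lip_free])

lift_definition plus_lip_free :: "'a lip_free \<Rightarrow> 'a lip_free \<Rightarrow> 'a lip_free" is "(+)"
  by (rule subspace_add[OF subspace_lip_free])

lift_definition uminus_lip_free :: "'a lip_free \<Rightarrow> 'a lip_free" is uminus
  by (rule subspace_neg[OF subspace_lip_free])

lift_definition minus_lip_free :: "'a lip_free \<Rightarrow> 'a lip_free \<Rightarrow> 'a lip_free" is "(-)"
  by (rule subspace_diff[OF subspace_lip_free])

lift_definition scaleR_lip_free :: "real \<Rightarrow> 'a lip_free \<Rightarrow> 'a lip_free" is scaleR
  by (rule subspace_scale[OF subspace_lip_free])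

lift_definition norm_lip_free :: "'a lip_free \<Rightarrow> real" is norm .

definition dist_lip_free :: "'a lip_free \<Rightarrow> 'a lip_free \<Rightarrow> real" where
  "dist_lip_free u v = norm (u - v)"

definition sgn_lip_free :: "'a lip_free \<Rightarrow> 'a lip_free" where
  "sgn_lip_free u = scaleR (inverse (norm u)) u"

definition uniformity_lip_free :: "('a lip_free \<times> 'a lip_free) filter" where
  "uniformity_lip_free = (INF e\<in>{0 <..}. principal {(u, v). dist u v < e})"

definition open_lip_free :: "'a lip_free set \<Rightarrow> bool" where
  "open_lip_free S = (\<forall>u\<in>S. \<forall>\<^sub>F (u', v) in uniformity. u' = u \<longrightarrow> v \<in> S)"

instance
proof
  fix u v w :: "'a lip_free" and a b :: real
  show "u + v + w = u + (v + w)" "u + v = v + u" "0 + u = u" "- u + u = 0" "u - v = u + - v"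
    "a *\<^sub>R (u + v) = a *\<^sub>R u + a *\<^sub>R v" "(a + b) *\<^sub>R u = a *\<^sub>R u + b *\<^sub>R u"
    "a *\<^sub>R b *\<^sub>R u = (a * b) *\<^sub>R u" "1 *\<^sub>R u = u"
    by (simp_all add: lip_free_functional_inject[symmetric] zero_lip_free.rep_eq plus_lip_free.rep_eq
        uminus_lip_free.rep_eq minus_lip_free.rep_eq scaleR_lip_free.rep_eq algebra_simps)
  show "dist u v = norm (u - v)" by (rule dist_lip_free_def)
  show "sgn u = scaleR (inverse (norm u)) u" by (rule sgn_lip_free_def)
  show "(uniformity :: ('a lip_free \<times> 'a lip_free) filter) = (INF e\<in>{0 <..}. principal {(u, v). dist u v < e})"
    by (rule uniformity_lip_free_def)
  show "open U = (\<forall>u\<in>U. \<forall>\<^sub>F (u', v) in uniformity. u' = u \<longrightarrow> v \<in> U)" for U :: "'a lip_free set"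
    by (rule open_lip_free_def)
  show "norm u = 0 \<longleftrightarrow> u = 0" "norm (u + v) \<le> norm u + norm v" "norm (a *\<^sub>R u) = \<bar>a\<bar> * norm u"
    by (simp_all add: lip_free_functional_inject[symmetric] norm_lip_free.rep_eq zero_lip_free.rep_eq
        plus_lip_free.rep_eq scaleR_lip_free.rep_eq norm_triangle_ineq)
qed

end

lemma dist_lip_free_functional:
  "dist (lip_free_functional u) (lip_free_functional v) = dist u v"
  by (simp add: dist_norm norm_lip_free.rep_eq minus_lip_free.rep_eq)

instance lip_free :: ("{metric_space, zero}") banach
proof
  fix X :: "nat \<Rightarrow> 'a lip_free"
  let ?F = "closure (span (range (lip0_delta :: 'a \<Rightarrow> _)))"
  assume "Cauchy X"
  then have "Cauchy (\<lambda>n. lip_free_functional (X n))"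
    by (simp add: Cauchy_def dist_lip_free_functional)
  then obtain l where l: "(\<lambda>n. lip_free_functional (X n)) \<longlonglongrightarrow> l"
    using Cauchy_convergent unfolding convergent_def by blast
  have "l \<in> ?F"
    by (rule closed_sequentially[OF closed_closure _ l]) (rule lip_free_functional)
  then have "lip_free_functional (Lip_free l) = l"
    by (rule Lip_free_inverse)
  with l have "X \<longlonglongrightarrow> Lip_free l"
    unfolding LIMSEQ_def dist_lip_free_functional[symmetric] by simp
  then show "convergent X" by (rule convergentI)
qed


section \<open>Geometry of the unit ball of a Banach space\<close>

definition daugavet_property :: "'b::banach itself \<Rightarrow> bool" where
  "daugavet_property _ \<longleftrightarrow>
     (\<forall>T :: 'b \<Rightarrow>\<^sub>L 'b. dim (range (blinfun_apply T)) = 1 \<longrightarrow> norm (id_blinfun + T) = 1 + norm T)"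

definition strongly_exposed_point :: "'b::banach \<Rightarrow> bool" where
  "strongly_exposed_point x \<longleftrightarrow> x \<in> cball 0 1 \<and>
     (\<exists>f :: 'b \<Rightarrow>\<^sub>L real. f \<noteq> 0 \<and> blinfun_apply f x = (SUP y\<in>cball 0 1. blinfun_apply f y) \<and>
        (\<forall>u :: nat \<Rightarrow> 'b. (\<forall>n. u n \<in> cball 0 1) \<longrightarrow>
           (\<lambda>n. blinfun_apply f (u n)) \<longlonglongrightarrow> blinfun_apply f x \<longrightarrow>
           (\<lambda>n. norm (u n - x)) \<longlonglongrightarrow> 0))"

lift_definition bidual_embedding :: "'b::banach \<Rightarrow> (('b \<Rightarrow>\<^sub>L real) \<Rightarrow>\<^sub>L real)"
  is "\<lambda>x f. blinfun_apply f x"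
  by (intro bounded_linear_intros)

definition preserved_extreme_point :: "'b::banach \<Rightarrow> bool" where
  "preserved_extreme_point x \<longleftrightarrow>
     x \<in> cball 0 1 \<and> bidual_embedding x extreme_point_of cball 0 1"

definition norm_gateaux_differentiable_at :: "'b::banach \<Rightarrow> bool" where
  "norm_gateaux_differentiable_at x \<longleftrightarrow>
     (\<forall>h. \<exists>l. ((\<lambda>t::real. (norm (x + t *\<^sub>R h) - norm x) / t) \<longlongrightarrow> l) (at 0))"

definition norm_frechet_differentiable_at :: "'b::banach \<Rightarrow> bool" where
  "norm_frechet_differentiable_at x \<longleftrightarrow> norm_gateaux_differentiable_at x \<and>
     (\<exists>l. uniform_limit (cball 0 1) (\<lambda>t h. (norm (x + t *\<^sub>R h) - norm x) / t) l (at (0::real)))"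

definition is_slice :: "'b::banach set \<Rightarrow> bool" where
  "is_slice S \<longleftrightarrow> (\<exists>(f :: 'b \<Rightarrow>\<^sub>L real) \<alpha>. f \<noteq> 0 \<and> \<alpha> > 0 \<and>
     S = {x \<in> cball 0 1. blinfun_apply f x > (SUP y\<in>cball 0 1. blinfun_apply f y) - \<alpha>})"

definition weak_topology :: "'b::banach topology" where
  "weak_topology =
     topology_generated_by {blinfun_apply f -` U | (f :: 'b \<Rightarrow>\<^sub>L real) U. open U}"

definition slice_diameter_2_property :: "'b::banach itself \<Rightarrow> bool" where
  "slice_diameter_2_property _ \<longleftrightarrow> (\<forall>S :: 'b set. is_slice S \<longrightarrow> diameter S = 2)"

definition diameter_2_property :: "'b::banach itself \<Rightarrow> bool" where
  "diameter_2_property _ \<longleftrightarrow>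
     (\<forall>W :: 'b set. openin (subtopology weak_topology (cball 0 1)) W \<and> W \<noteq> {} \<longrightarrow> diameter W = 2)"

definition strong_diameter_2_property :: "'b::banach itself \<Rightarrow> bool" where
  "strong_diameter_2_property _ \<longleftrightarrow>
     (\<forall>(n::nat) (c :: nat \<Rightarrow> real) (S :: nat \<Rightarrow> 'b set).
        n \<ge> 1 \<and> (\<forall>i\<in>{1..n}. c i \<ge> 0 \<and> is_slice (S i)) \<and> (\<Sum>i=1..n. c i) = 1 \<longrightarrow>
        diameter {\<Sum>i=1..n. c i *\<^sub>R s i | s. \<forall>i\<in>{1..n}. s i \<in> S i} = 2)"

end

theory Submission
  imports Defs
begin

text \<open>
  Everything is decided by how short pairs of points behave under Lipschitz functions, that is, by the
  molecules: the normalised differences of two evaluations. Molecules belong to the unit ball of the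
  free space, the norm of \<open>Lip\<^sub>0\<close> is the supremum of the slopes over them, and \<open>Lip\<^sub>0\<close> is the dual of the free
  space.

  \<^emph>\<open>Property (Z) against length.\<close> Property (Z) only provides points almost between \<open>x\<close> and \<open>y\<close>, possibly
  very close to one of them. Ekeland's principle, applied to pairs \<open>(a, b)\<close> squeezed between \<open>x\<close> and \<open>y\<close> whose ends
  have moved by at most half the distance, turns this into approximate midpoints
  (\<open>property_Z_imp_length_space\<close>).

  \<^emph>\<open>Failure of property (Z).\<close> If a pair \<open>(x, y)\<close> fails (Z), there is a function \<open>f\<close> of norm 1 whose slope over \<open>(u, v)\<close>
  drops from its maximal value 1 at \<open>(x, y)\<close> at least linearly in the displacement of \<open>(u, v)\<close>. Therefore
  the norm of \<open>Lip\<^sub>0\<close> is affine near \<open>f\<close>, its derivative being the molecule at \<open>(x, y)\<close>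
  (\<open>affine_peak_if_not_property_Z_pair\<close>). This single fact refutes all the remaining assertions: the norm
  is Frechet differentiable at \<open>f\<close>, the molecule is strongly exposed and preserved extreme, it has small
  slices, and subtracting the rank-one projection onto it from the identity gives operators of norm less than 2.

  \<^emph>\<open>Length spaces.\<close> In a length space a steep pair of \<open>f\<close> can be halved again and again without losing
  steepness, at levels of \<open>f\<close> that can be kept apart. So the norm of \<open>f\<close> is nearly attained on infinitely many pairs,
  each much shorter than the radius of a ball around it, with disjoint balls (\<open>separated_steep_pairs_exist\<close>).
  Inside such a ball a function can be given any slope in \<open>[-1, 1]\<close> over the pair at hardly any cost in norm
  (\<open>prescribe_slope\<close>). From this follow the Daugavet property of both spaces, the absence of points of Gateaux
  differentiability, and the strong diameter 2 property. The latter implies the diameter 2 property in any Banach space,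
  since every weakly open subset of the ball contains a convex combination of slices
  (\<open>convex_combination_of_slices_weakly_near\<close>), and it implies the slice diameter 2 property, which leaves no
  room for strongly exposed points. Finally, an element \<open>\<mu>\<close> of the ball is a weak limit of convex combinations of short
  molecules; separating those above from those below a suitable level of a function writes \<open>\<mu>\<close> as a proper
  convex combination in the bidual ball (\<open>not_preserved_extreme_if_length_space\<close>).
\<close>

section \<open>Functionals, slices and rank-one operators\<close>

lemma nonpos_if_le_arbitrary_multiple:
  fixes a K :: real
  assumes "\<And>\<epsilon>. \<epsilon> > 0 \<Longrightarrow> a \<le> K * \<epsilon>"
  shows "a \<le> 0"
proof (rule ccontr)
  assume "\<not> a \<le> 0"
  then have "a > 0" by simp
  then have "a / (\<bar>K\<bar> + 1) > 0" by (intro divide_pos_pos) auto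
  from assms[OF this] have "a * (\<bar>K\<bar> + 1) \<le> K * a" by (simp add: field_simps)
  moreover have "K * a \<le> \<bar>K\<bar> * a" using \<open>a > 0\<close> by (intro mult_right_mono) auto
  ultimately show False using \<open>a > 0\<close> unfolding distrib_left by (simp only: mult.commute)
qed

lemma abs_blinfun_le:
  fixes \<phi> :: "'b::real_normed_vector \<Rightarrow>\<^sub>L real"
  assumes "norm u \<le> 1"
  shows "\<bar>\<phi> u\<bar> \<le> norm \<phi>"
  using norm_blinfun[of \<phi> u] mult_left_mono[OF assms, of "norm \<phi>"] by simp

lemma norm_convex_combination_le:
  fixes s :: "'i \<Rightarrow> 'b::real_normed_vector"
  assumes "\<And>i. i \<in> I \<Longrightarrow> 0 \<le> c i" "\<And>i. i \<in> I \<Longrightarrow> norm (s i) \<le> 1"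
  shows "norm (\<Sum>i\<in>I. c i *\<^sub>R s i) \<le> (\<Sum>i\<in>I. c i)"
  using assms by (intro sum_norm_le) (simp add: mult_left_le)

lemma diameter_le_2:
  fixes S :: "'b::real_normed_vector set"
  assumes "S \<subseteq> cball 0 1"
  shows "diameter S \<le> 2"
proof (rule diameter_le)
  fix u v
  assume "u \<in> S" "v \<in> S"
  with assms have "norm u \<le> 1" "norm v \<le> 1" by auto
  then show "norm (u - v) \<le> 2"
    using norm_triangle_ineq4[of u v] by simp
qed simp

lemma norm_blinfun_less_witness:
  fixes \<phi> :: "'b::real_normed_vector \<Rightarrow>\<^sub>L real"
  assumes "a < norm \<phi>"
  obtains x where "norm x \<le> 1" "a < \<phi> x"
proof (rule ccontr)
  assume "\<not> thesis"
  with that have le: "\<phi> x \<le> a" if "norm x \<le> 1" for x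
    using \<open>norm x \<le> 1\<close> by (meson not_le)
  from le[of 0] have "0 \<le> a" by simp
  have "norm \<phi> \<le> a"
  proof (rule norm_blinfun_bound[OF \<open>0 \<le> a\<close>])
    fix x
    show "norm (\<phi> x) \<le> a * norm x"
    proof (cases "x = 0")
      case False
      have "\<bar>\<phi> x\<bar> / norm x \<le> a"
        using le[of "x /\<^sub>R norm x"] le[of "- x /\<^sub>R norm x"] False
        by (auto simp: blinfun.scaleR_right blinfun.minus_right abs_if divide_inverse_commute)
      with False show ?thesis by (simp add: divide_le_eq)
    qed simp
  qed
  with assms show False by simp
qed

lemma SUP_unit_ball_blinfun:
  fixes \<phi> :: "'b::real_normed_vector \<Rightarrow>\<^sub>L real"
  shows "(SUP y\<in>cball 0 1. \<phi> y) = norm \<phi>"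
proof (rule cSup_eq_non_empty)
  fix a
  assume "a \<in> blinfun_apply \<phi> ` cball 0 1"
  then obtain y where "a = \<phi> y" "norm y \<le> 1" by auto
  then show "a \<le> norm \<phi>" using abs_blinfun_le[of y \<phi>] by simp
next
  fix b
  assume ub: "\<And>a. a \<in> blinfun_apply \<phi> ` cball 0 1 \<Longrightarrow> a \<le> b"
  show "norm \<phi> \<le> b"
  proof (rule ccontr)
    assume "\<not> norm \<phi> \<le> b"
    then obtain x where "norm x \<le> 1" "b < \<phi> x"
      using norm_blinfun_less_witness[of b \<phi>] by (auto simp: not_le)
    with ub[of "\<phi> x"] show False by auto
  qed
qed auto

lemma is_slice_iff:
  "is_slice S \<longleftrightarrow> (\<exists>(\<phi> :: 'b::banach \<Rightarrow>\<^sub>L real) \<alpha>. \<phi> \<noteq> 0 \<and> \<alpha> > 0 \<and>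
     S = {x \<in> cball 0 1. norm \<phi> - \<alpha> < blinfun_apply \<phi> x})"
  unfolding is_slice_def SUP_unit_ball_blinfun by simp

definition rank_one :: "('b::banach \<Rightarrow>\<^sub>L real) \<Rightarrow> 'b \<Rightarrow> 'b \<Rightarrow>\<^sub>L 'b" where
  "rank_one \<phi> e = blinfun_scaleR_left e o\<^sub>L \<phi>"

lemma rank_one_apply [simp]: "rank_one \<phi> e x = \<phi> x *\<^sub>R e"
  by (simp add: rank_one_def)

lemma norm_rank_one: "norm (rank_one \<phi> e) = norm \<phi> * norm e"
proof (cases "e = 0")
  case True
  have "rank_one \<phi> e = 0" by (rule blinfun_eqI) (simp add: True)
  with True show ?thesis by simp
next
  case False
  show ?thesis
  proof (rule antisym)
    show "norm (rank_one \<phi> e) \<le> norm \<phi> * norm e"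
    proof (rule norm_blinfun_bound)
      fix x
      show "norm (rank_one \<phi> e x) \<le> norm \<phi> * norm e * norm x"
        using mult_right_mono[OF norm_blinfun[of \<phi> x], of "norm e"] by (simp add: mult_ac)
    qed simp
    have "norm \<phi> \<le> norm (rank_one \<phi> e) / norm e"
    proof (rule norm_blinfun_bound)
      fix x
      have "\<bar>\<phi> x\<bar> * norm e \<le> norm (rank_one \<phi> e) * norm x"
        using norm_blinfun[of "rank_one \<phi> e" x] by simp
      with False show "norm (\<phi> x) \<le> norm (rank_one \<phi> e) / norm e * norm x"
        by (simp add: field_simps)
    qed simp
    with False show "norm \<phi> * norm e \<le> norm (rank_one \<phi> e)"
      by (simp add: field_simps)
  qed
qed

lemma dim_range_rank_one:
  assumes "\<phi> \<noteq> 0" "e \<noteq> 0"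
  shows "dim (range (blinfun_apply (rank_one \<phi> e))) = 1"
proof -
  obtain x0 where x0: "\<phi> x0 \<noteq> 0"
    using \<open>\<phi> \<noteq> 0\<close> by (metis blinfun_eqI zero_blinfun.rep_eq)
  have "\<exists>x. \<phi> x = c" for c
    using x0 by (intro exI[of _ "(c / \<phi> x0) *\<^sub>R x0"]) (simp add: blinfun.scaleR_right)
  then have "range (blinfun_apply (rank_one \<phi> e)) = span {e}"
    unfolding span_singleton by (auto simp: image_iff) metis
  then have "dim (range (blinfun_apply (rank_one \<phi> e))) = dim {e}"
    by (simp add: dim_span)
  also have "\<dots> = card {e}"
    using \<open>e \<noteq> 0\<close> by (intro dim_eq_card_independent) simp
  finally show ?thesis by simp
qed

lemma rank_one_of_dim_range:
  fixes T :: "'b::banach \<Rightarrow>\<^sub>L 'b"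
  assumes "dim (range (blinfun_apply T)) = 1"
  obtains \<phi> e where "\<phi> \<noteq> 0" "e \<noteq> 0" "T = rank_one \<phi> e"
proof -
  obtain B where B: "B \<subseteq> range T" "range T \<subseteq> span B" "card B = 1"
    using basis_exists[of "range (blinfun_apply T)"] assms by metis
  then obtain e where "B = {e}" by (auto simp: card_1_singleton_iff)
  then obtain x0 where x0: "e = T x0" using B(1) by auto
  have "\<exists>c. T x = c *\<^sub>R e" for x
    using B(2) \<open>B = {e}\<close> by (auto simp: span_singleton)
  then obtain c where c: "\<And>x. T x = c x *\<^sub>R e" by metis
  have "e \<noteq> 0"
  proof
    assume "e = 0"
    then have "range (blinfun_apply T) = span {}" using c by auto
    then have "dim (range (blinfun_apply T)) = card ({} :: 'b set)"
      by (simp only: dim_span dim_eq_card_independent[OF independent_empty])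
    with assms show False by simp
  qed
  have "bounded_linear c"
  proof (rule bounded_linear_intro[where K = "norm T / norm e"])
    fix x y r
    have "c (x + y) *\<^sub>R e = (c x + c y) *\<^sub>R e"
      by (simp add: c[symmetric] blinfun.add_right scaleR_left_distrib)
    with \<open>e \<noteq> 0\<close> show "c (x + y) = c x + c y" by simp
    have "c (r *\<^sub>R x) *\<^sub>R e = (r *\<^sub>R c x) *\<^sub>R e"
      by (simp add: c[symmetric] blinfun.scaleR_right flip: scaleR_scaleR)
    with \<open>e \<noteq> 0\<close> show "c (r *\<^sub>R x) = r *\<^sub>R c x" by simp
    have "\<bar>c x\<bar> * norm e \<le> norm T * norm x"
      using norm_blinfun[of T x] c[of x] by simp
    with \<open>e \<noteq> 0\<close> show "norm (c x) \<le> norm x * (norm T / norm e)"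
      by (simp add: field_simps)
  qed
  then have apply_c: "blinfun_apply (Blinfun c) = c" by (rule bounded_linear_Blinfun_apply)
  show thesis
  proof (rule that[of "Blinfun c" e])
    show "T = rank_one (Blinfun c) e"
      by (rule blinfun_eqI) (simp add: apply_c c)
    show "Blinfun c \<noteq> 0"
    proof
      assume "Blinfun c = 0"
      then have "c x0 = 0" by (metis apply_c zero_blinfun.rep_eq)
      with x0 c[of x0] \<open>e \<noteq> 0\<close> show False by simp
    qed
  qed fact
qed

lemma daugavet_property_iff:
  "daugavet_property TYPE('b::banach) \<longleftrightarrow>
    (\<forall>(\<phi> :: 'b \<Rightarrow>\<^sub>L real) e. \<phi> \<noteq> 0 \<longrightarrow> e \<noteq> 0 \<longrightarrow>
      norm (id_blinfun + rank_one \<phi> e) = 1 + norm \<phi> * norm e)"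
  unfolding daugavet_property_def
  by (metis rank_one_of_dim_range dim_range_rank_one norm_rank_one)

lemma daugavet_propertyI:
  assumes "\<And>(\<phi> :: 'b::banach \<Rightarrow>\<^sub>L real) e \<epsilon>. \<phi> \<noteq> 0 \<Longrightarrow> e \<noteq> 0 \<Longrightarrow>
      0 < \<epsilon> \<Longrightarrow> \<epsilon> < norm \<phi> \<Longrightarrow> \<epsilon> < norm e \<Longrightarrow>
    \<exists>x. norm x \<le> 1 + \<epsilon> \<and> 1 + (norm \<phi> - \<epsilon>) * (norm e - \<epsilon>) - \<epsilon> \<le> norm (x + blinfun_apply \<phi> x *\<^sub>R e)"
  shows "daugavet_property TYPE('b)"
  unfolding daugavet_property_iff
proof (intro allI impI antisym)
  fix \<phi> :: "'b \<Rightarrow>\<^sub>L real" and e :: 'b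
  assume *: "\<phi> \<noteq> 0" "e \<noteq> 0"
  let ?N = "norm (id_blinfun + rank_one \<phi> e)"
  show "?N \<le> 1 + norm \<phi> * norm e"
    using norm_triangle_ineq[of id_blinfun "rank_one \<phi> e"] norm_blinfun_id_le[where 'a='b]
    by (simp add: norm_rank_one)
  have bound: "1 + (norm \<phi> - \<epsilon>) * (norm e - \<epsilon>) - \<epsilon> \<le> ?N * (1 + \<epsilon>)"
    if small: "0 < \<epsilon>" "\<epsilon> < norm \<phi>" "\<epsilon> < norm e" for \<epsilon>
  proof -
    obtain x where x: "norm x \<le> 1 + \<epsilon>"
      "1 + (norm \<phi> - \<epsilon>) * (norm e - \<epsilon>) - \<epsilon> \<le> norm (x + \<phi> x *\<^sub>R e)"
      using assms[OF * small] by blast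
    have "norm (x + \<phi> x *\<^sub>R e) \<le> ?N * norm x"
      using norm_blinfun[of "id_blinfun + rank_one \<phi> e" x] by (simp add: blinfun.add_left)
    also have "\<dots> \<le> ?N * (1 + \<epsilon>)"
      using x(1) by (intro mult_left_mono) auto
    finally show ?thesis using x(2) by linarith
  qed
  show "1 + norm \<phi> * norm e \<le> ?N"
  proof (rule tendsto_le)
    show "\<forall>\<^sub>F \<epsilon> in at_right 0. 1 + (norm \<phi> - \<epsilon>) * (norm e - \<epsilon>) - \<epsilon> \<le> ?N * (1 + \<epsilon>)"
      unfolding eventually_at_right_field
      using bound * by (intro exI[of _ "min (norm \<phi>) (norm e)"]) auto
    have "((\<lambda>\<epsilon>::real. ?N * (1 + \<epsilon>)) \<longlongrightarrow> ?N * (1 + 0)) (at_right 0)"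
      by (intro tendsto_intros)
    then show "((\<lambda>\<epsilon>::real. ?N * (1 + \<epsilon>)) \<longlongrightarrow> ?N) (at_right 0)" by simp
    have "((\<lambda>\<epsilon>::real. 1 + (norm \<phi> - \<epsilon>) * (norm e - \<epsilon>) - \<epsilon>)
      \<longlongrightarrow> 1 + (norm \<phi> - 0) * (norm e - 0) - 0) (at_right 0)"
      by (intro tendsto_intros)
    then show "((\<lambda>\<epsilon>::real. 1 + (norm \<phi> - \<epsilon>) * (norm e - \<epsilon>) - \<epsilon>)
      \<longlongrightarrow> 1 + norm \<phi> * norm e) (at_right 0)" by simp
  qed simp
qed

lemma diameter_eq_2I:
  fixes S :: "'b::real_normed_vector set"
  assumes "S \<subseteq> cball 0 1"
    and "\<And>\<epsilon>. \<epsilon> > 0 \<Longrightarrow> \<exists>u\<in>S. \<exists>v\<in>S. 2 - \<epsilon> \<le> norm (u - v)"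
  shows "diameter S = 2"
proof (rule antisym)
  show "diameter S \<le> 2" by (rule diameter_le_2) fact
  show "2 \<le> diameter S"
  proof (rule field_le_epsilon)
    fix \<epsilon> :: real
    assume "\<epsilon> > 0"
    then obtain u v where uv: "u \<in> S" "v \<in> S" "2 - \<epsilon> \<le> norm (u - v)" using assms(2) by blast
    have "bounded S" using assms(1) bounded_cball bounded_subset by blast
    with uv have "norm (u - v) \<le> diameter S"
      by (metis diameter_bounded_bound dist_norm)
    with uv(3) show "2 \<le> diameter S + \<epsilon>" by simp
  qed
qed

section \<open>Lipschitz functions, molecules and the duality\<close>

lemma McShane_extension:
  fixes k :: "'a::metric_space \<Rightarrow> real"
  assumes "A \<noteq> {}" and "\<And>a b. a \<in> A \<Longrightarrow> b \<in> A \<Longrightarrow> k a - k b \<le> C * dist a b" and "C \<ge> 0"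
  obtains g where "\<And>a. a \<in> A \<Longrightarrow> g a = k a" "\<And>x y. \<bar>g x - g y\<bar> \<le> C * dist x y"
proof -
  define g where "g x = (INF a\<in>A. k a + C * dist x a)" for x
  obtain a0 where "a0 \<in> A" using assms(1) by blast
  have lower: "k a0 - C * dist a0 x \<le> k a + C * dist x a" if "a \<in> A" for a x
  proof -
    have "k a0 - k a \<le> C * dist a0 a" using assms(2) \<open>a0 \<in> A\<close> that by blast
    also have "\<dots> \<le> C * (dist a0 x + dist x a)"
      using \<open>C \<ge> 0\<close> by (intro mult_left_mono dist_triangle)
    finally show ?thesis by (simp add: algebra_simps)
  qed
  have bdd: "bdd_below ((\<lambda>a. k a + C * dist x a) ` A)" for x
    using lower by (intro bdd_belowI2)
  have one_sided: "g x - g y \<le> C * dist x y" for x y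
  proof -
    have "g x - C * dist x y \<le> g y"
      unfolding g_def[of y]
    proof (rule cINF_greatest[OF assms(1)])
      fix a
      assume "a \<in> A"
      then have "g x \<le> k a + C * dist x a"
        unfolding g_def by (rule cINF_lower[OF bdd])
      also have "\<dots> \<le> k a + C * (dist x y + dist y a)"
        using \<open>C \<ge> 0\<close> by (intro add_left_mono mult_left_mono dist_triangle)
      finally show "g x - C * dist x y \<le> k a + C * dist y a"
        by (simp add: algebra_simps)
    qed
    then show ?thesis by simp
  qed
  show thesis
  proof
    show "\<bar>g x - g y\<bar> \<le> C * dist x y" for x y
      using one_sided[of x y] one_sided[of y x] by (simp add: abs_le_iff dist_commute)
    fix a
    assume "a \<in> A"
    show "g a = k a"
    proof (rule antisym)
      show "g a \<le> k a"
        using cINF_lower[OF bdd \<open>a \<in> A\<close>, of a] by (simp add: g_def)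
      show "k a \<le> g a"
        unfolding g_def using assms(2)[OF \<open>a \<in> A\<close>]
        by (intro cINF_greatest[OF assms(1)]) (force simp: algebra_simps)
    qed
  qed
qed

lemma lip0_of_function:
  fixes k :: "'a::{metric_space, zero} \<Rightarrow> real"
  assumes "\<And>x y. \<bar>k x - k y\<bar> \<le> C * dist x y" "k 0 = 0" "C \<ge> 0"
  obtains f where "lip0_apply f = k" "norm f \<le> C"
proof -
  have "C-lipschitz_on UNIV k"
    using assms by (auto simp: lipschitz_on_def dist_real_def)
  then have *: "lip0_apply (Lip0 k) = k"
    using assms(2) by (intro Lip0_inverse) auto
  moreover have "norm (Lip0 k) \<le> C"
    using assms by (intro lip0_norm_leI) (simp_all add: *)
  ultimately show thesis by (rule that)
qed

definition slope :: "'a::{metric_space, zero} lip0 \<Rightarrow> 'a \<Rightarrow> 'a \<Rightarrow> real" where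
  "slope f x y = (lip0_apply f x - lip0_apply f y) / dist x y"

lemma slope_le_norm: "slope f x y \<le> norm f"
  using lip0_norm_bound[of f x y]
  by (cases "x = y") (auto simp: slope_def divide_le_eq)

lemma slope_add: "slope (f + g) x y = slope f x y + slope g x y"
  by (simp add: slope_def plus_lip0.rep_eq diff_divide_distrib add_divide_distrib)

lemma slope_diff: "slope (f - g) x y = slope f x y - slope g x y"
  by (simp add: slope_def minus_lip0.rep_eq diff_divide_distrib add_divide_distrib)

lemma slope_scaleR: "slope (c *\<^sub>R f) x y = c * slope f x y"
  by (simp add: slope_def scaleR_lip0.rep_eq right_diff_distrib)

lemma slope_minus: "slope (- f) x y = - slope f x y"
  by (simp add: slope_def uminus_lip0.rep_eq diff_divide_distrib)

lemma abs_slope_le_norm: "\<bar>slope f x y\<bar> \<le> norm f"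
  using slope_le_norm[of f x y] slope_le_norm[of "-f" x y] by (simp add: slope_minus)

lemma lip0_norm_le_slopeI:
  assumes "K \<ge> 0" "\<And>x y. x \<noteq> y \<Longrightarrow> slope f x y \<le> K"
  shows "norm f \<le> K"
proof (rule lip0_norm_leI[OF \<open>K \<ge> 0\<close>])
  fix x y
  show "\<bar>lip0_apply f x - lip0_apply f y\<bar> \<le> K * dist x y"
    using assms(2)[of x y] assms(2)[of y x]
    by (cases "x = y") (auto simp: slope_def divide_le_eq dist_commute)
qed

lemma steep_pair_exists:
  assumes "0 \<le> a" "a < norm f"
  obtains x y where "x \<noteq> y" "a < slope f x y"
  using lip0_norm_le_slopeI[of a f] assms by (meson not_le)

lemma slope_eq_1_exists:
  fixes x :: "'a::{metric_space, zero}"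
  assumes "x \<noteq> 0"
  obtains f where "slope f x 0 = 1"
proof -
  have "\<bar>dist u 0 - dist v 0\<bar> \<le> 1 * dist u v" for u v :: 'a
    using dist_triangle[of u 0 v] dist_triangle[of v 0 u] by (simp add: dist_commute abs_le_iff)
  then obtain f :: "'a lip0" where f: "lip0_apply f = (\<lambda>u. dist u 0)"
    by (rule lip0_of_function) auto
  have "slope f x 0 = 1" using assms by (simp add: slope_def f)
  then show thesis by (rule that)
qed

definition pairing :: "'a::{metric_space, zero} lip_free \<Rightarrow> 'a lip0 \<Rightarrow> real" where
  "pairing u f = lip_free_functional u f"

lemma pairing_add_left: "pairing (u + v) f = pairing u f + pairing v f"
  and pairing_diff_left: "pairing (u - v) f = pairing u f - pairing v f"
  and pairing_minus_left: "pairing (- u) f = - pairing u f"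
  and pairing_scaleR_left: "pairing (c *\<^sub>R u) f = c * pairing u f"
  and pairing_zero_left: "pairing 0 f = 0"
  by (simp_all add: pairing_def plus_lip_free.rep_eq minus_lip_free.rep_eq scaleR_lip_free.rep_eq
      uminus_lip_free.rep_eq zero_lip_free.rep_eq
      blinfun.add_left blinfun.diff_left blinfun.minus_left blinfun.scaleR_left)

lemma pairing_add_right: "pairing u (f + g) = pairing u f + pairing u g"
  and pairing_diff_right: "pairing u (f - g) = pairing u f - pairing u g"
  and pairing_minus_right: "pairing u (- f) = - pairing u f"
  and pairing_scaleR_right: "pairing u (c *\<^sub>R f) = c * pairing u f"
  by (simp_all add: pairing_def blinfun.add_right blinfun.diff_right blinfun.minus_right
      blinfun.scaleR_right)

lemmas pairing_simps = pairing_add_left pairing_diff_left pairing_minus_left pairing_scaleR_left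
  pairing_zero_left pairing_add_right pairing_diff_right pairing_minus_right pairing_scaleR_right

lemma pairing_sum_left: "pairing (\<Sum>i\<in>I. u i) f = (\<Sum>i\<in>I. pairing (u i) f)"
  by (induction I rule: infinite_finite_induct) (simp_all add: pairing_simps)

lemma abs_pairing_le: "\<bar>pairing u f\<bar> \<le> norm u * norm f"
  using norm_blinfun[of "lip_free_functional u" f] by (simp add: pairing_def norm_lip_free.rep_eq)

lemma pairing_le: "norm u \<le> 1 \<Longrightarrow> pairing u f \<le> norm f"
  using abs_pairing_le[of u f] mult_right_mono[of "norm u" 1 "norm f"] by simp

lemma pairing_le_norm: "norm h \<le> C \<Longrightarrow> pairing u h \<le> norm u * C"
  using abs_pairing_le[of u h] mult_left_mono[of "norm h" C "norm u"] by simp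

lemma norm_lip_free_less_witness:
  assumes "a < norm u"
  obtains h where "norm h \<le> 1" "a < pairing u h"
  using norm_blinfun_less_witness[of a "lip_free_functional u"] assms
  by (auto simp: pairing_def norm_lip_free.rep_eq)

lemma norm_lip_free_leI:
  assumes "\<And>h. norm h \<le> 1 \<Longrightarrow> pairing u h \<le> a"
  shows "norm u \<le> a"
proof (rule ccontr)
  assume "\<not> norm u \<le> a"
  then obtain h where "norm h \<le> 1" "a < pairing u h"
    using norm_lip_free_less_witness[of a u] by auto
  with assms[of h] show False by simp
qed

definition free_delta :: "'a::{metric_space, zero} \<Rightarrow> 'a lip_free" where
  "free_delta m = Lip_free (lip0_delta m)"

lemma functional_free_delta: "lip_free_functional (free_delta m) = lip0_delta m"
  unfolding free_delta_def
  by (intro Lip_free_inverse subsetD[OF closure_subset] span_base) simp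

lemma pairing_free_delta [simp]: "pairing (free_delta m) f = lip0_apply f m"
  by (simp add: pairing_def functional_free_delta lip0_delta.rep_eq)

definition molecule :: "'a::{metric_space, zero} \<Rightarrow> 'a \<Rightarrow> 'a lip_free" where
  "molecule x y = (free_delta x - free_delta y) /\<^sub>R dist x y"

lemma pairing_molecule [simp]: "pairing (molecule x y) f = slope f x y"
  by (simp add: molecule_def slope_def pairing_simps divide_inverse_commute)

lemma norm_molecule_le: "norm (molecule x y) \<le> 1"
  by (rule norm_lip_free_leI) (metis order_trans pairing_molecule slope_le_norm)

text \<open>The span of the evaluations is dense. This carries both the weak\<open>*\<close> continuity of the elements of the
  free space on bounded sets of Lipschitz functions and the possibility of changing a test function
  away from finitely many points.\<close>

lemma pairing_finite_approximation:
  fixes u :: "'a::{metric_space, zero} lip_free"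
  assumes "\<epsilon> > 0"
  obtains N c where "finite N" "\<And>f. \<bar>pairing u f - (\<Sum>z\<in>N. c z * lip0_apply f z)\<bar> \<le> \<epsilon> * norm f"
proof -
  have "lip_free_functional u \<in> closure (span (range lip0_delta))"
    by (rule lip_free_functional)
  then obtain v where v: "v \<in> span (range lip0_delta)" "dist v (lip_free_functional u) < \<epsilon>"
    using assms by (auto simp: closure_approachable)
  from v(1) obtain t r where t: "finite t" "t \<subseteq> range lip0_delta" "v = (\<Sum>a\<in>t. r a *\<^sub>R a)"
    by (auto simp: span_explicit)
  obtain N where N: "N \<subseteq> UNIV" "inj_on lip0_delta N" "t = lip0_delta ` N"
    using t(2) by (metis subset_image_inj)
  have "finite N" using t(1) N by (simp add: finite_image_iff)
  have v_eq: "v f = (\<Sum>z\<in>N. r (lip0_delta z) * lip0_apply f z)" for f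
    unfolding t(3) N(3) by (simp add: sum.reindex[OF N(2)] blinfun.sum_left blinfun.scaleR_left
        lip0_delta.rep_eq)
  show thesis
  proof (rule that[OF \<open>finite N\<close>])
    fix f
    have "\<bar>pairing u f - v f\<bar> = norm ((lip_free_functional u - v) f)"
      by (simp add: pairing_def blinfun.diff_left)
    also have "\<dots> \<le> norm (lip_free_functional u - v) * norm f" by (rule norm_blinfun)
    also have "\<dots> \<le> \<epsilon> * norm f"
      using v(2) by (intro mult_right_mono) (simp_all add: dist_norm norm_minus_commute)
    finally show "\<bar>pairing u f - (\<Sum>z\<in>N. r (lip0_delta z) * lip0_apply f z)\<bar> \<le> \<epsilon> * norm f"
      by (simp add: v_eq)
  qed
qed

text \<open>The dual of the free space is \<open>Lip\<^sub>0\<close>.\<close>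

lift_definition lip0_functional :: "'a::{metric_space, zero} lip0 \<Rightarrow> 'a lip_free \<Rightarrow>\<^sub>L real"
  is "\<lambda>f u. pairing u f"
proof -
  fix f :: "'a lip0"
  show "bounded_linear (\<lambda>u. pairing u f)"
    by (rule bounded_linear_intro[where K = "norm f"]) (auto simp: pairing_simps abs_pairing_le)
qed

lemma norm_lip0_functional [simp]: "norm (lip0_functional f) = norm f"
proof (rule antisym)
  show "norm (lip0_functional f) \<le> norm f"
    by (rule norm_blinfun_bound)
      (auto simp: lip0_functional.rep_eq mult.commute intro: order_trans[OF abs_pairing_le])
  show "norm f \<le> norm (lip0_functional f)"
  proof (rule lip0_norm_le_slopeI)
    fix x y :: 'a
    show "slope f x y \<le> norm (lip0_functional f)"
      using abs_blinfun_le[OF norm_molecule_le, of "lip0_functional f" x y]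
      by (simp add: lip0_functional.rep_eq)
  qed simp
qed

lemma lip0_functional_eq_0_iff [simp]: "lip0_functional f = 0 \<longleftrightarrow> f = 0"
  by (metis norm_lip0_functional norm_eq_zero)

lemma lip0_functional_surj:
  fixes \<phi> :: "'a::{metric_space, zero} lip_free \<Rightarrow>\<^sub>L real"
  obtains f where "\<phi> = lip0_functional f"
proof -
  have delta0: "free_delta (0::'a) = 0"
    unfolding norm_le_zero_iff[symmetric] by (rule norm_lip_free_leI) simp
  have lip: "\<bar>\<phi> (free_delta x) - \<phi> (free_delta y)\<bar> \<le> norm \<phi> * dist x y" for x y
  proof (cases "x = y")
    case False
    then have "free_delta x - free_delta y = dist x y *\<^sub>R molecule x y"
      by (simp add: molecule_def)
    then have "\<phi> (free_delta x) - \<phi> (free_delta y) = dist x y * \<phi> (molecule x y)"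
      by (metis blinfun.diff_right blinfun.scaleR_right real_scaleR_def)
    moreover have "\<bar>\<phi> (molecule x y)\<bar> \<le> norm \<phi>"
      by (rule abs_blinfun_le[OF norm_molecule_le])
    ultimately show ?thesis
      using mult_left_mono[of "\<bar>\<phi> (molecule x y)\<bar>" "norm \<phi>" "dist x y"] by (simp add: abs_mult mult_ac)
  qed simp
  obtain f where f: "lip0_apply f = (\<lambda>x. \<phi> (free_delta x))"
    by (rule lip0_of_function[OF lip]) (auto simp: delta0)
  let ?\<psi> = "\<phi> - lip0_functional f"
  have "?\<psi> u = 0" for u
  proof -
    have "\<bar>?\<psi> u\<bar> \<le> norm ?\<psi> * \<epsilon>" if "\<epsilon> > 0" for \<epsilon>
    proof -
      have "\<exists>v. ?\<psi> v = 0 \<and> norm (u - v) \<le> \<epsilon>"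
      proof -
        obtain N c where N: "finite N"
          "\<And>g. \<bar>pairing u g - (\<Sum>z\<in>N. c z * lip0_apply g z)\<bar> \<le> \<epsilon> * norm g"
          using pairing_finite_approximation[OF \<open>\<epsilon> > 0\<close>, of u] by blast
        let ?v = "\<Sum>z\<in>N. c z *\<^sub>R free_delta z"
        have "norm (u - ?v) \<le> \<epsilon>"
        proof (rule norm_lip_free_leI)
          fix h :: "'a lip0"
          assume "norm h \<le> 1"
          then have "\<epsilon> * norm h \<le> \<epsilon> * 1" using \<open>\<epsilon> > 0\<close> by (intro mult_left_mono) auto
          then show "pairing (u - ?v) h \<le> \<epsilon>"
            using N(2)[of h] by (simp add: pairing_simps pairing_sum_left)
        qed
        moreover have "?\<psi> ?v = 0"
          by (simp add: blinfun.sum_right blinfun.scaleR_right blinfun.diff_left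
              lip0_functional.rep_eq f)
        ultimately show ?thesis by blast
      qed
      then obtain v where v: "?\<psi> v = 0" "norm (u - v) \<le> \<epsilon>" by blast
      have "\<bar>?\<psi> u\<bar> = norm (?\<psi> (u - v))" using v(1) by (simp add: blinfun.diff_right)
      also have "\<dots> \<le> norm ?\<psi> * norm (u - v)" by (rule norm_blinfun)
      also have "\<dots> \<le> norm ?\<psi> * \<epsilon>" using v(2) by (intro mult_left_mono) auto
      finally show ?thesis .
    qed
    from nonpos_if_le_arbitrary_multiple[OF this] show "?\<psi> u = 0" by simp
  qed
  then have "\<phi> = lip0_functional f"
    by (intro blinfun_eqI) (simp add: blinfun.diff_left)
  then show thesis by (rule that)
qed

section \<open>Property (Z) and length spaces\<close>

text \<open>A form of Ekeland's variational principle. Descend so that \<open>F\<close> comes closer and closer to its infimum over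
  the current lower set. Then the diameters of the lower sets tend to 0, and by completeness there is exactly one
  point in all of them.\<close>

lemma Ekeland_minimal_element:
  fixes R :: "'p::complete_space \<Rightarrow> 'p \<Rightarrow> bool" and F :: "'p \<Rightarrow> real"
  assumes refl: "\<And>p. R p p"
    and trans: "\<And>p q r. R p q \<Longrightarrow> R q r \<Longrightarrow> R p r"
    and closed: "\<And>p. closed {q. R q p}"
    and decrease: "\<And>p q. R q p \<Longrightarrow> c * dist q p \<le> F p - F q"
    and bounded: "\<And>p. 0 \<le> F p" and "c > 0"
  obtains m where "R m p0" "\<And>q. R q m \<Longrightarrow> q = m"
proof -
  have step: "\<exists>q. R q p \<and> (\<forall>r. R r q \<longrightarrow> F q \<le> F r + e)" if "e > 0" for p and e :: real
  proof -
    have bdd: "bdd_below (F ` {q. R q p})" using bounded by (intro bdd_belowI2)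
    have ne: "{q. R q p} \<noteq> {}" using refl by blast
    obtain q where q: "R q p" "F q < Inf (F ` {q. R q p}) + e"
      using cInf_less_iff[OF _ bdd, of "Inf (F ` {q. R q p}) + e"] ne \<open>e > 0\<close> by auto
    moreover have "Inf (F ` {q. R q p}) \<le> F r" if "R r q" for r
      using trans[OF that q(1)] by (intro cINF_lower[OF bdd]) simp
    ultimately show ?thesis by fastforce
  qed
  define nxt where "nxt n p = (SOME q. R q p \<and> (\<forall>r. R r q \<longrightarrow> F q \<le> F r + (1/2)^n))" for n :: nat and p
  have nxt: "R (nxt n p) p" "\<And>r. R r (nxt n p) \<Longrightarrow> F (nxt n p) \<le> F r + (1/2)^n" for n p
    using someI_ex[OF step[of "(1/2)^n" p]] unfolding nxt_def by auto
  define s where "s = rec_nat (nxt 0 p0) (\<lambda>n p. nxt (Suc n) p)"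
  have s0: "s 0 = nxt 0 p0" and sS: "s (Suc n) = nxt (Suc n) (s n)" for n
    by (simp_all add: s_def)
  have approx: "F (s n) \<le> F r + (1/2)^n" if "R r (s n)" for n r
    using that nxt(2) by (cases n) (simp_all only: s0 sS)
  have descending: "R (s n) (s m)" if "m \<le> n" for m n
    using that
  proof (induction n rule: dec_induct)
    case base show ?case by (rule refl)
  next
    case (step n)
    have "R (s (Suc n)) (s n)" unfolding sS by (rule nxt(1))
    then show ?case using step.IH by (rule trans)
  qed
  have near: "dist r (s m) \<le> (1/2)^m / c" if "R r (s m)" for r m
  proof -
    have "c * dist r (s m) \<le> (1/2)^m"
      using decrease[OF that] approx[OF that] by linarith
    with \<open>c > 0\<close> show ?thesis by (simp add: field_simps)
  qed
  have vanish: "(\<lambda>m. (1/2)^m / c :: real) \<longlonglongrightarrow> 0"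
    by (intro tendsto_divide_zero LIMSEQ_realpow_zero) auto
  have "Cauchy s"
    unfolding Cauchy_altdef
  proof (intro allI impI)
    fix e :: real
    assume "e > 0"
    obtain N where N: "\<And>m. m \<ge> N \<Longrightarrow> (1/2)^m / c < e"
      using order_tendstoD(2)[OF vanish \<open>e > 0\<close>] unfolding eventually_sequentially by auto
    have "dist (s m) (s n) < e" if "m \<ge> N" "n > m" for m n
      using near[OF descending[of m n]] N[OF \<open>m \<ge> N\<close>] \<open>n > m\<close> by (simp add: dist_commute)
    then show "\<exists>M. \<forall>m\<ge>M. \<forall>n>m. dist (s m) (s n) < e" by blast
  qed
  then obtain m where m: "s \<longlonglongrightarrow> m"
    using Cauchy_convergent unfolding convergent_def by blast
  have below: "R m (s k)" for k
  proof -
    have "m \<in> {q. R q (s k)}"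
    proof (rule Lim_in_closed_set[OF closed _ _ m])
      show "\<forall>\<^sub>F n in sequentially. s n \<in> {q. R q (s k)}"
        using descending by (auto intro: eventually_sequentiallyI)
    qed simp
    then show ?thesis by simp
  qed
  show thesis
  proof
    have "R (s 0) p0" unfolding s0 by (rule nxt(1))
    with below[of 0] show "R m p0" by (rule trans)
    fix q
    assume "R q m"
    then have "dist q (s k) \<le> (1/2)^k / c" for k
      using near trans below by blast
    then have "(\<lambda>k. dist q (s k)) \<longlonglongrightarrow> 0"
      by (intro tendsto_sandwich[OF _ _ tendsto_const vanish]) auto
    then have "s \<longlonglongrightarrow> q"
      using tendsto_dist_iff by (metis (no_types, lifting) dist_commute ext)
    with m show "q = m" by (metis LIMSEQ_unique)
  qed
qed

text \<open>To find an approximate midpoint of \<open>x\<close> and \<open>y\<close>, shrink the gap \<open>(x, y)\<close> from both sides, paying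
  almost nothing for the moves and never moving an end by more than \<open>dist x y / 2\<close>. A minimal gap
  \<open>(a, b)\<close> exists by Ekeland's principle. If \<open>a = b\<close>, this point is a midpoint. Otherwise property (Z) gives \<open>z\<close>
  almost between \<open>a\<close> and \<open>b\<close>, and whichever of \<open>a, b\<close> is replaced by \<open>z\<close>, the cost is small compared
  with the distance moved; so by minimality both moves violate the constraint. Hence \<open>z\<close> is more
  than \<open>dist x y / 2\<close> away from both ends, while the whole path through \<open>z\<close> is hardly longer than
  \<open>dist x y\<close>.\<close>

lemma property_Z_imp_length_space:
  assumes "property_Z TYPE('a::complete_space)"
  shows "length_space TYPE('a)"
  unfolding length_space_def
proof (intro allI impI)
  fix x y :: 'a and \<delta> :: real
  assume "\<delta> > 0"
  define D where "D = dist x y"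
  have "D \<ge> 0" by (simp add: D_def)
  define e where "e = min (1/2) (\<delta> / (6 * (D + 1)))"
  have e: "e > 0" "e \<le> 1/2" "6 * e * D \<le> \<delta>"
  proof -
    show "e > 0" using \<open>\<delta> > 0\<close> \<open>D \<ge> 0\<close> by (simp add: e_def)
    show "e \<le> 1/2" unfolding e_def by (rule min.cobounded1)
    have "e \<le> \<delta> / (6 * (D + 1))" by (simp add: e_def)
    then have "6 * e * (D + 1) \<le> \<delta>" using \<open>D \<ge> 0\<close> by (simp add: field_simps)
    moreover have "6 * e * D \<le> 6 * e * (D + 1)"
      using \<open>e > 0\<close> by (intro mult_left_mono) auto
    ultimately show "6 * e * D \<le> \<delta>" by linarith
  qed
  define K where "K = {p::'a\<times>'a. dist x (fst p) \<le> D / 2 \<and> dist (snd p) y \<le> D / 2}"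
  \<comment> \<open>The constraint is an implication so that \<open>S\<close> is reflexive on all pairs, not only on those in \<open>K\<close>.\<close>
  define S where "S q p \<longleftrightarrow> (1 - e) * (dist (fst q) (fst p) + dist (snd q) (snd p))
      \<le> dist (fst p) (snd p) - dist (fst q) (snd q) \<and> (p \<in> K \<longrightarrow> q \<in> K)" for q p :: "'a \<times> 'a"
  obtain m where m: "S m (x, y)" "\<And>q. S q m \<Longrightarrow> q = m"
  proof (rule Ekeland_minimal_element[of S "1/2" "\<lambda>p. dist (fst p) (snd p)" "(x, y)"])
    fix p q r :: "'a \<times> 'a"
    show "S p p" by (simp add: S_def)
    show "S p r" if "S p q" "S q r"
    proof -
      have "(1 - e) * (dist (fst p) (fst r) + dist (snd p) (snd r))
        \<le> (1 - e) * ((dist (fst p) (fst q) + dist (fst q) (fst r)) + (dist (snd p) (snd q) + dist (snd q) (snd r)))"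
        using e by (intro mult_left_mono add_mono dist_triangle) auto
      with that show ?thesis by (auto simp: S_def algebra_simps)
    qed
    have "closed K"
      unfolding K_def by (intro closed_Collect_conj closed_Collect_le continuous_intros)
    have "{q. S q p} = {q. (1 - e) * (dist (fst q) (fst p) + dist (snd q) (snd p))
      \<le> dist (fst p) (snd p) - dist (fst q) (snd q)} \<inter> (if p \<in> K then K else UNIV)"
      by (auto simp: S_def)
    also have "closed \<dots>"
      using \<open>closed K\<close> by (intro closed_Int closed_Collect_le continuous_intros) auto
    finally show "closed {q. S q p}" .
    show "1/2 * dist q p \<le> dist (fst p) (snd p) - dist (fst q) (snd q)" if "S q p"
    proof -
      have "dist q p \<le> dist (fst q) (fst p) + dist (snd q) (snd p)"
        unfolding dist_prod_def by (rule sqrt_sum_squares_le_sum) auto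
      then have "1/2 * dist q p \<le> (1 - e) * (dist (fst q) (fst p) + dist (snd q) (snd p))"
        using e by (intro mult_mono) auto
      with that show ?thesis by (simp add: S_def)
    qed
  qed auto
  define a b where "a = fst m" and "b = snd m"
  have m_eq: "m = (a, b)" by (simp add: a_def b_def)
  have "m \<in> K" using m(1) \<open>D \<ge> 0\<close> by (simp add: S_def K_def)
  then have ab: "dist x a \<le> D / 2" "dist b y \<le> D / 2" by (simp_all add: K_def m_eq)
  have cost: "(1 - e) * (dist x a + dist b y) \<le> D - dist a b"
    using m(1) by (simp add: S_def m_eq D_def dist_commute)
  show "\<exists>z. max (dist x z) (dist z y) \<le> dist x y / 2 + \<delta>"
  proof (cases "a = b")
    case True
    with ab \<open>\<delta> > 0\<close> show ?thesis by (intro exI[of _ a]) (auto simp: D_def)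
  next
    case False
    then obtain z where z: "z \<noteq> a" "z \<noteq> b" "dist a z + dist z b \<le> dist a b + e * min (dist a z) (dist z b)"
      using assms e(1) unfolding property_Z_def property_Z_pair_def by (metis insertI1 insertI2)
    have min: "e * min (dist a z) (dist z b) \<le> e * dist a z" "e * min (dist a z) (dist z b) \<le> e * dist z b"
      using e(1) by (auto intro: mult_left_mono)
    have "\<not> S (z, b) m" using m(2)[of "(z, b)"] z by (auto simp: m_eq)
    moreover have "(1 - e) * dist z a \<le> dist a b - dist z b"
      using z(3) min(1) by (simp add: algebra_simps dist_commute)
    ultimately have xz: "D / 2 < dist x z"
      using ab by (auto simp: S_def m_eq K_def)
    have "\<not> S (a, z) m" using m(2)[of "(a, z)"] z by (auto simp: m_eq)
    moreover have "(1 - e) * dist z b \<le> dist a b - dist a z"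
      using z(3) min(2) by (simp add: algebra_simps)
    ultimately have zy: "D / 2 < dist z y"
      using ab by (auto simp: S_def m_eq K_def)
    have "e * (dist x a + dist b y) \<le> e * D"
      using ab e(1) by (intro mult_left_mono) auto
    with cost have path: "dist x a + dist a b + dist b y \<le> D + e * D"
      by (simp add: algebra_simps)
    have "dist a b \<le> D + e * D" using path zero_le_dist[of x a] zero_le_dist[of b y] by linarith
    moreover have "e * D \<le> 1/2 * D" using e \<open>D \<ge> 0\<close> by (intro mult_right_mono) auto
    ultimately have "dist a b \<le> 2 * D" using \<open>D \<ge> 0\<close> by linarith
    have "e * min (dist a z) (dist z b) \<le> 1/2 * min (dist a z) (dist z b)"
      using e by (intro mult_right_mono) auto
    then have "min (dist a z) (dist z b) \<le> dist a b"
      using z(3) min.cobounded1[of "dist a z" "dist z b"] min.cobounded2[of "dist a z" "dist z b"]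
        zero_le_dist[of a z] zero_le_dist[of z b] by linarith
    then have "e * min (dist a z) (dist z b) \<le> e * (2 * D)"
      using e(1) \<open>dist a b \<le> 2 * D\<close> by (intro mult_left_mono) auto
    then have "dist x z + dist z y \<le> D + 3 * (e * D)"
      using z(3) path dist_triangle[of x z a] dist_triangle[of z y b] by linarith
    with xz zy e(3) \<open>\<delta> > 0\<close> show ?thesis
      by (intro exI[of _ z]) (auto simp: D_def)
  qed
qed

lemma length_space_imp_property_Z:
  assumes "length_space TYPE('a::complete_space)"
  shows "property_Z TYPE('a)"
  unfolding property_Z_def property_Z_pair_def
proof (intro allI impI)
  fix x y :: 'a and e :: real
  assume "x \<noteq> y" "e > 0"
  define D where "D = dist x y"
  define \<delta> where "\<delta> = min (D / 4) (e * D / 8)"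
  have "D > 0" using \<open>x \<noteq> y\<close> by (simp add: D_def)
  then have \<delta>: "\<delta> > 0" "\<delta> \<le> D / 4" "\<delta> \<le> e * D / 8"
    using \<open>e > 0\<close> unfolding \<delta>_def by auto
  obtain z where z: "max (dist x z) (dist z y) \<le> D / 2 + \<delta>"
    using assms \<delta>(1) unfolding length_space_def D_def by blast
  then have "dist x z \<le> D / 2 + \<delta>" "dist z y \<le> D / 2 + \<delta>" by auto
  moreover have "D \<le> dist x z + dist z y" unfolding D_def by (rule dist_triangle)
  ultimately have far: "D / 4 \<le> dist x z" "D / 4 \<le> dist z y" using \<delta> by linarith+
  then have "e * (D / 4) \<le> e * min (dist x z) (dist z y)"
    using \<open>e > 0\<close> by (intro mult_left_mono) auto
  then have "dist x z + dist z y \<le> D + e * min (dist x z) (dist z y)"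
    using z \<delta>(3) by auto
  moreover have "z \<notin> {x, y}" using far \<open>D > 0\<close> by auto
  ultimately show "\<exists>z. z \<notin> {x, y} \<and> dist x z + dist z y \<le> dist x y + e * min (dist x z) (dist z y)"
    unfolding D_def by blast
qed

theorem property_Z_iff_length_space:
  "property_Z TYPE('a::complete_space) \<longleftrightarrow> length_space TYPE('a)"
  using property_Z_imp_length_space length_space_imp_property_Z by blast

section \<open>Pairs failing property (Z)\<close>

text \<open>The function \<open>f\<close> peaks at the pair \<open>(x, y)\<close> so strongly that the norm of \<open>Lip\<^sub>0\<close> is affine on a whole ball
  around \<open>f\<close>, with the molecule at \<open>(x, y)\<close> as its derivative.\<close>

definition affine_peak :: "'a::{metric_space, zero} lip0 \<Rightarrow> 'a \<Rightarrow> 'a \<Rightarrow> real \<Rightarrow> bool" where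
  "affine_peak f x y t \<longleftrightarrow>
    x \<noteq> y \<and> t > 0 \<and> (\<forall>h. norm h \<le> t \<longrightarrow> norm (f + h) = 1 + slope h x y)"

lemma slope_diff_le_displacement:
  assumes "u \<noteq> v" "x \<noteq> y"
  shows "\<bar>slope h u v - slope h x y\<bar> \<le> 2 * norm h * ((dist u x + dist v y) / dist u v)"
proof -
  let ?h = "lip0_apply h" and ?s = "dist u x + dist v y"
  have "dist x y \<le> dist u v + ?s" "dist u v \<le> dist x y + ?s"
    using dist_triangle[of x y u] dist_triangle[of u y v] dist_triangle[of u v x] dist_triangle[of x v y]
    by (simp_all add: dist_commute)
  then have "\<bar>dist x y - dist u v\<bar> \<le> ?s" by linarith
  then have A: "\<bar>slope h x y * (dist x y - dist u v)\<bar> \<le> norm h * ?s"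
    unfolding abs_mult by (intro mult_mono abs_slope_le_norm) auto
  have B: "\<bar>(?h u - ?h v) - (?h x - ?h y)\<bar> \<le> norm h * ?s"
    using lip0_norm_bound[of h u x] lip0_norm_bound[of h v y] by (simp add: distrib_left)
  have "slope h u v * dist u v = ?h u - ?h v" "slope h x y * dist x y = ?h x - ?h y"
    using assms by (simp_all add: slope_def)
  then have "(slope h u v - slope h x y) * dist u v
      = ((?h u - ?h v) - (?h x - ?h y)) + slope h x y * (dist x y - dist u v)"
    by (simp add: algebra_simps)
  with A B have "\<bar>(slope h u v - slope h x y) * dist u v\<bar> \<le> 2 * norm h * ?s" by linarith
  then have "\<bar>slope h u v - slope h x y\<bar> * dist u v \<le> 2 * norm h * ?s"
    by (simp add: abs_mult)
  with \<open>u \<noteq> v\<close> show ?thesis by (simp add: field_simps)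
qed

text \<open>Failure of property (Z) says that a detour from \<open>x\<close> to \<open>y\<close> through \<open>z\<close> costs a fixed proportion \<open>e\<close> of the
  distance from \<open>z\<close> to the nearer end. So a function that falls from \<open>x\<close> and rises from \<open>y\<close> with a slope
  \<open>b\<close> slightly less than 1 until it reaches its middle level is still 1-Lipschitz, and its slope over
  \<open>(u, v)\<close> loses an amount proportional to the displacement of \<open>(u, v)\<close> from \<open>(x, y)\<close>. A small perturbation
  \<open>h\<close> gains over \<open>(u, v)\<close> at most a small multiple of this displacement, which is why the maximal slope
  stays at \<open>(x, y)\<close>.\<close>

lemma affine_peak_if_not_property_Z_pair:
  fixes x y :: "'a::{metric_space, zero}"
  assumes "x \<noteq> y" "\<not> property_Z_pair x y"
  obtains f t where "affine_peak f x y t"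
proof -
  obtain e0 where e0: "e0 > 0"
    "\<And>z. z \<notin> {x, y} \<Longrightarrow> dist x y + e0 * min (dist x z) (dist z y) < dist x z + dist z y"
    using assms(2) unfolding property_Z_pair_def by (meson not_le)
  define e where "e = min e0 1"
  have e: "0 < e" "e \<le> 1" using e0(1) by (auto simp: e_def)
  define D where "D = dist x y"
  have "D > 0" using assms(1) by (simp add: D_def)
  have detour: "D + e * min (dist z x) (dist z y) \<le> dist z x + dist z y" for z
  proof (cases "z \<in> {x, y}")
    case False
    have "e * min (dist z x) (dist z y) \<le> e0 * min (dist z x) (dist z y)"
      by (intro mult_right_mono) (auto simp: e_def)
    with e0(2)[OF False] show ?thesis by (simp add: dist_commute D_def)
  qed (auto simp: D_def dist_commute)
  \<comment> \<open>Averaging the detour inequalities for \<open>u\<close> and \<open>v\<close> bounds \<open>dist u v\<close> from below by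
    \<open>D - (1 - e / 2) * (dist u x + dist v y)\<close>, so \<open>b\<close> has to lie strictly between \<open>1 - e / 2\<close> and 1.\<close>
  define b where "b = 1 - e / 8"
  have b: "0 \<le> b" "b \<le> 1" "7/8 \<le> b" using e by (auto simp: b_def)
  define p where "p u = max 0 (D / 2 - b * dist u x)" for u
  define q where "q u = max 0 (D / 2 - b * dist u y)" for u
  define g where "g u = p u - q u" for u
  have nearer: "r \<le> s" if "D + e * min r s \<le> r + s" "b * r < D / 2" "0 \<le> s" for r s
  proof (rule ccontr)
    assume "\<not> r \<le> s"
    with that have "D + e * s \<le> r + s" "s < r" by (auto simp: min_def)
    moreover have "(1 - e) * s \<le> (1 - e) * r" using e \<open>s < r\<close> by (intro mult_left_mono) auto
    moreover have "0 < e * r" using e \<open>s < r\<close> \<open>0 \<le> s\<close> by simp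
    ultimately show False using that(2) by (simp add: b_def algebra_simps)
  qed
  have p_pos: "D - (1 - e) * dist u x \<le> dist u y" if "p u > 0" for u
    using nearer[OF detour, of u] detour[of u] that
    by (auto simp: p_def algebra_simps split: if_splits)
  have q_pos: "D - (1 - e) * dist v y \<le> dist v x" if "q v > 0" for v
    using nearer[of "dist v y" "dist v x"] detour[of v] that
    by (auto simp: q_def algebra_simps min.commute split: if_splits)
  have p_lip: "p u - p v \<le> b * dist u v" for u v
  proof -
    have "b * dist v x \<le> b * (dist u v + dist u x)"
      using dist_triangle[of v x u] b(1) by (intro mult_left_mono) (auto simp: dist_commute)
    moreover have "0 \<le> b * dist u v" using b(1) by simp
    ultimately show ?thesis unfolding p_def distrib_left by linarith
  qed
  have q_lip: "q v - q u \<le> b * dist u v" for u v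
  proof -
    have "b * dist u y \<le> b * (dist u v + dist v y)"
      using dist_triangle[of u y v] b(1) by (intro mult_left_mono) auto
    moreover have "0 \<le> b * dist u v" using b(1) by simp
    ultimately show ?thesis unfolding q_def distrib_left by linarith
  qed
  have slope_loss: "g u - g v \<le> b * dist u v \<or>
      g u - g v \<le> dist u v - 3 * e / 8 * (dist u x + dist v y)" for u v
  proof (cases "p u > 0 \<and> q v > 0")
    case True
    let ?A = "dist u x" and ?B = "dist v y"
    have "p u = D / 2 - b * ?A" "q v = D / 2 - b * ?B" "0 \<le> p v" "0 \<le> q u"
      using True by (auto simp: p_def q_def max_def split: if_splits)
    then have "g u - g v \<le> D - b * (?A + ?B)" by (simp add: g_def algebra_simps)
    then have 1: "g u - g v \<le> D - ?A - ?B + E / 8 + F / 8"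
      if "E = e * ?A" "F = e * ?B" for E F using that by (simp add: b_def algebra_simps add_divide_distrib)
    have "D - (1 - e) * ?A \<le> dist u v + ?B" "D - (1 - e) * ?B \<le> dist u v + ?A"
      using p_pos[of u] q_pos[of v] True dist_triangle[of u y v] dist_triangle[of v x u]
      by (simp_all add: dist_commute)
    then have 2: "D - ?A + E \<le> dist u v + ?B" "D - ?B + F \<le> dist u v + ?A"
      if "E = e * ?A" "F = e * ?B" for E F using that by (simp_all add: algebra_simps)
    have "g u - g v \<le> dist u v - 3 / 8 * (e * ?A + e * ?B)"
      using 1[OF refl refl] 2[OF refl refl] by argo
    then show ?thesis by (simp add: algebra_simps add_divide_distrib)
  next
    case False
    have "0 \<le> p u" "0 \<le> q v" "0 \<le> p v" "0 \<le> q u" by (auto simp: p_def q_def)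
    with False have "p u = 0 \<or> q v = 0" by auto
    then have "g u - g v \<le> b * dist u v"
      using p_lip[of u v] q_lip[of v u] \<open>0 \<le> p v\<close> \<open>0 \<le> q u\<close> by (auto simp: g_def)
    then show ?thesis ..
  qed
  have one_sided: "g u - g v \<le> dist u v" for u v
  proof -
    have "b * dist u v \<le> 1 * dist u v" using b by (intro mult_right_mono) auto
    moreover have "0 \<le> 3 * e / 8 * (dist u x + dist v y)" using e by simp
    ultimately show ?thesis using slope_loss[of u v] by linarith
  qed
  have "\<bar>(g u - g 0) - (g v - g 0)\<bar> \<le> 1 * dist u v" for u v
    using one_sided[of u v] one_sided[of v u] by (simp add: dist_commute)
  then obtain f where f: "lip0_apply f = (\<lambda>u. g u - g 0)"
    by (rule lip0_of_function[of "\<lambda>u. g u - g 0" 1]) auto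
  have "D / 2 - b * D \<le> 0" using mult_right_mono[OF b(3), of D] \<open>D > 0\<close> by simp
  then have "g x = D / 2" "g y = - (D / 2)"
    using \<open>D > 0\<close> by (auto simp: g_def p_def q_def D_def dist_commute)
  then have slope_xy: "slope f x y = 1"
    using \<open>D > 0\<close> by (simp add: slope_def f D_def)
  have slope_f: "slope f u v \<le> b \<or> slope f u v \<le> 1 - 3 * e / 8 * ((dist u x + dist v y) / dist u v)"
    if "u \<noteq> v" for u v
  proof -
    have eq: "slope f u v = (g u - g v) / dist u v" by (simp add: slope_def f)
    show ?thesis
      using slope_loss[of u v]
    proof
      assume "g u - g v \<le> b * dist u v"
      then show ?thesis using that by (simp add: eq divide_le_eq)
    next
      assume "g u - g v \<le> dist u v - 3 * e / 8 * (dist u x + dist v y)"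
      then have "slope f u v \<le> (dist u v - 3 * e / 8 * (dist u x + dist v y)) / dist u v"
        unfolding eq by (intro divide_right_mono) auto
      then show ?thesis using that by (simp add: diff_divide_distrib)
    qed
  qed
  have "affine_peak f x y (e / 16)"
    unfolding affine_peak_def
  proof (intro conjI allI impI antisym)
    fix h :: "'a lip0"
    assume h: "norm h \<le> e / 16"
    have "slope (f + h) x y \<le> norm (f + h)" by (rule slope_le_norm)
    then show "1 + slope h x y \<le> norm (f + h)" by (simp add: slope_add slope_xy)
    show "norm (f + h) \<le> 1 + slope h x y"
    proof (rule lip0_norm_le_slopeI)
      show "0 \<le> 1 + slope h x y" using abs_slope_le_norm[of h x y] h e by linarith
      fix u v :: 'a
      assume "u \<noteq> v"
      let ?s = "(dist u x + dist v y) / dist u v"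
      from slope_f[OF \<open>u \<noteq> v\<close>] show "slope (f + h) u v \<le> 1 + slope h x y"
      proof
        assume "slope f u v \<le> b"
        then show ?thesis
          using abs_slope_le_norm[of h x y] abs_slope_le_norm[of h u v] h
          by (simp add: slope_add b_def)
      next
        assume A: "slope f u v \<le> 1 - 3 * e / 8 * ?s"
        have "\<bar>slope h u v - slope h x y\<bar> \<le> 2 * norm h * ?s"
          using slope_diff_le_displacement[OF \<open>u \<noteq> v\<close> \<open>x \<noteq> y\<close>] .
        also have "\<dots> \<le> 3 * e / 8 * ?s"
          using h e by (intro mult_right_mono divide_nonneg_nonneg) auto
        finally show ?thesis using A unfolding slope_add by linarith
      qed
    qed
  qed (use assms e in auto)
  then show thesis by (rule that)
qed

lemma affine_peak_norm_eq_1: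
  assumes "affine_peak f x y t"
  shows "norm f = 1"
  using assms by (auto simp: affine_peak_def slope_def zero_lip0.rep_eq dest: spec[of _ 0])

lemma affine_peak_slope_eq_1:
  assumes "affine_peak f x y t"
  shows "slope f x y = 1"
proof -
  have "t > 0" using assms by (simp add: affine_peak_def)
  have "norm (f + t *\<^sub>R f) = norm ((1 + t) *\<^sub>R f)" by (simp add: scaleR_left_distrib)
  also have "\<dots> = 1 + t" using affine_peak_norm_eq_1[OF assms] \<open>t > 0\<close> by simp
  finally have "1 + t = 1 + slope (t *\<^sub>R f) x y"
    using assms affine_peak_norm_eq_1[OF assms] by (simp add: affine_peak_def)
  with \<open>t > 0\<close> show ?thesis by (simp add: slope_scaleR)
qed

lemma affine_peak_norm_molecule:
  assumes "affine_peak f x y t"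
  shows "norm (molecule x y) = 1"
  using abs_pairing_le[of "molecule x y" f] norm_molecule_le[of x y]
    affine_peak_slope_eq_1[OF assms] affine_peak_norm_eq_1[OF assms] by simp

text \<open>Testing a point of the unit ball against the perturbations of \<open>f\<close> shows that it is close to the molecule
  as soon as \<open>f\<close> is close to its maximum there.\<close>

lemma affine_peak_exposes:
  assumes "affine_peak f x y t" "norm u \<le> 1"
  shows "norm (u - molecule x y) \<le> (1 - pairing u f) / t"
proof (rule norm_lip_free_leI)
  fix h :: "'a lip0"
  assume h: "norm h \<le> 1"
  have "t > 0" using assms by (simp add: affine_peak_def)
  have "norm (t *\<^sub>R h) \<le> t" using h \<open>t > 0\<close> by (simp add: mult_left_le)
  have "pairing u (f + t *\<^sub>R h) \<le> norm (f + t *\<^sub>R h)" using assms(2) by (rule pairing_le)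
  also have "\<dots> = 1 + slope (t *\<^sub>R h) x y"
    using assms(1) \<open>norm (t *\<^sub>R h) \<le> t\<close> by (simp add: affine_peak_def)
  finally have "t * (pairing u h - slope h x y) \<le> 1 - pairing u f"
    by (simp add: pairing_simps slope_scaleR algebra_simps)
  with \<open>t > 0\<close> show "pairing (u - molecule x y) h \<le> (1 - pairing u f) / t"
    by (simp add: pairing_simps field_simps)
qed

lemma affine_peak_strongly_exposed_point:
  fixes x y :: "'a::{metric_space, zero}"
  assumes "affine_peak f x y t"
  shows "strongly_exposed_point (molecule x y)"
  unfolding strongly_exposed_point_def SUP_unit_ball_blinfun
proof (intro conjI exI[of _ "lip0_functional f"] allI impI)
  note one = affine_peak_norm_eq_1[OF assms] affine_peak_slope_eq_1[OF assms]
  show "lip0_functional f \<noteq> 0" using one by auto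
  show "lip0_functional f (molecule x y) = norm (lip0_functional f)"
    using one by (simp add: lip0_functional.rep_eq)
  fix u :: "nat \<Rightarrow> 'a lip_free"
  assume u: "\<forall>n. u n \<in> cball 0 1"
    "(\<lambda>n. lip0_functional f (u n)) \<longlonglongrightarrow> lip0_functional f (molecule x y)"
  then have lim: "(\<lambda>n. pairing (u n) f) \<longlonglongrightarrow> 1" using one by (simp add: lip0_functional.rep_eq)
  have "t \<noteq> 0" using assms by (simp add: affine_peak_def)
  have "(\<lambda>n. (1 - pairing (u n) f) / t) \<longlonglongrightarrow> (1 - 1) / t"
    by (intro tendsto_intros lim \<open>t \<noteq> 0\<close>)
  then have bound: "(\<lambda>n. (1 - pairing (u n) f) / t) \<longlonglongrightarrow> 0" by simp
  have "norm (u n - molecule x y) \<le> (1 - pairing (u n) f) / t" for n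
    using affine_peak_exposes[OF assms, of "u n"] u(1) by simp
  then show "(\<lambda>n. norm (u n - molecule x y)) \<longlonglongrightarrow> 0"
    by (intro tendsto_sandwich[OF always_eventually always_eventually tendsto_const bound]) auto
qed (simp add: norm_molecule_le)

text \<open>An element of the bidual unit ball stays below the norm, which is affine near \<open>f\<close>. If it attains the norm at
  \<open>f\<close>, it therefore agrees with the derivative of the norm there, the molecule.\<close>

lemma affine_peak_preserved_extreme_point:
  fixes x y :: "'a::{metric_space, zero}"
  assumes "affine_peak f x y t"
  shows "preserved_extreme_point (molecule x y)"
proof -
  note one = affine_peak_norm_eq_1[OF assms] affine_peak_slope_eq_1[OF assms]
  have "t > 0" using assms by (simp add: affine_peak_def)
  let ?J = "bidual_embedding (molecule x y)"
  have J: "?J (lip0_functional h) = slope h x y" for h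
    by (simp add: bidual_embedding.rep_eq lip0_functional.rep_eq)
  have le: "U (lip0_functional h) \<le> norm h" if "norm U \<le> 1" for U :: "('a lip_free \<Rightarrow>\<^sub>L real) \<Rightarrow>\<^sub>L real" and h
    using norm_blinfun[of U "lip0_functional h"] mult_right_mono[OF that, of "norm h"] by simp
  have functional_add: "lip0_functional (g + h) = lip0_functional g + lip0_functional h" for g h :: "'a lip0"
    by (rule blinfun_eqI) (simp add: lip0_functional.rep_eq pairing_simps blinfun.add_left)
  have functional_scaleR: "lip0_functional (c *\<^sub>R h) = c *\<^sub>R lip0_functional h" for c and h :: "'a lip0"
    by (rule blinfun_eqI) (simp add: lip0_functional.rep_eq pairing_simps blinfun.scaleR_left)
  have unique: "U = ?J" if U: "norm U \<le> 1" "blinfun_apply U (lip0_functional f) = 1" for U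
  proof -
    have upper: "U (lip0_functional h) \<le> slope h x y" for h
    proof -
      define c where "c = t / (norm h + 1)"
      have "c > 0" using \<open>t > 0\<close> by (auto simp: c_def intro!: divide_pos_pos add_nonneg_pos)
      have "norm (c *\<^sub>R h) \<le> t"
        using mult_left_mono[of "norm h" "norm h + 1" t] \<open>t > 0\<close>
        by (simp add: c_def divide_le_eq add_nonneg_pos)
      then have "norm (f + c *\<^sub>R h) = 1 + c * slope h x y"
        using assms by (simp add: affine_peak_def slope_scaleR)
      with le[OF U(1), of "f + c *\<^sub>R h"] U(2) have "c * U (lip0_functional h) \<le> c * slope h x y"
        by (simp add: functional_add functional_scaleR blinfun.add_right blinfun.scaleR_right)
      with \<open>c > 0\<close> show ?thesis by simp
    qed
    have "U (lip0_functional h) = slope h x y" for h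
      using upper[of h] upper[of "- 1 *\<^sub>R h"]
      by (simp only: functional_scaleR blinfun.scaleR_right slope_scaleR) simp
    then have "U \<phi> = ?J \<phi>" for \<phi>
      using lip0_functional_surj[of \<phi>] J by metis
    then show ?thesis by (rule blinfun_eqI)
  qed
  have "norm ?J \<le> 1"
  proof (rule norm_blinfun_bound)
    fix \<phi> :: "'a lip_free \<Rightarrow>\<^sub>L real"
    show "norm (?J \<phi>) \<le> 1 * norm \<phi>"
      using abs_blinfun_le[OF norm_molecule_le] by (simp add: bidual_embedding.rep_eq)
  qed simp
  moreover have "?J \<notin> open_segment U V" if "norm U \<le> 1" "norm V \<le> 1" for U V
  proof
    assume "?J \<in> open_segment U V"
    then obtain s where s: "U \<noteq> V" "0 < s" "s < 1" "?J = (1 - s) *\<^sub>R U + s *\<^sub>R V"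
      by (auto simp: in_segment)
    let ?F = "lip0_functional f"
    have "1 = (1 - s) * U ?F + s * V ?F"
      using J[of f] one(2) by (simp add: s(4) blinfun.add_left blinfun.scaleR_left)
    moreover have F: "U ?F \<le> 1" "V ?F \<le> 1" using le[OF that(1), of f] le[OF that(2), of f] one by auto
    ultimately have "(1 - s) * (1 - U ?F) + s * (1 - V ?F) = 0" by (simp add: algebra_simps)
    moreover have "0 \<le> (1 - s) * (1 - U ?F)" "0 \<le> s * (1 - V ?F)" using F s by simp_all
    ultimately have "(1 - s) * (1 - U ?F) = 0" "s * (1 - V ?F) = 0" by linarith+
    then have "U ?F = 1" "V ?F = 1" using s by auto
    with unique that s(1) show False by blast
  qed
  ultimately show ?thesis
    unfolding preserved_extreme_point_def extreme_point_of_def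
    using norm_molecule_le[of x y] by auto
qed

lemma affine_peak_difference_quotient:
  assumes "affine_peak f x y t" "s \<noteq> 0" "\<bar>s\<bar> * norm h \<le> t"
  shows "(norm (f + s *\<^sub>R h) - norm f) / s = slope h x y"
  using assms affine_peak_norm_eq_1[OF assms(1)] by (simp add: affine_peak_def slope_scaleR)

lemma affine_peak_frechet_differentiable:
  fixes f :: "'a::{metric_space, zero} lip0"
  assumes "affine_peak f x y t"
  shows "norm_frechet_differentiable_at f"
  unfolding norm_frechet_differentiable_at_def norm_gateaux_differentiable_at_def
proof (intro conjI allI)
  have "t > 0" using assms by (simp add: affine_peak_def)
  let ?Q = "\<lambda>s h. (norm (f + s *\<^sub>R h) - norm f) / s"
  show "\<exists>l. ((\<lambda>s. ?Q s h) \<longlongrightarrow> l) (at 0)" for h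
  proof
    have pos: "t / (norm h + 1) > 0"
      using \<open>t > 0\<close> by (intro divide_pos_pos add_nonneg_pos) auto
    have "?Q s h = slope h x y" if "s \<noteq> 0" "\<bar>s\<bar> < t / (norm h + 1)" for s
    proof (rule affine_peak_difference_quotient[OF assms that(1)])
      have "\<bar>s\<bar> * (norm h + 1) \<le> t" using that(2) by (simp add: less_divide_eq add_nonneg_pos)
      then show "\<bar>s\<bar> * norm h \<le> t" by (simp add: distrib_left)
    qed
    then have "\<forall>\<^sub>F s in at 0. ?Q s h = slope h x y"
      using pos unfolding eventually_at dist_real_def by (metis diff_zero)
    then show "((\<lambda>s. ?Q s h) \<longlongrightarrow> slope h x y) (at 0)" by (rule tendsto_eventually)
  qed
  show "\<exists>l. uniform_limit (cball 0 1) ?Q l (at 0)"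
  proof (intro exI uniform_limitI)
    fix e :: real
    assume "e > 0"
    have "dist (?Q s h) (slope h x y) < e" if "s \<noteq> 0" "\<bar>s\<bar> < t" "h \<in> cball 0 1" for s h
    proof -
      have "\<bar>s\<bar> * norm h \<le> \<bar>s\<bar> * 1" using that(3) by (intro mult_left_mono) auto
      then have "\<bar>s\<bar> * norm h \<le> t" using that(2) by simp
      then have "?Q s h = slope h x y"
        by (rule affine_peak_difference_quotient[OF assms that(1)])
      with \<open>e > 0\<close> show ?thesis by simp
    qed
    then show "\<forall>\<^sub>F s in at 0. \<forall>h\<in>cball 0 1. dist (?Q s h) (slope h x y) < e"
      using \<open>t > 0\<close> unfolding eventually_at dist_real_def by (metis diff_zero)
  qed
qed

lemma affine_peak_slice:
  assumes "affine_peak f x y t"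
  defines "S \<equiv> {u \<in> cball 0 1. 1 - t / 4 < pairing u f}"
  shows "is_slice S" "openin (subtopology weak_topology (cball 0 1)) S" "S \<noteq> {}" "diameter S < 2"
proof -
  have "t > 0" using assms by (simp add: affine_peak_def)
  note one = affine_peak_norm_eq_1[OF assms(1)] affine_peak_slope_eq_1[OF assms(1)]
  show "is_slice S"
    unfolding is_slice_iff S_def using one \<open>t > 0\<close>
    by (intro exI[of _ "lip0_functional f"] exI[of _ "t / 4"]) (auto simp: lip0_functional.rep_eq)
  let ?H = "blinfun_apply (lip0_functional f) -` {1 - t / 4<..}"
  have "openin weak_topology ?H"
    unfolding weak_topology_def
    by (rule topology_generated_by_Basis, rule CollectI, rule exI[of _ "lip0_functional f"],
        rule exI[of _ "{1 - t / 4<..}"]) simp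
  then have "openin (subtopology weak_topology (cball 0 1)) (?H \<inter> cball 0 1)"
    by (rule openin_subtopology_Int)
  also have "?H \<inter> cball 0 1 = S" by (auto simp: S_def lip0_functional.rep_eq)
  finally show "openin (subtopology weak_topology (cball 0 1)) S" .
  have "molecule x y \<in> S" using one \<open>t > 0\<close> by (simp add: S_def norm_molecule_le)
  then show "S \<noteq> {}" by blast
  have near: "norm (u - molecule x y) \<le> 1 / 4" if "u \<in> S" for u
  proof -
    have "(1 - pairing u f) / t \<le> 1 / 4" using that \<open>t > 0\<close> by (simp add: S_def field_simps)
    moreover have "norm u \<le> 1" using that by (simp add: S_def)
    ultimately show ?thesis using affine_peak_exposes[OF assms(1)] order_trans by blast
  qed
  have "diameter S \<le> 1"
  proof (rule diameter_le)
    fix u v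
    assume "u \<in> S" "v \<in> S"
    then show "norm (u - v) \<le> 1"
      using near[of u] near[of v] norm_triangle_ineq4[of "u - molecule x y" "v - molecule x y"] by simp
  qed simp
  then show "diameter S < 2" by simp
qed

text \<open>Up to the sign of \<open>u\<close>, either \<open>f\<close> is nearly maximal at \<open>u\<close>, and then \<open>u\<close> is close to the molecule itself,
  or it is not, and then the subtracted multiple of the molecule is shorter than 1 by a fixed amount.\<close>

lemma affine_peak_projection_bound:
  assumes "affine_peak f x y t"
  obtains \<alpha> where "\<alpha> > 0"
    "\<And>u. norm u \<le> 1 \<Longrightarrow> norm (u - pairing u f *\<^sub>R molecule x y) \<le> 2 - \<alpha>"
proof -
  let ?m = "molecule x y"
  have "t > 0" using assms by (simp add: affine_peak_def)
  define \<alpha> where "\<alpha> = min (1/2) (t / 2)"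
  have \<alpha>: "\<alpha> > 0" "\<alpha> \<le> 1/2" "\<alpha> / t \<le> 1/2" using \<open>t > 0\<close> by (auto simp: \<alpha>_def field_simps)
  have nonneg: "norm (u - pairing u f *\<^sub>R ?m) \<le> 2 - \<alpha>" if "norm u \<le> 1" "0 \<le> pairing u f" for u
  proof (cases "1 - \<alpha> \<le> pairing u f")
    case True
    have "pairing u f \<le> 1" using pairing_le[OF that(1), of f] affine_peak_norm_eq_1[OF assms] by simp
    have "u - pairing u f *\<^sub>R ?m = (u - ?m) + (1 - pairing u f) *\<^sub>R ?m"
      by (simp add: algebra_simps)
    then have "norm (u - pairing u f *\<^sub>R ?m) \<le> norm (u - ?m) + \<bar>1 - pairing u f\<bar> * norm ?m"
      by (metis norm_triangle_ineq norm_scaleR)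
    also have "\<dots> \<le> \<alpha> / t + \<alpha>"
    proof (rule add_mono)
      have "(1 - pairing u f) / t \<le> \<alpha> / t" using True \<open>t > 0\<close> by (intro divide_right_mono) auto
      with affine_peak_exposes[OF assms that(1)] show "norm (u - ?m) \<le> \<alpha> / t" by linarith
      show "\<bar>1 - pairing u f\<bar> * norm ?m \<le> \<alpha>"
        using True \<open>pairing u f \<le> 1\<close> affine_peak_norm_molecule[OF assms] by simp
    qed
    finally show ?thesis using \<alpha> by linarith
  next
    case False
    have "norm (u - pairing u f *\<^sub>R ?m) \<le> norm u + \<bar>pairing u f\<bar> * norm ?m"
      by (metis norm_triangle_ineq4 norm_scaleR)
    with False that show ?thesis using affine_peak_norm_molecule[OF assms] by simp
  qed
  show thesis
  proof (rule that[OF \<alpha>(1)])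
    fix u :: "'a lip_free"
    assume "norm u \<le> 1"
    show "norm (u - pairing u f *\<^sub>R ?m) \<le> 2 - \<alpha>"
    proof (cases "0 \<le> pairing u f")
      case False
      then show ?thesis
        using nonneg[of "- u"] \<open>norm u \<le> 1\<close> norm_minus_cancel[of "u - pairing u f *\<^sub>R ?m"]
        by (simp add: pairing_simps)
    qed (use nonneg \<open>norm u \<le> 1\<close> in blast)
  qed
qed

lemma affine_peak_not_daugavet_lip_free:
  fixes x y :: "'a::{metric_space, zero}"
  assumes "affine_peak f x y t"
  shows "\<not> daugavet_property TYPE('a lip_free)"
proof
  assume D: "daugavet_property TYPE('a lip_free)"
  obtain \<alpha> where \<alpha>: "\<alpha> > 0"
    "\<And>u. norm u \<le> 1 \<Longrightarrow> norm (u - pairing u f *\<^sub>R molecule x y) \<le> 2 - \<alpha>"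
    using affine_peak_projection_bound[OF assms] by blast
  note one = affine_peak_norm_eq_1[OF assms] affine_peak_norm_molecule[OF assms]
  let ?T = "id_blinfun + rank_one (lip0_functional f) (- molecule x y)"
  have "f \<noteq> 0" "molecule x y \<noteq> 0" using one by auto
  then have "norm ?T = 1 + norm (lip0_functional f) * norm (- molecule x y)"
    using D unfolding daugavet_property_iff by (metis lip0_functional_eq_0_iff neg_equal_0_iff_equal)
  then have "norm ?T = 2" using one by simp
  moreover have "norm ?T \<le> 2 - \<alpha>"
  proof (rule norm_blinfun_bound)
    show "0 \<le> 2 - \<alpha>" using \<alpha>(2)[of 0] by (simp add: pairing_simps)
    fix u
    show "norm (?T u) \<le> (2 - \<alpha>) * norm u"
    proof (cases "u = 0")
      case False
      let ?v = "u /\<^sub>R norm u"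
      have "?T u = norm u *\<^sub>R (?v - pairing ?v f *\<^sub>R molecule x y)"
        using False by (simp add: blinfun.add_left lip0_functional.rep_eq pairing_simps scaleR_right_diff_distrib)
      then have "norm (?T u) = norm u * norm (?v - pairing ?v f *\<^sub>R molecule x y)" by simp
      also have "\<dots> \<le> norm u * (2 - \<alpha>)" using False by (intro mult_left_mono \<alpha>(2)) auto
      finally show ?thesis by (simp add: mult.commute)
    qed simp
  qed
  ultimately show False using \<alpha>(1) by simp
qed

lemma affine_peak_not_daugavet_lip0:
  fixes x y :: "'a::{metric_space, zero}"
  assumes "affine_peak f x y t"
  shows "\<not> daugavet_property TYPE('a lip0)"
proof
  assume D: "daugavet_property TYPE('a lip0)"
  let ?m = "molecule x y"
  obtain \<alpha> where \<alpha>: "\<alpha> > 0" "\<And>u. norm u \<le> 1 \<Longrightarrow> norm (u - pairing u f *\<^sub>R ?m) \<le> 2 - \<alpha>"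
    using affine_peak_projection_bound[OF assms] by blast
  note one = affine_peak_norm_eq_1[OF assms] affine_peak_norm_molecule[OF assms]
  let ?\<Phi> = "lip_free_functional ?m"
  have \<Phi>: "?\<Phi> h = slope h x y" for h
    using pairing_molecule[of x y h] by (simp only: pairing_def)
  have norm_\<Phi>: "norm ?\<Phi> = 1" using one(2) by (simp add: norm_lip_free.rep_eq)
  let ?T = "id_blinfun + rank_one ?\<Phi> (- f)"
  have "f \<noteq> 0" "?\<Phi> \<noteq> 0" using one norm_\<Phi> by auto
  then have "norm ?T = 1 + norm ?\<Phi> * norm (- f)"
    using D unfolding daugavet_property_iff by (metis neg_equal_0_iff_equal)
  then have "norm ?T = 2" using one norm_\<Phi> by simp
  moreover have "norm ?T \<le> 2 - \<alpha>"
  proof (rule norm_blinfun_bound)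
    show nonneg: "0 \<le> 2 - \<alpha>" using \<alpha>(2)[of 0] by (simp add: pairing_simps)
    fix h
    have "norm (h - slope h x y *\<^sub>R f) \<le> (2 - \<alpha>) * norm h"
    proof (rule lip0_norm_le_slopeI)
      show "0 \<le> (2 - \<alpha>) * norm h" using nonneg by simp
      fix u v
      have "slope (h - slope h x y *\<^sub>R f) u v = pairing (molecule u v - pairing (molecule u v) f *\<^sub>R ?m) h"
        by (simp add: pairing_simps slope_diff slope_scaleR)
      also have "\<dots> \<le> norm (molecule u v - pairing (molecule u v) f *\<^sub>R ?m) * norm h"
        using abs_pairing_le abs_le_D1 by blast
      also have "\<dots> \<le> (2 - \<alpha>) * norm h"
        by (intro mult_right_mono \<alpha>(2) norm_molecule_le) simp
      finally show "slope (h - slope h x y *\<^sub>R f) u v \<le> (2 - \<alpha>) * norm h" .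
    qed
    then show "norm (?T h) \<le> (2 - \<alpha>) * norm h" by (simp add: blinfun.add_left \<Phi>)
  qed
  ultimately show False using \<alpha>(1) by simp
qed

section \<open>Steep pairs in length spaces\<close>

lemma less_slope_iff:
  assumes "0 \<le> a"
  shows "a < slope f x y \<longleftrightarrow> a * dist x y < lip0_apply f x - lip0_apply f y"
  using assms by (cases "x = y") (auto simp: slope_def less_divide_eq)

lemma length_space_midpoint:
  fixes x y :: "'a::complete_space"
  assumes "length_space TYPE('a)" "\<delta> > 0"
  obtains z where "dist x z \<le> dist x y / 2 + \<delta>" "dist z y \<le> dist x y / 2 + \<delta>"
  using assms unfolding length_space_def by (metis max.bounded_iff)

text \<open>The slope over a pair is almost an average of the slopes over its two halves, so one of these is as steep
  as the pair up to an arbitrarily small loss. The loss is absorbed because the steepness is only required to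
  exceed \<open>a\<close>.\<close>

lemma steep_half:
  fixes f :: "'a::{complete_space, zero} lip0"
  assumes "length_space TYPE('a)" "a < slope f x y" "3 / 4 * norm f \<le> a"
  obtains x' y' where "a < slope f x' y'" "dist x' y' \<le> 3 / 4 * dist x y"
    "lip0_apply f y \<le> lip0_apply f y'" "lip0_apply f x' \<le> lip0_apply f x"
proof -
  let ?f = "lip0_apply f" and ?L = "norm f" and ?d = "dist x y"
  have "a < ?L" using assms(2) slope_le_norm[of f x y] by linarith
  with assms(3) have "0 < ?L" by linarith
  with assms(3) have "0 < a" by linarith
  note iff = less_slope_iff[of a, OF less_imp_le[OF \<open>0 < a\<close>]]
  define G where "G = ?f x - ?f y - a * ?d"
  have "0 < G" using assms(2) by (simp add: iff G_def)
  then have "0 < ?d" using \<open>0 < a\<close> by (auto simp: G_def)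
  define \<delta> where "\<delta> = min (?d / 4) (G / (4 * ?L))"
  have \<delta>: "0 < \<delta>" "\<delta> \<le> ?d / 4" "\<delta> \<le> G / (4 * ?L)"
    using \<open>0 < ?d\<close> \<open>0 < G\<close> \<open>0 < ?L\<close> by (auto simp: \<delta>_def)
  obtain z where z: "dist x z \<le> ?d / 2 + \<delta>" "dist z y \<le> ?d / 2 + \<delta>"
    using length_space_midpoint[OF assms(1) \<delta>(1)] by blast
  have "?L * (?d / 2 + \<delta>) \<le> ?L * (3 / 4 * ?d)"
    using \<delta>(2) \<open>0 < ?L\<close> by (intro mult_left_mono) auto
  also have "\<dots> \<le> a * ?d" using mult_right_mono[OF assms(3), of ?d] by (simp add: mult_ac)
  finally have L: "?L * (?d / 2 + \<delta>) \<le> a * ?d" .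
  have "?L * dist x z \<le> ?L * (?d / 2 + \<delta>)" "?L * dist z y \<le> ?L * (?d / 2 + \<delta>)"
    using z by (auto intro: mult_left_mono)
  with L lip0_norm_bound[of f x z] lip0_norm_bound[of f z y] \<open>0 < G\<close>
  have between: "?f y \<le> ?f z" "?f z \<le> ?f x" by (auto simp: G_def)
  have "a * (dist x z + dist z y) \<le> a * (?d + 2 * \<delta>)"
    using z \<open>0 < a\<close> by (intro mult_left_mono) auto
  also have "\<dots> \<le> a * ?d + 2 * (?L * \<delta>)"
    using \<open>a < ?L\<close> \<delta>(1) mult_right_mono[of a ?L \<delta>] by (simp add: algebra_simps)
  also have "?L * \<delta> \<le> G / 4" using \<delta>(3) \<open>0 < ?L\<close> by (simp add: field_simps)
  finally have "a * (dist x z + dist z y) < a * ?d + G" using \<open>0 < G\<close> by simp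
  then have "a * dist x z + a * dist z y < (?f x - ?f z) + (?f z - ?f y)"
    by (simp add: G_def distrib_left)
  then consider "a < slope f x z" | "a < slope f z y" unfolding iff by linarith
  then show thesis
  proof cases
    case 1
    then show ?thesis using that[of x z] z(1) \<delta>(2) between by simp
  next
    case 2
    then show ?thesis using that[of z y] z(2) \<delta>(2) between by simp
  qed
qed

lemma short_steep_pair:
  fixes f :: "'a::{complete_space, zero} lip0"
  assumes "length_space TYPE('a)" "a < slope f x y" "3 / 4 * norm f \<le> a"
  shows "\<exists>x' y'. a < slope f x' y' \<and> dist x' y' \<le> (3 / 4) ^ n * dist x y \<and>
    lip0_apply f y \<le> lip0_apply f y' \<and> lip0_apply f x' \<le> lip0_apply f x"
proof (induction n)
  case 0
  then show ?case using assms(2) by auto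
next
  case (Suc n)
  then obtain x1 y1 where 1: "a < slope f x1 y1" "dist x1 y1 \<le> (3 / 4) ^ n * dist x y"
    "lip0_apply f y \<le> lip0_apply f y1" "lip0_apply f x1 \<le> lip0_apply f x" by blast
  obtain x2 y2 where 2: "a < slope f x2 y2" "dist x2 y2 \<le> 3 / 4 * dist x1 y1"
    "lip0_apply f y1 \<le> lip0_apply f y2" "lip0_apply f x2 \<le> lip0_apply f x1"
    using steep_half[OF assms(1) 1(1) assms(3)] by blast
  have "dist x2 y2 \<le> (3 / 4) ^ Suc n * dist x y"
    using 2(2) 1(2) by simp
  with 1 2 show ?case by (intro exI[of _ x2] exI[of _ y2]) auto
qed

text \<open>Working with levels of \<open>f\<close> rather than with points of the space makes the separation of steep pairs a
  question about real numbers.\<close>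

definition steep_level :: "'a::{metric_space, zero} lip0 \<Rightarrow> real \<Rightarrow> real \<Rightarrow> bool" where
  "steep_level f a s \<longleftrightarrow> (\<forall>\<eta>>0. \<exists>x y. a < slope f x y \<and>
     \<bar>lip0_apply f x - s\<bar> < \<eta> \<and> \<bar>lip0_apply f y - s\<bar> < \<eta>)"

lemma steep_level_antimono: "steep_level f b s \<Longrightarrow> a \<le> b \<Longrightarrow> steep_level f a s"
  unfolding steep_level_def by (meson le_less_trans)

lemma steep_level_exists:
  fixes f :: "'a::{complete_space, zero} lip0"
  assumes "length_space TYPE('a)" "a < slope f x y" "3 / 4 * norm f \<le> a"
  shows "\<exists>s\<in>{lip0_apply f y..lip0_apply f x}. steep_level f a s"
proof -
  let ?f = "lip0_apply f"
  have "0 \<le> 3 / 4 * norm f" by simp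
  with assms(3) have "0 \<le> a" by (rule order_trans[rotated])
  obtain X Y where XY: "\<And>n. a < slope f (X n) (Y n)" "\<And>n. dist (X n) (Y n) \<le> (3 / 4) ^ n * dist x y"
    "\<And>n. ?f y \<le> ?f (Y n)" "\<And>n. ?f (X n) \<le> ?f x"
    using short_steep_pair[OF assms] by metis
  have le: "?f (Y n) \<le> ?f (X n)" for n
    using XY(1)[of n] less_slope_iff[OF \<open>0 \<le> a\<close>, of f "X n" "Y n"] \<open>0 \<le> a\<close>
      mult_nonneg_nonneg[OF \<open>0 \<le> a\<close> zero_le_dist, of "X n" "Y n"] by linarith
  have "?f (X n) \<in> {?f y..?f x}" for n
    using XY(3,4) le order_trans by (auto intro: order_trans)
  then obtain s r where s: "s \<in> {?f y..?f x}" "strict_mono r" "(\<lambda>n. ?f (X (r n))) \<longlonglongrightarrow> s"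
    using seq_compactE[OF compact_imp_seq_compact[OF compact_Icc], of "\<lambda>n. ?f (X n)" "?f y" "?f x"]
    by (auto simp: comp_def)
  have "(\<lambda>n. norm f * ((3 / 4) ^ n * dist x y)) \<longlonglongrightarrow> norm f * (0 * dist x y)"
    by (intro tendsto_intros LIMSEQ_power_zero) auto
  then have zero: "(\<lambda>n. norm f * ((3 / 4) ^ n * dist x y)) \<longlonglongrightarrow> 0" by simp
  have "\<bar>?f (X n) - ?f (Y n)\<bar> \<le> norm f * ((3 / 4) ^ n * dist x y)" for n
    using lip0_norm_bound[of f "X n" "Y n"] mult_left_mono[OF XY(2)[of n], of "norm f"] by simp
  then have "(\<lambda>n. \<bar>?f (X n) - ?f (Y n)\<bar>) \<longlonglongrightarrow> 0"
    by (intro tendsto_sandwich[OF always_eventually always_eventually tendsto_const zero]) auto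
  then have "(\<lambda>n. ?f (X n) - ?f (Y n)) \<longlonglongrightarrow> 0" by (simp add: tendsto_rabs_zero_iff)
  from LIMSEQ_subseq_LIMSEQ[OF this s(2)] have "(\<lambda>n. ?f (X (r n)) - ?f (Y (r n))) \<longlonglongrightarrow> 0"
    by (simp add: comp_def)
  from tendsto_diff[OF s(3) this] have sY: "(\<lambda>n. ?f (Y (r n))) \<longlonglongrightarrow> s" by simp
  have "steep_level f a s"
    unfolding steep_level_def
  proof (intro allI impI)
    fix \<eta> :: real
    assume "\<eta> > 0"
    then have "\<forall>\<^sub>F n in sequentially. dist (?f (X (r n))) s < \<eta> \<and> dist (?f (Y (r n))) s < \<eta>"
      using tendstoD[OF s(3)] tendstoD[OF sY] eventually_conj by blast
    then obtain n where "dist (?f (X (r n))) s < \<eta>" "dist (?f (Y (r n))) s < \<eta>"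
      unfolding eventually_sequentially by blast
    with XY(1)[of "r n"] show "\<exists>x y. a < slope f x y \<and> \<bar>?f x - s\<bar> < \<eta> \<and> \<bar>?f y - s\<bar> < \<eta>"
      by (auto simp: dist_real_def)
  qed
  with s(1) show ?thesis by blast
qed

lemma both_halves_steep:
  fixes f :: "'a::{complete_space, zero} lip0"
  assumes "length_space TYPE('a)" "norm f * (1 - \<alpha>) < slope f x y" "0 < \<alpha>" "\<alpha> \<le> 1 / 4"
  obtains z where "norm f * (1 - 3 * \<alpha>) < slope f x z" "norm f * (1 - 3 * \<alpha>) < slope f z y"
proof -
  let ?f = "lip0_apply f" and ?L = "norm f" and ?d = "dist x y"
  have nonneg: "0 \<le> ?L * (1 - \<alpha>)" "0 \<le> ?L * (1 - 3 * \<alpha>)" using assms by simp_all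
  have steep: "?L * (1 - \<alpha>) * ?d < ?f x - ?f y" using assms(2) less_slope_iff[OF nonneg(1)] by blast
  then have "x \<noteq> y" by auto
  then have "0 < \<alpha> * ?d / 4" using assms by simp
  then obtain z where z: "dist x z \<le> ?d / 2 + \<alpha> * ?d / 4" "dist z y \<le> ?d / 2 + \<alpha> * ?d / 4"
    using length_space_midpoint[OF assms(1)] by blast
  have half: "?L * (1 - 3 * \<alpha>) * r < ?f x - ?f y - ?L * r'"
    if "r \<le> ?d / 2 + \<alpha> * ?d / 4" "r' \<le> ?d / 2 + \<alpha> * ?d / 4" for r r'
  proof -
    have "(1 - 3 * \<alpha>) * r \<le> (1 - 3 * \<alpha>) * (?d / 2 + \<alpha> * ?d / 4)"
      using that(1) assms by (intro mult_left_mono) auto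
    also have "\<dots> = (1 - \<alpha>) * ?d - (?d / 2 + \<alpha> * ?d / 4) - 3 / 4 * (\<alpha> * \<alpha> * ?d)"
      by (simp add: field_simps)
    also have "\<dots> \<le> (1 - \<alpha>) * ?d - (?d / 2 + \<alpha> * ?d / 4)" by simp
    also have "\<dots> \<le> (1 - \<alpha>) * ?d - r'" using that(2) by linarith
    finally have "?L * ((1 - 3 * \<alpha>) * r) \<le> ?L * ((1 - \<alpha>) * ?d - r')"
      by (intro mult_left_mono) auto
    moreover have "?L * ((1 - \<alpha>) * ?d) < ?f x - ?f y" using steep by (simp only: mult.assoc)
    moreover have "?L * ((1 - \<alpha>) * ?d - r') = ?L * ((1 - \<alpha>) * ?d) - ?L * r'"
      by (rule right_diff_distrib)
    ultimately show ?thesis unfolding mult.assoc by linarith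
  qed
  have "?f z - ?f y \<le> ?L * dist z y" "?f x - ?f z \<le> ?L * dist x z"
    using lip0_norm_bound[of f z y] lip0_norm_bound[of f x z] by auto
  with half[OF z(1) z(2)] half[OF z(2) z(1)] show thesis
    by (intro that[of z]) (auto simp: less_slope_iff[OF nonneg(2)])
qed

text \<open>Splitting a pair repeatedly gives pairs over disjoint intervals of levels, each of which contains a
  steep level. The factor 9 allows for two splittings per step: the second one leaves a gap between
  the new level and the ones found before.\<close>

lemma many_steep_levels:
  fixes f :: "'a::{complete_space, zero} lip0"
  assumes "length_space TYPE('a)" "0 < \<alpha>" "\<alpha> \<le> 1 / 4" "norm f * (1 - \<alpha> / 9 ^ k) < slope f x y"
  shows "\<exists>S\<subseteq>{lip0_apply f y..lip0_apply f x}. finite S \<and> card S = Suc k \<and>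
    (\<forall>s\<in>S. steep_level f (norm f * (1 - \<alpha>)) s)"
  using assms(4)
proof (induction k arbitrary: x y)
  case 0
  have "3 / 4 * norm f \<le> norm f * (1 - \<alpha>)" using mult_left_mono[of "3 / 4" "1 - \<alpha>" "norm f"] assms(3) by (simp add: mult.commute)
  then obtain s where "s \<in> {lip0_apply f y..lip0_apply f x}" "steep_level f (norm f * (1 - \<alpha>)) s"
    using steep_level_exists[OF assms(1), of "norm f * (1 - \<alpha>)" f x y] 0 by auto
  then show ?case by (intro exI[of _ "{s}"]) auto
next
  case (Suc k)
  let ?f = "lip0_apply f"
  define \<beta> where "\<beta> = \<alpha> / 9 ^ Suc k"
  have "\<alpha> / 9 ^ k \<le> \<alpha> / 1"
    using assms(2) by (intro divide_left_mono) (auto simp: one_le_power)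
  moreover have "9 * \<beta> = \<alpha> / 9 ^ k" by (simp add: \<beta>_def)
  ultimately have \<beta>: "0 < \<beta>" "\<beta> \<le> 1 / 36" "9 * \<beta> \<le> \<alpha>" "9 * \<beta> = \<alpha> / 9 ^ k"
    using assms(2,3) by (simp add: \<beta>_def, linarith+)
  have weaken: "norm f * (1 - c) < slope f u v" if "norm f * (1 - b) < slope f u v" "b \<le> c" for b c u v
  proof -
    have "norm f * (1 - c) \<le> norm f * (1 - b)" using that(2) by (intro mult_left_mono) auto
    with that(1) show ?thesis by linarith
  qed
  obtain z where z: "norm f * (1 - 3 * \<beta>) < slope f x z" "norm f * (1 - 3 * \<beta>) < slope f z y"
    by (rule both_halves_steep[OF assms(1) Suc.prems[folded \<beta>_def] \<beta>(1)]) (use \<beta>(2) in linarith)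
  obtain w where w: "norm f * (1 - 3 * (3 * \<beta>)) < slope f z w" "norm f * (1 - 3 * (3 * \<beta>)) < slope f w y"
    by (rule both_halves_steep[OF assms(1) z(2)]) (use \<beta>(1,2) in linarith)+
  have "norm f * (1 - \<alpha> / 9 ^ k) < slope f x z" using weaken[OF z(1)] \<beta> by auto
  then obtain S where S: "S \<subseteq> {?f z..?f x}" "finite S" "card S = Suc k"
    "\<forall>s\<in>S. steep_level f (norm f * (1 - \<alpha>)) s" using Suc.IH by blast
  have "3 / 4 * norm f \<le> norm f * (1 - \<alpha>)" using mult_left_mono[of "3 / 4" "1 - \<alpha>" "norm f"] assms(3) by (simp add: mult.commute)
  moreover have "norm f * (1 - \<alpha>) < slope f w y" using weaken[OF w(2)] \<beta> by auto
  ultimately obtain s where s: "s \<in> {?f y..?f w}" "steep_level f (norm f * (1 - \<alpha>)) s"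
    using steep_level_exists[OF assms(1)] by blast
  have increasing: "?f v < ?f u" if "norm f * (1 - c) < slope f u v" "c \<le> 1" for c u v
  proof -
    have "0 \<le> norm f * (1 - c)" using that(2) by simp
    moreover from this have "0 \<le> norm f * (1 - c) * dist u v" by simp
    ultimately show ?thesis using that(1) less_slope_iff[of "norm f * (1 - c)" f u v] by linarith
  qed
  have "?f w < ?f z" "?f z < ?f x"
    using increasing[OF w(1)] increasing[OF z(1)] \<beta>(2) by auto
  moreover have "?f y < ?f z" using increasing[OF z(2)] \<beta>(2) by auto
  ultimately have "insert s S \<subseteq> {?f y..?f x}" "s \<notin> S" using S(1) s(1) by fastforce+
  with S s show ?case by (intro exI[of _ "insert s S"]) auto
qed

lemma infinite_steep_levels:
  fixes f :: "'a::{complete_space, zero} lip0"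
  assumes "length_space TYPE('a)" "f \<noteq> 0" "0 < \<alpha>" "\<alpha> \<le> 1 / 4"
  shows "infinite {s. steep_level f (norm f * (1 - \<alpha>)) s}" (is "infinite ?A")
proof
  assume fin: "finite ?A"
  define k where "k = card ?A"
  have "\<alpha> / 9 ^ k \<le> \<alpha> / 1" using assms(3) by (intro divide_left_mono) (auto simp: one_le_power)
  then have "\<alpha> / 9 ^ k \<le> 1" using assms(4) by linarith
  moreover have "0 < \<alpha> / 9 ^ k" using assms(3) by simp
  ultimately have "0 \<le> norm f * (1 - \<alpha> / 9 ^ k)" "norm f * (1 - \<alpha> / 9 ^ k) < norm f" using \<open>f \<noteq> 0\<close> by simp_all
  then obtain x y where "norm f * (1 - \<alpha> / 9 ^ k) < slope f x y" by (rule steep_pair_exists)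
  from many_steep_levels[OF assms(1,3,4) this]
  obtain S where "card S = Suc k" "\<forall>s\<in>S. steep_level f (norm f * (1 - \<alpha>)) s" by blast
  then have "card S \<le> card ?A" by (intro card_mono[OF fin]) auto
  with \<open>card S = Suc k\<close> show False by (simp add: k_def)
qed

text \<open>Select distinct nonzero numbers one after the other. In a monotone subsequence the gaps on both sides of
  a number separate it from all the others.\<close>

lemma infinite_sets_isolated_selection:
  fixes A :: "nat \<Rightarrow> real set"
  assumes "\<And>n. infinite (A n)" "\<And>m n. m \<le> n \<Longrightarrow> A n \<subseteq> A m"
  shows "\<exists>t \<rho>. (\<forall>n. t n \<in> A n \<and> 0 < \<rho> n \<and> \<rho> n \<le> \<bar>t n\<bar>) \<and>
    (\<forall>m n. m \<noteq> n \<longrightarrow> \<rho> m + \<rho> n \<le> \<bar>t m - t n\<bar>)"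
proof -
  have "\<exists>q. \<forall>n. (fst (q n) \<in> A n \<and> fst (q n) \<notin> snd (q n) \<and> finite (snd (q n)) \<and> (0::real) \<in> snd (q n)) \<and>
      snd (q (Suc n)) = insert (fst (q n)) (snd (q n))"
  proof (rule dependent_nat_choice)
    have "infinite (A 0 - {0})" using assms(1) by simp
    then obtain s where "s \<in> A 0 - {0}" using infinite_imp_nonempty by blast
    then show "\<exists>p. fst p \<in> A 0 \<and> fst p \<notin> snd p \<and> finite (snd p) \<and> (0::real) \<in> snd p"
      by (intro exI[of _ "(s, {0})"]) auto
  next
    fix p :: "real \<times> real set" and n
    assume p: "fst p \<in> A n \<and> fst p \<notin> snd p \<and> finite (snd p) \<and> (0::real) \<in> snd p"
    then have "infinite (A (Suc n) - insert (fst p) (snd p))" using assms(1) by simp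
    then obtain s where "s \<in> A (Suc n) - insert (fst p) (snd p)" using infinite_imp_nonempty by blast
    with p show "\<exists>p'. (fst p' \<in> A (Suc n) \<and> fst p' \<notin> snd p' \<and> finite (snd p') \<and> (0::real) \<in> snd p') \<and>
        snd p' = insert (fst p) (snd p)"
      by (intro exI[of _ "(s, insert (fst p) (snd p))"]) auto
  qed
  then obtain q where q: "\<And>n. fst (q n) \<in> A n" "\<And>n. fst (q n) \<notin> snd (q n)" "\<And>n. (0::real) \<in> snd (q n)"
    "\<And>n. snd (q (Suc n)) = insert (fst (q n)) (snd (q n))" by blast
  define s where "s n = fst (q n)" for n
  have old: "s m \<in> snd (q n)" if "Suc m \<le> n" for m n
    using that
  proof (induction n rule: dec_induct)
    case base
    show ?case by (simp add: q(4) s_def)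
  next
    case (step n)
    then show ?case by (simp add: q(4))
  qed
  have distinct: "s m \<noteq> s n" if "m < n" for m n
    using old[of m n] q(2)[of n] that by (auto simp: s_def)
  have nonzero: "s n \<noteq> 0" for n using q(2,3)[of n] by (auto simp: s_def)
  obtain r where r: "strict_mono r" "monoseq (\<lambda>n. s (r n))"
    using seq_monosub[of s] by blast
  define v where "v n = s (r n)" for n
  have v_ne: "v m \<noteq> v n" if "m < n" for m n
    using distinct[of "r m" "r n"] r(1) that by (simp add: v_def strict_mono_def)
  have v_A: "v n \<in> A n" for n
    using q(1)[of "r n"] assms(2)[OF seq_suble[OF r(1)]] by (auto simp: v_def s_def)
  define \<rho> where "\<rho> n = min \<bar>v (Suc n)\<bar>
      (min \<bar>v (Suc (Suc n)) - v (Suc n)\<bar> \<bar>v (Suc n) - v n\<bar>) / 2" for n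
  have half: "2 * \<rho> n \<le> \<bar>v (Suc (Suc n)) - v (Suc n)\<bar>" "2 * \<rho> n \<le> \<bar>v (Suc n) - v n\<bar>" for n
    by (simp_all add: \<rho>_def min_le_iff_disj)
  have separated: "\<rho> m + \<rho> n \<le> \<bar>v (Suc m) - v (Suc n)\<bar>" if "m < n" for m n
  proof -
    have idx: "Suc m \<le> Suc (Suc m)" "Suc (Suc m) \<le> Suc n" "Suc m \<le> n" "n \<le> Suc n" using that by auto
    have "(\<forall>i j. i \<le> j \<longrightarrow> v i \<le> v j) \<or> (\<forall>i j. i \<le> j \<longrightarrow> v j \<le> v i)"
      using r(2) unfolding monoseq_def v_def by blast
    then have "\<bar>v (Suc (Suc m)) - v (Suc m)\<bar> \<le> \<bar>v (Suc m) - v (Suc n)\<bar> \<and>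
      \<bar>v (Suc n) - v n\<bar> \<le> \<bar>v (Suc m) - v (Suc n)\<bar>"
    proof
      assume "\<forall>i j. i \<le> j \<longrightarrow> v i \<le> v j"
      with idx have "v (Suc m) \<le> v (Suc (Suc m))" "v (Suc (Suc m)) \<le> v (Suc n)" "v (Suc m) \<le> v n" "v n \<le> v (Suc n)"
        by blast+
      then show ?thesis by linarith
    next
      assume "\<forall>i j. i \<le> j \<longrightarrow> v j \<le> v i"
      with idx have "v (Suc m) \<ge> v (Suc (Suc m))" "v (Suc (Suc m)) \<ge> v (Suc n)" "v (Suc m) \<ge> v n" "v n \<ge> v (Suc n)"
        by blast+
      then show ?thesis by linarith
    qed
    with half(1)[of m] half(2)[of n] show ?thesis by linarith
  qed
  have "v (Suc n) \<in> A n" for n using v_A[of "Suc n"] assms(2)[of n "Suc n"] by auto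
  moreover have "v (Suc n) \<noteq> 0" for n unfolding v_def by (rule nonzero)
  then have "0 < \<rho> n" for n
    using v_ne[of n "Suc n"] v_ne[of "Suc n" "Suc (Suc n)"] unfolding \<rho>_def by auto
  moreover have "2 * \<rho> n \<le> \<bar>v (Suc n)\<bar>" for n by (simp add: \<rho>_def)
  then have "\<rho> n \<le> \<bar>v (Suc n)\<bar>" for n using abs_ge_zero[of "v (Suc n)"] by (smt (verit))
  moreover have "\<rho> m + \<rho> n \<le> \<bar>v (Suc m) - v (Suc n)\<bar>" if "m \<noteq> n" for m n
    using separated[of m n] separated[of n m] that
    by (cases "m < n") (auto simp: abs_minus_commute add.commute)
  ultimately show ?thesis by (intro exI[of _ "\<lambda>n. v (Suc n)"] exI[of _ \<rho>] conjI allI impI)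
qed

text \<open>The geometric core of all the positive results: the slope of \<open>f\<close> is nearly attained infinitely often,
  on pairs that are short compared with the radii of disjoint balls around them.\<close>

locale separated_steep_pairs =
  fixes f :: "'a::{metric_space, zero} lip0" and X Y :: "nat \<Rightarrow> 'a" and R :: "nat \<Rightarrow> real"
  assumes radius_pos: "0 < R n" and radius_le_1: "R n \<le> 1"
    and steep: "norm f * (1 - 1 / (real n + 1)) < slope f (X n) (Y n)"
    and short: "dist (X n) (Y n) < R n / (real n + 1)"
    and zero_outside: "0 \<notin> ball (X n) (R n)"
    and disjoint: "m \<noteq> n \<Longrightarrow> ball (X m) (R m) \<inter> ball (X n) (R n) = {}"
begin

lemma distinct: "X n \<noteq> Y n"
proof -
  have "0 \<le> norm f * (1 - 1 / (real n + 1))" by (simp add: field_simps)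
  with steep[of n] have "0 < slope f (X n) (Y n)" by linarith
  then show ?thesis by (auto simp: slope_def)
qed

lemma inside: "dist (X n) (Y n) < R n"
proof -
  have "R n / (real n + 1) \<le> R n / 1" using radius_pos[of n] by (intro divide_left_mono) auto
  with short[of n] show ?thesis by simp
qed

lemma nearly_maximal:
  assumes "norm f / \<epsilon> \<le> real n" "0 < \<epsilon>"
  shows "norm f - \<epsilon> < slope f (X n) (Y n)"
proof -
  have "norm f \<le> \<epsilon> * (real n + 1)" using assms by (simp add: field_simps)
  then have "norm f / (real n + 1) \<le> \<epsilon>" by (simp add: divide_le_eq)
  with steep[of n] show ?thesis by (simp add: algebra_simps)
qed

lemma relatively_short:
  assumes "(C + 1) / \<epsilon> \<le> real n" "0 < \<epsilon>" "0 \<le> C"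
  shows "(C + 1) * dist (X n) (Y n) \<le> \<epsilon> * R n"
proof -
  have "C + 1 \<le> \<epsilon> * (real n + 1)" using assms(1,2) by (simp add: field_simps)
  then have "(C + 1) * (R n / (real n + 1)) \<le> \<epsilon> * (real n + 1) * (R n / (real n + 1))"
    using radius_pos[of n] by (intro mult_right_mono) auto
  also have "\<dots> = \<epsilon> * R n" by simp
  finally have "(C + 1) * (R n / (real n + 1)) \<le> \<epsilon> * R n" .
  moreover have "(C + 1) * dist (X n) (Y n) \<le> (C + 1) * (R n / (real n + 1))"
    using short[of n] assms(3) by (intro mult_left_mono) auto
  ultimately show ?thesis by linarith
qed

end

lemma separated_steep_pairs_exist:
  fixes f :: "'a::{complete_space, zero} lip0"
  assumes "length_space TYPE('a)" "f \<noteq> 0"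
  shows "\<exists>X Y R. separated_steep_pairs f X Y R"
proof -
  let ?f = "lip0_apply f" and ?L = "norm f"
  have "0 < ?L" using assms(2) by simp
  define \<alpha> where "\<alpha> n = 1 / (4 * (real n + 1))" for n
  have \<alpha>: "0 < \<alpha> n" "\<alpha> n \<le> 1 / 4" "\<alpha> n \<le> 1 / (real n + 1)" for n
    by (auto simp: \<alpha>_def field_simps)
  define A where "A n = {s. steep_level f (?L * (1 - \<alpha> n)) s}" for n
  have infinite: "infinite (A n)" for n
    unfolding A_def using infinite_steep_levels[OF assms \<alpha>(1,2)] .
  have decreasing: "A n \<subseteq> A m" if "m \<le> n" for m n
  proof -
    have "\<alpha> n \<le> \<alpha> m" using that by (auto simp: \<alpha>_def frac_le)
    then have "?L * (1 - \<alpha> m) \<le> ?L * (1 - \<alpha> n)" by (intro mult_left_mono) auto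
    then show ?thesis unfolding A_def using steep_level_antimono by blast
  qed
  obtain t \<rho> where t: "\<And>n. t n \<in> A n" "\<And>n. 0 < \<rho> n" "\<And>n. \<rho> n \<le> \<bar>t n\<bar>"
    "\<And>m n. m \<noteq> n \<Longrightarrow> \<rho> m + \<rho> n \<le> \<bar>t m - t n\<bar>"
    using infinite_sets_isolated_selection[of A, OF infinite decreasing] by blast
  define R where "R n = min 1 (\<rho> n / (2 * ?L))" for n
  have R: "0 < R n" "R n \<le> 1" "?L * R n \<le> \<rho> n / 2" for n
  proof -
    show "0 < R n" "R n \<le> 1" using t(2) \<open>0 < ?L\<close> by (auto simp: R_def)
    have "R n \<le> \<rho> n / (2 * ?L)" by (simp add: R_def)
    with \<open>0 < ?L\<close> show "?L * R n \<le> \<rho> n / 2" by (simp add: field_simps)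
  qed
  define \<eta> where "\<eta> n = min (\<rho> n / 2) (?L * R n / (4 * (real n + 1)))" for n
  have \<eta>: "0 < \<eta> n" "\<eta> n \<le> \<rho> n / 2" "\<eta> n \<le> ?L * R n / (4 * (real n + 1))" for n
  proof -
    show "0 < \<eta> n" using t(2) R(1) \<open>0 < ?L\<close> by (auto simp: \<eta>_def)
    show "\<eta> n \<le> \<rho> n / 2" "\<eta> n \<le> ?L * R n / (4 * (real n + 1))"
      unfolding \<eta>_def by (rule min.cobounded1, rule min.cobounded2)
  qed
  have "\<exists>x y. ?L * (1 - \<alpha> n) < slope f x y \<and> \<bar>?f x - t n\<bar> < \<eta> n \<and> \<bar>?f y - t n\<bar> < \<eta> n" for n
    using t(1)[of n] \<eta>(1)[of n] by (auto simp: A_def steep_level_def)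
  then obtain X Y where XY: "\<And>n. ?L * (1 - \<alpha> n) < slope f (X n) (Y n)"
    "\<And>n. \<bar>?f (X n) - t n\<bar> < \<eta> n" "\<And>n. \<bar>?f (Y n) - t n\<bar> < \<eta> n" by metis
  have level: "\<bar>?f z - t n\<bar> < \<rho> n" if "z \<in> ball (X n) (R n)" for z n
  proof -
    have "?L * dist z (X n) \<le> ?L * R n"
      using that by (intro mult_left_mono) (auto simp: dist_commute)
    with lip0_norm_bound[of f z "X n"] R(3)[of n] XY(2)[of n] \<eta>(2)[of n] show ?thesis by linarith
  qed
  have "separated_steep_pairs f X Y R"
  proof
    fix n
    show "0 < R n" "R n \<le> 1" by (fact R)+
    have "?L * (1 - 1 / (real n + 1)) \<le> ?L * (1 - \<alpha> n)"
      using \<alpha>(3)[of n] by (intro mult_left_mono) auto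
    with XY(1)[of n] show "?L * (1 - 1 / (real n + 1)) < slope f (X n) (Y n)" by linarith
    have "0 \<le> ?L * (1 - \<alpha> n)" using \<alpha>(2)[of n] by simp
    then have "?L * (1 - \<alpha> n) * dist (X n) (Y n) < ?f (X n) - ?f (Y n)"
      using XY(1) less_slope_iff by blast
    also have "\<dots> < 2 * \<eta> n" using XY(2,3)[of n] by linarith
    also have "\<dots> \<le> ?L * (R n / (2 * (real n + 1)))" using \<eta>(3)[of n] by (simp add: field_simps)
    finally have "?L * ((1 - \<alpha> n) * dist (X n) (Y n)) < ?L * (R n / (2 * (real n + 1)))"
      by (simp add: mult.assoc)
    then have "(1 - \<alpha> n) * dist (X n) (Y n) < R n / (2 * (real n + 1))"
      by (rule mult_left_less_imp_less) simp
    moreover have "1 / 2 * dist (X n) (Y n) \<le> (1 - \<alpha> n) * dist (X n) (Y n)"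
      using \<alpha>(2)[of n] by (intro mult_right_mono) auto
    ultimately have "1 / 2 * dist (X n) (Y n) < R n / (2 * (real n + 1))" by (rule le_less_trans[rotated])
    then show "dist (X n) (Y n) < R n / (real n + 1)" by (simp add: field_simps)
    show "0 \<notin> ball (X n) (R n)" using level[of 0 n] t(3)[of n] by auto
  next
    fix m n :: nat
    assume "m \<noteq> n"
    then show "ball (X m) (R m) \<inter> ball (X n) (R n) = {}"
      using level[of _ m] level[of _ n] t(4)[of m n] by fastforce
  qed
  then show ?thesis by blast
qed

text \<open>To change the slope over \<open>(x, y)\<close> it suffices to change the value at \<open>x\<close>. This costs little in norm when,
  apart from \<open>y\<close>, all the points where values are kept are much farther from \<open>x\<close> than \<open>y\<close> is.\<close>

lemma prescribe_slope:
  fixes h0 :: "'a::{metric_space, zero} lip0"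
  assumes "norm h0 \<le> C" "1 \<le> C" "\<bar>\<sigma>\<bar> \<le> 1" "x \<noteq> y" "0 \<notin> ball x R" "dist x y < R" "0 \<le> \<epsilon>"
    and short: "(C + 1) * dist x y \<le> \<epsilon> * R"
  shows "\<exists>h. norm h \<le> C + \<epsilon> \<and> slope h x y = \<sigma> \<and>
    (\<forall>z. z \<notin> ball x R \<longrightarrow> lip0_apply h z = lip0_apply h0 z)"
proof -
  let ?h = "lip0_apply h0"
  define A where "A = insert x (insert y (- ball x R))"
  define k where "k z = (if z = x then ?h y + \<sigma> * dist x y else ?h z)" for z
  have "0 \<le> C + \<epsilon>" using assms by simp
  have weaken: "C * r \<le> (C + \<epsilon>) * r" if "0 \<le> r" for r using that assms by (intro mult_right_mono) auto
  have at_x: "\<bar>k x - k a\<bar> \<le> (C + \<epsilon>) * dist x a" if a: "a \<in> A" for a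
  proof -
    consider "a = x" | "a = y" "a \<noteq> x" | "a \<noteq> x" "R \<le> dist x a" using a by (auto simp: A_def not_less)
    then show ?thesis
    proof cases
      case 2
      have "\<bar>\<sigma>\<bar> * dist x y \<le> C * dist x y" using assms by (intro mult_right_mono) auto
      with 2 weaken[of "dist x y"] show ?thesis by (simp add: k_def abs_mult)
    next
      case 3
      have "\<bar>?h y - ?h a\<bar> \<le> C * dist y a"
        using lip0_norm_bound[of h0 y a] mult_right_mono[OF assms(1), of "dist y a"] by simp
      also have "\<dots> \<le> C * (dist x y + dist x a)"
        using dist_triangle[of y a x] assms(2) by (intro mult_left_mono) (auto simp: dist_commute)
      finally have "\<bar>?h y - ?h a\<bar> \<le> C * dist x y + C * dist x a" by (simp add: distrib_left)
      moreover have "\<bar>\<sigma> * dist x y\<bar> \<le> 1 * dist x y"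
        unfolding abs_mult using assms(3) by (intro mult_mono) auto
      moreover have "\<epsilon> * R \<le> \<epsilon> * dist x a" using 3 assms(7) by (intro mult_left_mono)
      ultimately show ?thesis using 3 short by (simp add: k_def distrib_right)
    qed simp
  qed
  have k_lip: "k a - k b \<le> (C + \<epsilon>) * dist a b" if "a \<in> A" "b \<in> A" for a b
  proof -
    consider "a = x" | "b = x" | "a \<noteq> x" "b \<noteq> x" by blast
    then show ?thesis
    proof cases
      case 1
      then show ?thesis using at_x[OF that(2)] by simp
    next
      case 2
      then show ?thesis using at_x[OF that(1)] by (simp add: dist_commute)
    next
      case 3
      have "\<bar>?h a - ?h b\<bar> \<le> C * dist a b"
        using lip0_norm_bound[of h0 a b] mult_right_mono[OF assms(1), of "dist a b"] by simp
      with 3 weaken[of "dist a b"] show ?thesis by (simp add: k_def)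
    qed
  qed
  have "A \<noteq> {}" by (simp add: A_def)
  from McShane_extension[OF this k_lip \<open>0 \<le> C + \<epsilon>\<close>]
  obtain g where g: "\<And>a. a \<in> A \<Longrightarrow> g a = k a" "\<And>u v. \<bar>g u - g v\<bar> \<le> (C + \<epsilon>) * dist u v" by blast
  have "0 < R" using assms(6) zero_le_dist[of x y] by linarith
  have outside: "g z = ?h z" if "z \<notin> ball x R" for z
    using g(1)[of z] that \<open>0 < R\<close> by (auto simp: A_def k_def)
  obtain h where h: "lip0_apply h = g" "norm h \<le> C + \<epsilon>"
    using lip0_of_function[OF g(2) _ \<open>0 \<le> C + \<epsilon>\<close>] outside[OF assms(5)] by auto
  show ?thesis
  proof (intro exI[of _ h] conjI allI impI)
    show "norm h \<le> C + \<epsilon>" by fact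
    show "slope h x y = \<sigma>"
      using g(1)[of x] g(1)[of y] \<open>x \<noteq> y\<close> by (simp add: slope_def h A_def k_def)
    show "lip0_apply h z = ?h z" if "z \<notin> ball x R" for z using outside[OF that] by (simp add: h)
  qed
qed

section \<open>Daugavet properties, differentiability and slices in length spaces\<close>

text \<open>Disjoint balls meet a finite set only finitely often, so a steep pair can be found far, relative to its
  length, from any finite set of points where the values of \<open>h0\<close> are to be kept.\<close>

lemma prescribe_slope_at_steep_pair:
  fixes f h0 :: "'a::{complete_space, zero} lip0"
  assumes "length_space TYPE('a)" "f \<noteq> 0" "finite N" "0 < \<epsilon>" "norm h0 \<le> C" "1 \<le> C" "\<bar>\<sigma>\<bar> \<le> 1"
  shows "\<exists>x y h. norm f - \<epsilon> < slope f x y \<and> dist x y < \<epsilon> \<and> norm h \<le> C + \<epsilon> \<and>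
    slope h x y = \<sigma> \<and> (\<forall>z\<in>N. lip0_apply h z = lip0_apply h0 z)"
proof -
  obtain X Y R where "separated_steep_pairs f X Y R"
    using separated_steep_pairs_exist[OF assms(1,2)] by blast
  then interpret separated_steep_pairs f X Y R .
  have "finite {n. z \<in> ball (X n) (R n)}" for z
  proof (rule finite_subset)
    show "{n. z \<in> ball (X n) (R n)} \<subseteq> {THE n. z \<in> ball (X n) (R n)}"
    proof
      fix n
      assume "n \<in> {n. z \<in> ball (X n) (R n)}"
      then have "z \<in> ball (X n) (R n)" by simp
      then have "(THE n. z \<in> ball (X n) (R n)) = n"
        by (rule the_equality) (use disjoint \<open>z \<in> ball (X n) (R n)\<close> in blast)
      then show "n \<in> {THE n. z \<in> ball (X n) (R n)}" by simp
    qed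
  qed simp
  then have "finite (\<Union>z\<in>N. {n. z \<in> ball (X n) (R n)})" using assms(3) by blast
  then obtain n0 where n0: "\<And>n z. n0 \<le> n \<Longrightarrow> z \<in> N \<Longrightarrow> z \<notin> ball (X n) (R n)"
    unfolding finite_nat_set_iff_bounded using leD by blast
  obtain n where n: "n0 \<le> n" "(C + 1) / \<epsilon> \<le> real n" "norm f / \<epsilon> \<le> real n"
    using real_arch_simple[of "max (real n0) (max ((C + 1) / \<epsilon>) (norm f / \<epsilon>))"] by auto
  have slope: "norm f - \<epsilon> < slope f (X n) (Y n)" by (rule nearly_maximal[OF n(3) assms(4)])
  have near: "(C + 1) * dist (X n) (Y n) \<le> \<epsilon> * R n"
    by (rule relatively_short[OF n(2) assms(4)]) (use assms(6) in simp)
  obtain h where h: "norm h \<le> C + \<epsilon>" "slope h (X n) (Y n) = \<sigma>"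
    "\<And>z. z \<notin> ball (X n) (R n) \<Longrightarrow> lip0_apply h z = lip0_apply h0 z"
    using prescribe_slope[OF assms(5,6,7) distinct zero_outside inside less_imp_le[OF assms(4)] near]
    by blast
  have "0 < dist (X n) (Y n)" using distinct by simp
  have "2 * dist (X n) (Y n) \<le> (C + 1) * dist (X n) (Y n)" using assms(6) by (intro mult_right_mono) auto
  moreover have "\<epsilon> * R n \<le> \<epsilon> * 1" using radius_le_1 assms(4) by (intro mult_left_mono) auto
  ultimately have "dist (X n) (Y n) < \<epsilon>" using near \<open>0 < dist (X n) (Y n)\<close> by linarith
  with slope h n0[OF n(1)] show ?thesis by (intro exI[of _ "X n"] exI[of _ "Y n"] exI[of _ h]) auto
qed

text \<open>The element \<open>\<mu>\<close> hardly sees anything but finitely many points. So a function norming \<open>\<mu>\<close> can be given slope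
  1 over a short pair where the functional \<open>f\<close> nearly attains its norm, and then it almost norms \<open>\<mu>\<close> and the
  molecule simultaneously.\<close>

lemma daugavet_lip_free_if_length_space:
  assumes "length_space TYPE('a::{complete_space, zero})"
  shows "daugavet_property TYPE('a lip_free)"
proof (rule daugavet_propertyI)
  fix \<phi> :: "'a lip_free \<Rightarrow>\<^sub>L real" and \<mu> :: "'a lip_free" and \<epsilon> :: real
  assume \<phi>: "\<phi> \<noteq> 0" and \<epsilon>: "0 < \<epsilon>" "\<epsilon> < norm \<phi>" "\<epsilon> < norm \<mu>"
  obtain f where f: "\<phi> = lip0_functional f" using lip0_functional_surj .
  define \<delta> where "\<delta> = min 1 (\<epsilon> / (8 * (1 + norm \<phi> * norm \<mu>)))"
  let ?K = "1 + norm \<phi> * norm \<mu>"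
  have "0 \<le> norm \<phi> * norm \<mu>" by simp
  then have K: "1 \<le> ?K" by linarith
  then have "0 < ?K" by linarith
  have \<delta>: "0 < \<delta>" "\<delta> \<le> 1" using \<epsilon>(1) \<open>0 < ?K\<close> by (auto simp: \<delta>_def)
  have "\<delta> \<le> \<epsilon> / (8 * ?K)" by (simp add: \<delta>_def)
  then have \<delta>K: "8 * (\<delta> * ?K) \<le> \<epsilon>" using \<open>0 < ?K\<close> by (simp add: field_simps)
  have "\<delta> * 1 \<le> \<delta> * ?K" using \<delta> K by (intro mult_left_mono) auto
  with \<delta>K \<delta> have \<delta>\<epsilon>: "8 * \<delta> \<le> \<epsilon>" by linarith
  obtain N c where N: "finite N"
    "\<And>g. \<bar>pairing \<mu> g - (\<Sum>z\<in>N. c z * lip0_apply g z)\<bar> \<le> \<delta> * norm g"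
    using pairing_finite_approximation[OF \<delta>(1), of \<mu>] by blast
  have "norm \<mu> - \<delta> < norm \<mu>" using \<delta> by simp
  then obtain g where g: "norm g \<le> 1" "norm \<mu> - \<delta> < pairing \<mu> g"
    by (rule norm_lip_free_less_witness)
  have "f \<noteq> 0" using \<phi> by (simp add: f)
  have "\<bar>1 :: real\<bar> \<le> 1" by simp
  from prescribe_slope_at_steep_pair[OF assms \<open>f \<noteq> 0\<close> N(1) \<delta>(1) g(1) order_refl this]
  obtain x y h where h: "norm f - \<delta> < slope f x y" "norm h \<le> 1 + \<delta>" "slope h x y = 1"
    "\<And>z. z \<in> N \<Longrightarrow> lip0_apply h z = lip0_apply g z" by blast
  have "(\<Sum>z\<in>N. c z * lip0_apply h z) = (\<Sum>z\<in>N. c z * lip0_apply g z)"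
    using h(4) by (intro sum.cong) auto
  moreover have "\<delta> * norm g \<le> \<delta> * 1" "\<delta> * norm h \<le> \<delta> * 2"
    using g(1) h(2) \<delta> by (auto intro!: mult_left_mono)
  ultimately have \<mu>h: "norm \<mu> - 4 * \<delta> \<le> pairing \<mu> h"
    using N(2)[of g] N(2)[of h] g(2) by linarith
  let ?u = "molecule x y" and ?w = "molecule x y + \<phi> (molecule x y) *\<^sub>R \<mu>"
  have \<phi>u: "\<phi> ?u = slope f x y" by (simp add: f lip0_functional.rep_eq)
  have "pairing ?w h = 1 + slope f x y * pairing \<mu> h"
    by (simp add: pairing_simps \<phi>u h(3))
  moreover have "(norm \<phi> - \<delta>) * (norm \<mu> - 4 * \<delta>) \<le> slope f x y * pairing \<mu> h"
    using h(1) \<mu>h \<epsilon> \<delta>\<epsilon> by (intro mult_mono) (auto simp: f)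
  moreover have "(norm \<phi> - \<epsilon>) * (norm \<mu> - \<epsilon>) \<le> (norm \<phi> - \<delta>) * (norm \<mu> - 4 * \<delta>)"
    using \<epsilon> \<delta>\<epsilon> \<delta> by (intro mult_mono) auto
  moreover have "pairing ?w h \<le> norm ?w * (1 + \<delta>)" by (rule pairing_le_norm[OF h(2)])
  moreover have "norm ?w * \<delta> \<le> \<epsilon>"
  proof -
    have "\<bar>\<phi> ?u\<bar> * norm \<mu> \<le> norm \<phi> * norm \<mu>"
      using abs_slope_le_norm[of f x y] by (intro mult_right_mono) (auto simp: f lip0_functional.rep_eq)
    then have "norm ?w \<le> ?K"
      using norm_triangle_ineq[of ?u "\<phi> ?u *\<^sub>R \<mu>"] norm_molecule_le[of x y] by simp
    then have "norm ?w * \<delta> \<le> ?K * \<delta>" using \<delta> by (intro mult_right_mono) auto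
    with \<delta>K \<epsilon>(1) show ?thesis by (simp add: mult.commute)
  qed
  ultimately have "1 + (norm \<phi> - \<epsilon>) * (norm \<mu> - \<epsilon>) - \<epsilon> \<le> norm ?w"
    unfolding distrib_left[of "norm ?w"] mult_1_right by linarith
  moreover have "norm ?u \<le> 1 + \<epsilon>" using norm_molecule_le[of x y] \<epsilon>(1) by linarith
  ultimately show "\<exists>u. norm u \<le> 1 + \<epsilon> \<and>
      1 + (norm \<phi> - \<epsilon>) * (norm \<mu> - \<epsilon>) - \<epsilon> \<le> norm (u + \<phi> u *\<^sub>R \<mu>)" by blast
qed

lemma lip0_apply_sum: "lip0_apply (\<Sum>i\<in>I. g i) x = (\<Sum>i\<in>I. lip0_apply (g i) x)"
  by (induction I rule: infinite_finite_induct) (simp_all add: zero_lip0.rep_eq plus_lip0.rep_eq)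

text \<open>At two given points, at most two of the functions are nonzero.\<close>

lemma norm_sum_disjoint_support_le:
  assumes "finite F" "\<And>n. n \<in> F \<Longrightarrow> norm (\<psi> n) \<le> C" "0 \<le> C" "\<And>n. \<bar>c n\<bar> \<le> 1"
    and disjoint: "\<And>m n z. m \<in> F \<Longrightarrow> n \<in> F \<Longrightarrow> lip0_apply (\<psi> m) z \<noteq> 0 \<Longrightarrow> lip0_apply (\<psi> n) z \<noteq> 0 \<Longrightarrow> m = n"
  shows "norm (\<Sum>n\<in>F. c n *\<^sub>R \<psi> n) \<le> 2 * C"
proof (rule lip0_norm_leI)
  fix z w
  let ?g = "\<Sum>n\<in>F. c n *\<^sub>R \<psi> n"
  let ?A = "{n\<in>F. lip0_apply (\<psi> n) z \<noteq> 0}" and ?B = "{n\<in>F. lip0_apply (\<psi> n) w \<noteq> 0}"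
  have "card ?A \<le> Suc 0" "card ?B \<le> Suc 0"
    using disjoint \<open>finite F\<close> by (auto simp: card_le_Suc0_iff_eq)
  then have "card (?A \<union> ?B) \<le> 2" using card_Un_le[of ?A ?B] by simp
  have "lip0_apply ?g z - lip0_apply ?g w = (\<Sum>n\<in>F. c n * (lip0_apply (\<psi> n) z - lip0_apply (\<psi> n) w))"
    by (simp add: lip0_apply_sum scaleR_lip0.rep_eq sum_subtractf[symmetric] right_diff_distrib)
  also have "\<dots> = (\<Sum>n\<in>?A \<union> ?B. c n * (lip0_apply (\<psi> n) z - lip0_apply (\<psi> n) w))"
    using \<open>finite F\<close> by (intro sum.mono_neutral_right) auto
  also have "\<bar>\<dots>\<bar> \<le> real (card (?A \<union> ?B)) * (C * dist z w)"
  proof (rule order_trans[OF sum_abs], rule sum_bounded_above)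
    fix n
    assume "n \<in> ?A \<union> ?B"
    then have "norm (\<psi> n) \<le> C" using assms(2) by blast
    have "\<bar>c n\<bar> * \<bar>lip0_apply (\<psi> n) z - lip0_apply (\<psi> n) w\<bar> \<le> 1 * (C * dist z w)"
      using assms(4) lip0_norm_bound[of "\<psi> n" z w] mult_right_mono[OF \<open>norm (\<psi> n) \<le> C\<close>, of "dist z w"]
      by (intro mult_mono) auto
    then show "\<bar>c n * (lip0_apply (\<psi> n) z - lip0_apply (\<psi> n) w)\<bar> \<le> C * dist z w"
      by (simp add: abs_mult)
  qed
  also have "\<dots> \<le> 2 * (C * dist z w)"
    using \<open>card (?A \<union> ?B) \<le> 2\<close> \<open>0 \<le> C\<close> by (intro mult_right_mono) auto
  finally show "\<bar>lip0_apply ?g z - lip0_apply ?g w\<bar> \<le> 2 * C * dist z w" by simp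
qed (use assms in simp)

text \<open>The signed sums of the \<open>\<psi> n\<close> being bounded, the values of a functional on the \<open>\<psi> n\<close> are absolutely
  summable.\<close>

lemma functional_small_on_disjoint_supports:
  fixes \<Phi> :: "'a::{metric_space, zero} lip0 \<Rightarrow>\<^sub>L real"
  assumes "\<And>n::nat. n0 \<le> n \<Longrightarrow> norm (\<psi> n) \<le> C" "0 \<le> C" "0 < \<epsilon>"
    and disjoint: "\<And>m n z. n0 \<le> m \<Longrightarrow> n0 \<le> n \<Longrightarrow> lip0_apply (\<psi> m) z \<noteq> 0 \<Longrightarrow> lip0_apply (\<psi> n) z \<noteq> 0 \<Longrightarrow> m = n"
  shows "\<exists>n\<ge>n0. \<bar>\<Phi> (\<psi> n)\<bar> < \<epsilon>"
proof (rule ccontr)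
  assume "\<not> ?thesis"
  then have large: "\<epsilon> \<le> \<bar>\<Phi> (\<psi> n)\<bar>" if "n0 \<le> n" for n using that by force
  obtain K :: nat where K: "norm \<Phi> * (2 * C) < real K * \<epsilon>"
    using ex_less_of_nat_mult[OF \<open>0 < \<epsilon>\<close>] by blast
  let ?F = "{n0..<n0 + K}" and ?c = "\<lambda>n. sgn (\<Phi> (\<psi> n))"
  have "real K * \<epsilon> = (\<Sum>n\<in>?F. \<epsilon>)" by simp
  also have "\<dots> \<le> (\<Sum>n\<in>?F. \<bar>\<Phi> (\<psi> n)\<bar>)" using large by (intro sum_mono) auto
  also have "\<dots> = \<Phi> (\<Sum>n\<in>?F. ?c n *\<^sub>R \<psi> n)"
    by (simp add: blinfun.sum_right blinfun.scaleR_right abs_sgn mult.commute)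
  also have "\<dots> \<le> norm \<Phi> * norm (\<Sum>n\<in>?F. ?c n *\<^sub>R \<psi> n)"
    using norm_blinfun[of \<Phi> "\<Sum>n\<in>?F. ?c n *\<^sub>R \<psi> n"] by simp
  also have "\<dots> \<le> norm \<Phi> * (2 * C)"
    using assms by (intro mult_left_mono norm_sum_disjoint_support_le) (auto simp: abs_sgn_eq)
  finally show False using K by simp
qed

text \<open>The functional \<open>\<Phi>\<close> need not be weak\<open>*\<close> continuous, so it could notice the change of a single test function.
  But it cannot notice all of infinitely many changes with disjoint supports.\<close>

lemma daugavet_lip0_if_length_space:
  assumes "length_space TYPE('a::{complete_space, zero})"
  shows "daugavet_property TYPE('a lip0)"
proof (rule daugavet_propertyI)
  fix \<Phi> :: "'a lip0 \<Rightarrow>\<^sub>L real" and f :: "'a lip0" and \<epsilon> :: real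
  assume "f \<noteq> 0" and \<epsilon>: "0 < \<epsilon>" "\<epsilon> < norm \<Phi>" "\<epsilon> < norm f"
  obtain X Y R where "separated_steep_pairs f X Y R"
    using separated_steep_pairs_exist[OF assms \<open>f \<noteq> 0\<close>] by blast
  then interpret separated_steep_pairs f X Y R .
  have "norm \<Phi> - \<epsilon> / 2 < norm \<Phi>" using \<epsilon> by simp
  then obtain h0 where h0: "norm h0 \<le> 1" "norm \<Phi> - \<epsilon> / 2 < \<Phi> h0"
    by (rule norm_blinfun_less_witness)
  obtain n0 :: nat where n0: "2 / \<epsilon> \<le> real n0" "norm f / \<epsilon> \<le> real n0"
    using real_arch_simple[of "max (2 / \<epsilon>) (norm f / \<epsilon>)"] by auto
  have "\<exists>h. n0 \<le> n \<longrightarrow> norm h \<le> 1 + \<epsilon> \<and> slope h (X n) (Y n) = 1 \<and>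
      (\<forall>z. z \<notin> ball (X n) (R n) \<longrightarrow> lip0_apply h z = lip0_apply h0 z)" for n
  proof (cases "n0 \<le> n")
    case True
    have "(1 + 1) * dist (X n) (Y n) \<le> \<epsilon> * R n"
      using n0(1) True by (intro relatively_short[OF _ \<epsilon>(1)]) auto
    moreover have "\<bar>1 :: real\<bar> \<le> 1" by simp
    ultimately show ?thesis
      using prescribe_slope[OF h0(1) order_refl _ distinct zero_outside inside less_imp_le[OF \<epsilon>(1)]]
      by metis
  qed simp
  then obtain h where h: "\<And>n. n0 \<le> n \<Longrightarrow> norm (h n) \<le> 1 + \<epsilon>" "\<And>n. n0 \<le> n \<Longrightarrow> slope (h n) (X n) (Y n) = 1"
    "\<And>n z. n0 \<le> n \<Longrightarrow> z \<notin> ball (X n) (R n) \<Longrightarrow> lip0_apply (h n) z = lip0_apply h0 z" by metis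
  have support: "z \<in> ball (X n) (R n)" if "lip0_apply (h n - h0) z \<noteq> 0" "n0 \<le> n" for n z
    using h(3)[OF that(2), of z] that(1) by (auto simp: minus_lip0.rep_eq)
  have "\<exists>n\<ge>n0. \<bar>\<Phi> (h n - h0)\<bar> < \<epsilon> / 2"
  proof (rule functional_small_on_disjoint_supports[where C = "2 + \<epsilon>"])
    fix n
    assume "n0 \<le> n"
    then show "norm (h n - h0) \<le> 2 + \<epsilon>"
      using h(1) h0(1) norm_triangle_ineq4[of "h n" h0] by fastforce
  next
    fix m n z
    assume "n0 \<le> m" "n0 \<le> n" "lip0_apply (h m - h0) z \<noteq> 0" "lip0_apply (h n - h0) z \<noteq> 0"
    then show "m = n" using support disjoint by blast
  qed (use \<epsilon> in auto)
  then obtain n where n: "n0 \<le> n" "\<bar>\<Phi> (h n - h0)\<bar> < \<epsilon> / 2" by blast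
  then have \<Phi>h: "norm \<Phi> - \<epsilon> < \<Phi> (h n)" using h0(2) unfolding blinfun.diff_right by linarith
  have "norm f - \<epsilon> < slope f (X n) (Y n)"
    using n0(2) n(1) by (intro nearly_maximal \<epsilon>(1)) auto
  then have "(norm \<Phi> - \<epsilon>) * (norm f - \<epsilon>) \<le> \<Phi> (h n) * slope f (X n) (Y n)"
    using \<Phi>h \<epsilon> by (intro mult_mono) auto
  also have "1 + \<dots> = slope (h n + \<Phi> (h n) *\<^sub>R f) (X n) (Y n)"
    by (simp add: slope_add slope_scaleR h(2)[OF n(1)])
  also have "\<dots> \<le> norm (h n + \<Phi> (h n) *\<^sub>R f)" by (rule slope_le_norm)
  finally have "1 + (norm \<Phi> - \<epsilon>) * (norm f - \<epsilon>) - \<epsilon> \<le> norm (h n + \<Phi> (h n) *\<^sub>R f)"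
    using \<epsilon>(1) by simp
  with h(1)[OF n(1)] show "\<exists>h. norm h \<le> 1 + \<epsilon> \<and>
      1 + (norm \<Phi> - \<epsilon>) * (norm f - \<epsilon>) - \<epsilon> \<le> norm (h + \<Phi> h *\<^sub>R f)" by blast
qed

text \<open>A direction \<open>h\<close> that has slope at least 1 on every other pair of a separated sequence of steep pairs and
  slope 0 on the remaining ones makes the norm grow with rate at least 1 to the right of \<open>f\<close>, while to the
  left it does not fall below its value at \<open>f\<close>.\<close>

lemma not_gateaux_differentiable_if_length_space:
  fixes f :: "'a::{complete_space, zero} lip0"
  assumes "length_space TYPE('a)" "\<exists>x :: 'a. x \<noteq> 0"
  shows "\<not> norm_gateaux_differentiable_at f"
proof -
  have "\<exists>h. (\<forall>t>0. norm f + t \<le> norm (f + t *\<^sub>R h)) \<and> (\<forall>t<0. norm f \<le> norm (f + t *\<^sub>R h))"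
  proof (cases "f = 0")
    case True
    obtain x :: 'a where "x \<noteq> 0" using assms(2) by blast
    obtain h where "slope h x 0 = 1" using slope_eq_1_exists[OF \<open>x \<noteq> 0\<close>] .
    then have "1 \<le> norm h" using slope_le_norm[of h x 0] by simp
    then have "t \<le> \<bar>t\<bar> * norm h" if "0 < t" for t using that by simp
    then show ?thesis using True by (intro exI[of _ h]) (auto simp: mult_nonpos_nonneg)
  next
    case False
    obtain X Y R where "separated_steep_pairs f X Y R"
      using separated_steep_pairs_exist[OF assms(1) False] by blast
    then interpret separated_steep_pairs f X Y R .
    let ?d = "\<lambda>n. dist (X n) (Y n)"
    have pos: "0 < ?d n" for n using distinct by simp
    \<comment> \<open>The direction is the distance to the complement of the balls around the \<open>X n\<close> with even \<open>n\<close>. Each of these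
      balls has \<open>Y n\<close> on its boundary sphere, which gives slope at least 1 over \<open>(X n, Y n)\<close>.\<close>
    define U where "U = (\<Union>k. ball (X (2 * k)) (?d (2 * k)))"
    have U: "z \<in> ball (X n) (?d n) \<and> even n" if z: "z \<in> U" "z \<in> ball (X n) (R n)" for z n
    proof -
      obtain k where k: "z \<in> ball (X (2 * k)) (?d (2 * k))" using z(1) by (auto simp: U_def)
      then have "z \<in> ball (X (2 * k)) (R (2 * k))" using inside[of "2 * k"] by auto
      with disjoint[of "2 * k" n] z(2) have "2 * k = n" by blast
      with k show ?thesis by auto
    qed
    have in_ball: "X n \<in> ball (X n) (R n)" "Y n \<in> ball (X n) (R n)" for n
      using radius_pos inside by auto
    have Y: "Y n \<notin> U" for n using U[OF _ in_ball(2)] by auto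
    have X: "X n \<notin> U" if "odd n" for n using U[OF _ in_ball(1)] that by auto
    have "0 \<notin> U"
    proof
      assume "0 \<in> U"
      then obtain k where "0 \<in> ball (X (2 * k)) (?d (2 * k))" by (auto simp: U_def)
      then show False using zero_outside[of "2 * k"] inside[of "2 * k"] by auto
    qed
    let ?k = "\<lambda>z. infdist z (- U)"
    have "\<bar>?k u - ?k v\<bar> \<le> 1 * dist u v" for u v using infdist_triangle_abs[of u "- U" v] by simp
    moreover have "?k 0 = 0" using \<open>0 \<notin> U\<close> by simp
    ultimately obtain h where h: "lip0_apply h = ?k" by (rule lip0_of_function) auto
    have far: "?d (2 * k) \<le> ?k (X (2 * k))" for k
    proof -
      have "- U \<noteq> {}" using \<open>0 \<notin> U\<close> by blast
      moreover have "?d (2 * k) \<le> dist (X (2 * k)) a" if "a \<in> - U" for a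
        using that by (force simp: U_def not_less)
      ultimately show ?thesis unfolding infdist_def by (auto intro!: cINF_greatest)
    qed
    have slope_even: "1 \<le> slope h (X (2 * k)) (Y (2 * k))" for k
      using far[of k] Y[of "2 * k"] pos[of "2 * k"] by (simp add: slope_def h)
    have slope_odd: "slope h (X (2 * k + 1)) (Y (2 * k + 1)) = 0" for k
      using X[of "2 * k + 1"] Y[of "2 * k + 1"] by (simp add: slope_def h)
    have limit: "norm f + r \<le> B"
      if "\<And>k. \<exists>n\<ge>k. norm f * (1 - 1 / (real n + 1)) + r \<le> B" for r B
    proof -
      have "norm f + r - B \<le> norm f * e" if "0 < e" for e
      proof -
        obtain k :: nat where k: "1 / e \<le> real k" using real_arch_simple by blast
        obtain n where n: "n \<ge> k" "norm f * (1 - 1 / (real n + 1)) + r \<le> B"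
          using \<open>\<And>k. \<exists>n\<ge>k. _ n + r \<le> B\<close> by blast
        have "1 / e \<le> real n + 1" using k n(1) by linarith
        then have "1 / (real n + 1) \<le> e" using \<open>0 < e\<close> by (simp add: field_simps)
        then have "norm f * (1 / (real n + 1)) \<le> norm f * e" by (rule mult_left_mono) simp
        with n(2) show ?thesis by (simp add: right_diff_distrib)
      qed
      from nonpos_if_le_arbitrary_multiple[OF this] show ?thesis by simp
    qed
    show ?thesis
    proof (intro exI[of _ h] conjI allI impI)
      fix t :: real
      assume "0 < t"
      show "norm f + t \<le> norm (f + t *\<^sub>R h)"
      proof (rule limit)
        fix k
        have "t * 1 \<le> t * slope h (X (2 * k)) (Y (2 * k))"
          using slope_even \<open>0 < t\<close> by (intro mult_left_mono) auto
        then have "norm f * (1 - 1 / (real (2 * k) + 1)) + t \<le> slope (f + t *\<^sub>R h) (X (2 * k)) (Y (2 * k))"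
          using steep[of "2 * k"] by (simp add: slope_add slope_scaleR)
        also have "\<dots> \<le> norm (f + t *\<^sub>R h)" by (rule slope_le_norm)
        finally show "\<exists>n\<ge>k. norm f * (1 - 1 / (real n + 1)) + t \<le> norm (f + t *\<^sub>R h)"
          by (intro exI[of _ "2 * k"]) auto
      qed
    next
      fix t :: real
      have "norm f + 0 \<le> norm (f + t *\<^sub>R h)"
      proof (rule limit)
        fix k
        have "norm f * (1 - 1 / (real (2 * k + 1) + 1)) + 0 \<le> slope (f + t *\<^sub>R h) (X (2 * k + 1)) (Y (2 * k + 1))"
          using steep[of "2 * k + 1"] unfolding slope_add slope_scaleR slope_odd by linarith
        also have "\<dots> \<le> norm (f + t *\<^sub>R h)" by (rule slope_le_norm)
        finally show "\<exists>n\<ge>k. norm f * (1 - 1 / (real n + 1)) + 0 \<le> norm (f + t *\<^sub>R h)"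
          by (intro exI[of _ "2 * k + 1"]) auto
      qed
      then show "norm f \<le> norm (f + t *\<^sub>R h)" by simp
    qed
  qed
  then obtain h where h: "\<And>t. 0 < t \<Longrightarrow> norm f + t \<le> norm (f + t *\<^sub>R h)"
    "\<And>t. t < 0 \<Longrightarrow> norm f \<le> norm (f + t *\<^sub>R h)" by blast
  let ?Q = "\<lambda>t. (norm (f + t *\<^sub>R h) - norm f) / t"
  show ?thesis
  proof
    assume "norm_gateaux_differentiable_at f"
    then obtain l where l: "(?Q \<longlongrightarrow> l) (at 0)" unfolding norm_gateaux_differentiable_at_def by blast
    then have right: "(?Q \<longlongrightarrow> l) (at_right 0)" and left: "(?Q \<longlongrightarrow> l) (at_left 0)"
      using filterlim_at_split by blast+
    have "1 \<le> l"
    proof (rule tendsto_lowerbound[OF right])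
      have "1 \<le> ?Q t" if "0 < t" for t using h(1)[OF that] that by (simp add: le_divide_eq)
      then show "\<forall>\<^sub>F t in at_right 0. 1 \<le> ?Q t" by (auto simp: eventually_at_filter)
    qed simp
    moreover have "l \<le> 0"
    proof (rule tendsto_upperbound[OF left])
      have "?Q t \<le> 0" if "t < 0" for t using h(2)[OF that] that by (simp add: divide_nonneg_neg)
      then show "\<forall>\<^sub>F t in at_left 0. ?Q t \<le> 0" by (auto simp: eventually_at_filter)
    qed simp
    ultimately show False by simp
  qed
qed

text \<open>The pairs are chosen one after the other; the ends of the earlier ones are finitely many points whose values
  are kept.\<close>

lemma prescribe_slopes_at_steep_pairs:
  fixes f :: "'i \<Rightarrow> 'a::{complete_space, zero} lip0"
  assumes "length_space TYPE('a)" "finite I" "\<And>i. i \<in> I \<Longrightarrow> f i \<noteq> 0" "\<And>i. i \<in> I \<Longrightarrow> \<bar>\<sigma> i\<bar> \<le> 1" "0 < \<epsilon>"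
  shows "\<exists>x y h. norm h \<le> 1 + \<epsilon> \<and>
    (\<forall>i\<in>I. norm (f i) - \<epsilon> < slope (f i) (x i) (y i) \<and> slope h (x i) (y i) = \<sigma> i)"
  using assms(2-5)
proof (induction I arbitrary: \<epsilon> rule: finite_induct)
  case empty
  have "norm (0 :: 'a lip0) \<le> 1 + \<epsilon>" using empty by simp
  then show ?case by blast
next
  case (insert j I)
  have "0 < \<epsilon> / 2" using insert.prems by simp
  with insert obtain x y h0 where IH: "norm h0 \<le> 1 + \<epsilon> / 2"
    "\<forall>i\<in>I. norm (f i) - \<epsilon> / 2 < slope (f i) (x i) (y i) \<and> slope h0 (x i) (y i) = \<sigma> i"
    by (metis insertCI)
  have "finite (x ` I \<union> y ` I)" using insert.hyps by simp
  moreover have "1 \<le> 1 + \<epsilon> / 2" using insert.prems by simp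
  ultimately obtain a b h where h: "norm (f j) - \<epsilon> / 2 < slope (f j) a b" "norm h \<le> 1 + \<epsilon> / 2 + \<epsilon> / 2"
    "slope h a b = \<sigma> j" "\<And>z. z \<in> x ` I \<union> y ` I \<Longrightarrow> lip0_apply h z = lip0_apply h0 z"
    using prescribe_slope_at_steep_pair[OF assms(1), of "f j" "x ` I \<union> y ` I" "\<epsilon> / 2" h0 "1 + \<epsilon> / 2" "\<sigma> j"]
      insert.prems \<open>0 < \<epsilon> / 2\<close> IH(1) by auto
  have "slope h (x i) (y i) = slope h0 (x i) (y i)" if "i \<in> I" for i
    using h(4) that by (simp add: slope_def)
  then have old: "norm (f i) - \<epsilon> < slope (f i) (x i) (y i) \<and> slope h (x i) (y i) = \<sigma> i" "i \<noteq> j"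
    if "i \<in> I" for i
    using IH(2) that insert.prems insert.hyps by auto
  have new: "norm (f j) - \<epsilon> < slope (f j) a b" using h(1) insert.prems by simp
  have "norm h \<le> 1 + \<epsilon>" using h(2) by simp
  moreover have "\<forall>i\<in>insert j I. norm (f i) - \<epsilon> < slope (f i) ((x(j := a)) i) ((y(j := b)) i) \<and>
      slope h ((x(j := a)) i) ((y(j := b)) i) = \<sigma> i"
    using old new h(3) by auto
  ultimately show ?case by blast
qed

text \<open>In each slice two molecules are chosen, with prescribed slopes 1 and -1 respectively for a common
  function of norm almost 1.\<close>

lemma strong_diameter_2_if_length_space:
  assumes "length_space TYPE('a::{complete_space, zero})"
  shows "strong_diameter_2_property TYPE('a lip_free)"
  unfolding strong_diameter_2_property_def
proof (intro allI impI)
  fix n :: nat and c :: "nat \<Rightarrow> real" and S :: "nat \<Rightarrow> 'a lip_free set"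
  assume *: "1 \<le> n \<and> (\<forall>i\<in>{1..n}. 0 \<le> c i \<and> is_slice (S i)) \<and> (\<Sum>i=1..n. c i) = 1"
  then have c: "\<And>i. i \<in> {1..n} \<Longrightarrow> 0 \<le> c i" "(\<Sum>i=1..n. c i) = 1" by auto
  define Q where "Q i f \<alpha> \<longleftrightarrow> f \<noteq> 0 \<and> 0 < \<alpha> \<and> S i = {u \<in> cball 0 1. norm f - \<alpha> < pairing u f}" for i f \<alpha>
  have "\<exists>f \<alpha>. Q i f \<alpha>" if "i \<in> {1..n}" for i
  proof -
    from * \<open>i \<in> {1..n}\<close> obtain \<phi> \<alpha> where
      "\<phi> \<noteq> 0" "0 < \<alpha>" "S i = {u \<in> cball 0 1. norm \<phi> - \<alpha> < blinfun_apply \<phi> u}"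
      unfolding is_slice_iff by blast
    moreover obtain f where "\<phi> = lip0_functional f" using lip0_functional_surj .
    ultimately show ?thesis
      by (intro exI[of _ f] exI[of _ \<alpha>]) (simp add: lip0_functional.rep_eq Q_def)
  qed
  then obtain f \<alpha> where "\<And>i. i \<in> {1..n} \<Longrightarrow> Q i (f i) (\<alpha> i)" by metis
  then have S: "f i \<noteq> 0 \<and> 0 < \<alpha> i \<and> S i = {u \<in> cball 0 1. norm (f i) - \<alpha> i < pairing u (f i)}"
    if "i \<in> {1..n}" for i using that unfolding Q_def by blast
  let ?T = "{\<Sum>i=1..n. c i *\<^sub>R s i | s. \<forall>i\<in>{1..n}. s i \<in> S i}"
  show "diameter ?T = 2"
  proof (rule diameter_eq_2I)
    show "?T \<subseteq> cball 0 1"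
    proof clarify
      fix s
      assume "\<forall>i\<in>{1..n}. s i \<in> S i"
      then have "norm (s i) \<le> 1" if "i \<in> {1..n}" for i using S[OF that] that by auto
      with c(1) have "norm (\<Sum>i=1..n. c i *\<^sub>R s i) \<le> (\<Sum>i=1..n. c i)"
        by (rule norm_convex_combination_le)
      then show "(\<Sum>i=1..n. c i *\<^sub>R s i) \<in> cball 0 1" using c(2) by simp
    qed
    fix \<epsilon> :: real
    assume "0 < \<epsilon>"
    define \<delta> where "\<delta> = Min (insert (\<epsilon> / 2) (\<alpha> ` {1..n}))"
    have \<delta>: "0 < \<delta>" "\<delta> \<le> \<epsilon> / 2" "\<And>i. i \<in> {1..n} \<Longrightarrow> \<delta> \<le> \<alpha> i"
    proof -
      show "0 < \<delta>" using S \<open>0 < \<epsilon>\<close> by (auto simp: \<delta>_def)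
      show "\<delta> \<le> \<epsilon> / 2" unfolding \<delta>_def by (intro Min_le) auto
      show "\<delta> \<le> \<alpha> i" if "i \<in> {1..n}" for i unfolding \<delta>_def using that by (intro Min_le) auto
    qed
    have "\<exists>x y h. norm h \<le> 1 + \<delta> \<and> (\<forall>p\<in>{1..n} \<times> (UNIV :: bool set).
        norm (f (fst p)) - \<delta> < slope (f (fst p)) (x p) (y p) \<and> slope h (x p) (y p) = (if snd p then 1 else - 1))"
      using S \<delta>(1) by (intro prescribe_slopes_at_steep_pairs[OF assms]) auto
    then obtain x y h where h: "norm h \<le> 1 + \<delta>"
      "\<And>i b. i \<in> {1..n} \<Longrightarrow> norm (f i) - \<delta> < slope (f i) (x (i, b)) (y (i, b))"
      "\<And>i b. i \<in> {1..n} \<Longrightarrow> slope h (x (i, b)) (y (i, b)) = (if b then 1 else - 1)" by force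
    define s where "s b i = molecule (x (i, b)) (y (i, b))" for b :: bool and i
    have "s b i \<in> S i" if "i \<in> {1..n}" for b i
      using S[OF that] h(2)[OF that, of b] \<delta>(3)[OF that] by (simp add: s_def norm_molecule_le)
    then have mem: "(\<Sum>i=1..n. c i *\<^sub>R s b i) \<in> ?T" for b by blast
    let ?w = "(\<Sum>i=1..n. c i *\<^sub>R s True i) - (\<Sum>i=1..n. c i *\<^sub>R s False i)"
    have "pairing ?w h = (\<Sum>i=1..n. c i * 1) - (\<Sum>i=1..n. c i * (- 1))"
      unfolding pairing_diff_left pairing_sum_left
      by (intro arg_cong2[where f = "(-)"] sum.cong refl) (simp_all add: pairing_simps s_def h(3))
    then have "pairing ?w h = 2" using c(2) by (simp add: sum_negf)
    then have "2 \<le> norm ?w * (1 + \<delta>)" using pairing_le_norm[OF h(1), of ?w] by simp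
    moreover have "norm ?w \<le> 2"
    proof -
      have "norm (\<Sum>i=1..n. c i *\<^sub>R s b i) \<le> 1" for b
        using mem[of b] \<open>?T \<subseteq> cball 0 1\<close> by auto
      from this[of True] this[of False] show ?thesis
        using norm_triangle_ineq4[of "\<Sum>i=1..n. c i *\<^sub>R s True i" "\<Sum>i=1..n. c i *\<^sub>R s False i"] by linarith
    qed
    then have "norm ?w * \<delta> \<le> 2 * (\<epsilon> / 2)" using \<delta> by (intro mult_mono) auto
    ultimately have "2 - \<epsilon> \<le> norm ?w" by (simp add: distrib_left)
    then show "\<exists>u\<in>?T. \<exists>v\<in>?T. 2 - \<epsilon> \<le> norm (u - v)"
      by (rule bexI[OF bexI[OF _ mem[of False]] mem[of True]])
  qed
qed

section \<open>Convex combinations of slices in weakly open sets\<close>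

text \<open>Bourgain's lemma. Finitely many functionals define a seminorm coming from a positive form \<open>q\<close>. A point of
  the ball that is almost farthest, in this seminorm, from some center has a slice around it that is
  small in this seminorm. Taking the centers far away in a given direction shows that the
  points with small slices are, as far as \<open>q\<close> can tell, not contained in any smaller half-space than the ball;
  so their convex hull comes close to every point of the ball.\<close>

locale functionals_seminorm =
  fixes F :: "('b::banach \<Rightarrow>\<^sub>L real) set"
  assumes finite_F: "finite F"
begin

definition q :: "'b \<Rightarrow> 'b \<Rightarrow> real" where
  "q u v = (\<Sum>\<phi>\<in>F. blinfun_apply \<phi> u * blinfun_apply \<phi> v)"

lemma q_add_left: "q (u + v) w = q u w + q v w"
  and q_add_right: "q w (u + v) = q w u + q w v"
  and q_diff_left: "q (u - v) w = q u w - q v w"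
  and q_diff_right: "q w (u - v) = q w u - q w v"
  and q_scale_left: "q (c *\<^sub>R u) w = c * q u w"
  and q_scale_right: "q w (c *\<^sub>R u) = c * q w u"
  by (simp_all add: q_def blinfun.bilinear_simps algebra_simps sum.distrib sum_subtractf
      sum_distrib_left)

lemmas q_simps = q_add_left q_add_right q_diff_left q_diff_right q_scale_left q_scale_right

lemma q_commute: "q u v = q v u"
  by (simp add: q_def mult.commute)

lemma q_square_add: "q (u + v) (u + v) = q u u + 2 * q u v + q v v"
  by (simp add: q_simps q_commute[of v u])

lemma q_nonneg: "0 \<le> q u u"
  by (simp add: q_def sum_nonneg)

lemma square_le_q: "\<phi> \<in> F \<Longrightarrow> (blinfun_apply \<phi> u)\<^sup>2 \<le> q u u"
  unfolding q_def power2_eq_square by (rule member_le_sum) (auto simp: finite_F)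

lemma abs_less_if_q_less:
  assumes "\<phi> \<in> F" "q u u < r\<^sup>2" "0 \<le> r"
  shows "\<bar>blinfun_apply \<phi> u\<bar> < r"
  using square_le_q[OF assms(1), of u] assms(2,3) by (intro power2_less_imp_less[of _ r]) simp_all

lemma q_le: "q u u \<le> (\<Sum>\<phi>\<in>F. (norm \<phi>)\<^sup>2) * (norm u)\<^sup>2"
  unfolding q_def sum_distrib_right
proof (rule sum_mono)
  fix \<phi> :: "'b \<Rightarrow>\<^sub>L real"
  have "\<bar>\<phi> u\<bar> \<le> norm \<phi> * norm u" using norm_blinfun[of \<phi> u] by simp
  then have "\<bar>\<phi> u\<bar>\<^sup>2 \<le> (norm \<phi> * norm u)\<^sup>2" by (intro power_mono) auto
  then have "(\<phi> u)\<^sup>2 \<le> (norm \<phi>)\<^sup>2 * (norm u)\<^sup>2" by (simp add: power_mult_distrib)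
  then show "\<phi> u * \<phi> u \<le> (norm \<phi>)\<^sup>2 * (norm u)\<^sup>2" by (simp add: power2_eq_square)
qed

definition small_slice_points :: "real \<Rightarrow> 'b set" where
  "small_slice_points r = {e \<in> cball 0 1. \<exists>S. is_slice S \<and> (\<forall>u\<in>S. q (u - e) (u - e) < r)}"

lemma small_slice_points_extreme_in_direction:
  assumes "0 < q w w" "norm u0 \<le> 1" "0 < r" "0 < \<xi>"
  shows "\<exists>e\<in>small_slice_points r. q w u0 - \<xi> \<le> q w e"
proof -
  define C where "C = (\<Sum>\<phi>\<in>F. (norm \<phi>)\<^sup>2)"
  have "0 \<le> C" by (simp add: C_def sum_nonneg)
  define \<sigma> where "\<sigma> = r / 3"
  have "0 < \<sigma>" using assms by (simp add: \<sigma>_def)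
  \<comment> \<open>The center is \<open>- t w\<close>; the bound on \<open>t\<close> makes the curvature of the seminorm ball around it negligible.\<close>
  define t where "t = 1 + (\<sigma> + C) / (2 * \<xi>) + \<sigma> / q w w"
  have t: "1 \<le> t" "(\<sigma> + C) / (2 * \<xi>) \<le> t" "\<sigma> / q w w \<le> t"
  proof -
    have "0 \<le> (\<sigma> + C) / (2 * \<xi>)" "0 \<le> \<sigma> / q w w" using assms \<open>0 \<le> C\<close> \<open>0 < \<sigma>\<close> by simp_all
    then show "1 \<le> t" "(\<sigma> + C) / (2 * \<xi>) \<le> t" "\<sigma> / q w w \<le> t" unfolding t_def by linarith+
  qed
  define N where "N u = q (u + t *\<^sub>R w) (u + t *\<^sub>R w)" for u
  have N: "N u = q u u + 2 * t * q w u + t * t * q w w" for u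
    by (simp add: N_def q_simps q_commute[of u w] algebra_simps)
  have bound: "N u \<le> C * (1 + norm (t *\<^sub>R w))\<^sup>2" if "u \<in> cball 0 1" for u
  proof -
    have "norm (u + t *\<^sub>R w) \<le> 1 + norm (t *\<^sub>R w)"
      using that norm_triangle_ineq[of u "t *\<^sub>R w"] by simp
    then have "(norm (u + t *\<^sub>R w))\<^sup>2 \<le> (1 + norm (t *\<^sub>R w))\<^sup>2" by (intro power_mono) auto
    then have "C * (norm (u + t *\<^sub>R w))\<^sup>2 \<le> C * (1 + norm (t *\<^sub>R w))\<^sup>2"
      using \<open>0 \<le> C\<close> by (intro mult_left_mono)
    then show ?thesis using q_le[of "u + t *\<^sub>R w"] unfolding N_def C_def by linarith
  qed
  then have bdd: "bdd_above (N ` cball 0 1)" by (intro bdd_aboveI2)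
  define m where "m = (SUP u\<in>cball 0 1. N u)"
  have le_m: "N u \<le> m" if "norm u \<le> 1" for u
    unfolding m_def using that by (intro cSUP_upper[OF _ bdd]) simp
  have "m - \<sigma> < Sup (N ` cball 0 1)" using \<open>0 < \<sigma>\<close> by (simp add: m_def)
  moreover have "N ` cball 0 1 \<noteq> {}" by simp
  ultimately obtain e where e: "norm e \<le> 1" "m - \<sigma> < N e"
    using less_cSup_iff[OF _ bdd] by auto
  define G where "G = (\<Sum>\<phi>\<in>F. blinfun_apply \<phi> (e + t *\<^sub>R w) *\<^sub>R \<phi>)"
  have G: "G u = q (e + t *\<^sub>R w) u" for u
    by (simp add: G_def q_def blinfun.sum_left blinfun.scaleR_left)
  have "\<sigma> \<le> t * q w w" using t(3) assms(1) by (simp add: divide_le_eq)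
  also have "\<dots> \<le> t * t * q w w" using t(1) assms(1) by (intro mult_right_mono) auto
  also have "\<dots> = N 0" by (simp add: N q_def)
  also have "\<dots> \<le> m" by (rule le_m) simp
  finally have "0 < G (e + t *\<^sub>R w)" using e(2) by (simp add: G N_def)
  then have "G \<noteq> 0" by auto
  have "is_slice {u \<in> cball 0 1. norm G - \<sigma> < G u}"
    unfolding is_slice_iff using \<open>G \<noteq> 0\<close> \<open>0 < \<sigma>\<close> by blast
  moreover have "q (u - e) (u - e) < r" if "u \<in> {u \<in> cball 0 1. norm G - \<sigma> < G u}" for u
  proof -
    have eq: "(e + t *\<^sub>R w) + (u - e) = u + t *\<^sub>R w" by simp
    have "N u = N e + 2 * (G u - G e) + q (u - e) (u - e)"
      using q_square_add[of "e + t *\<^sub>R w" "u - e"] unfolding eq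
      by (simp add: N_def G q_diff_right[symmetric])
    moreover have "N u < N e + \<sigma>" using le_m[of u] e(2) that by simp
    moreover have "G e \<le> norm G"
      using abs_blinfun_le[OF e(1), of G] by simp
    ultimately show ?thesis using that by (simp add: \<sigma>_def)
  qed
  ultimately have "e \<in> small_slice_points r" using e(1) unfolding small_slice_points_def by auto
  moreover have "q w u0 - \<xi> \<le> q w e"
  proof -
    have "N u0 - \<sigma> \<le> N e" using le_m[OF assms(2)] e(2) by linarith
    moreover have "q e e \<le> C"
    proof -
      have "C * (norm e)\<^sup>2 \<le> C * 1" using e(1) \<open>0 \<le> C\<close> by (intro mult_left_mono) (auto simp: power_le_one)
      then show ?thesis using q_le[of e] by (simp add: C_def)
    qed
    ultimately have "2 * t * q w u0 \<le> 2 * t * q w e + (\<sigma> + C)"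
      using q_nonneg[of u0] unfolding N by linarith
    moreover have "\<sigma> + C \<le> 2 * t * \<xi>" using t(2) assms(4) by (simp add: divide_le_eq mult_ac)
    ultimately have "2 * t * q w u0 \<le> 2 * t * (q w e + \<xi>)" by (simp add: distrib_left)
    then show ?thesis using t(1) by simp
  qed
  ultimately show ?thesis by blast
qed

text \<open>Otherwise a point of the convex hull almost nearest to \<open>\<mu>\<close> could be improved by moving towards a point with
  a small slice that lies about as far in the direction of \<open>\<mu>\<close> as \<open>\<mu>\<close> itself.\<close>

lemma small_slice_points_nearly_fill_ball:
  assumes "0 < q z z" "norm \<mu> \<le> 1" "0 < r"
  shows "\<exists>\<kappa>\<in>convex hull small_slice_points r. q (\<kappa> - \<mu>) (\<kappa> - \<mu>) < r"
proof (rule ccontr)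
  assume contra: "\<not> ?thesis"
  let ?A = "small_slice_points r"
  define K where "K = convex hull ?A"
  have far: "r \<le> q (\<kappa> - \<mu>) (\<kappa> - \<mu>)" if "\<kappa> \<in> K" for \<kappa>
    using contra that unfolding K_def by (meson not_less)
  have "K \<subseteq> cball 0 1" unfolding K_def by (rule hull_minimal) (auto simp: small_slice_points_def)
  have "K \<noteq> {}"
    using small_slice_points_extreme_in_direction[OF assms(1), of 0 r 1] assms(3) by (auto simp: K_def)
  define C where "C = (\<Sum>\<phi>\<in>F. (norm \<phi>)\<^sup>2)"
  have "0 \<le> C" by (simp add: C_def sum_nonneg)
  define D where "D = 4 * C + r"
  have D: "0 < D" "r \<le> D" using assms(3) \<open>0 \<le> C\<close> by (auto simp: D_def)
  \<comment> \<open>Moving a fraction \<open>s\<close> of the way to a suitable point decreases the squared distance to \<open>\<mu>\<close> by a fixed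
    amount.\<close>
  define s where "s = r / (2 * D)"
  have s: "0 < s" "s \<le> 1" using D assms(3) by (auto simp: s_def)
  define m where "m = (INF \<kappa>\<in>K. q (\<kappa> - \<mu>) (\<kappa> - \<mu>))"
  have bdd: "bdd_below ((\<lambda>\<kappa>. q (\<kappa> - \<mu>) (\<kappa> - \<mu>)) ` K)" using q_nonneg by (intro bdd_belowI2)
  have "Inf ((\<lambda>\<kappa>. q (\<kappa> - \<mu>) (\<kappa> - \<mu>)) ` K) < m + s * r / 2" using s assms(3) by (simp add: m_def)
  then obtain \<kappa>0 where \<kappa>0: "\<kappa>0 \<in> K" "q (\<kappa>0 - \<mu>) (\<kappa>0 - \<mu>) < m + s * r / 2"
    using cInf_less_iff[OF _ bdd] \<open>K \<noteq> {}\<close> by auto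
  define w where "w = \<mu> - \<kappa>0"
  have "q w w = q (\<kappa>0 - \<mu>) (\<kappa>0 - \<mu>)"
    unfolding w_def by (simp add: q_simps)
  then have w: "r \<le> q w w" "q w w < m + s * r / 2" using far[OF \<kappa>0(1)] \<kappa>0(2) by simp_all
  then have "0 < q w w" using assms(3) by linarith
  then obtain e where e: "e \<in> ?A" "q w \<mu> - r / 4 \<le> q w e"
    using small_slice_points_extreme_in_direction[OF _ assms(2,3), of w "r / 4"] assms(3) by auto
  have "e \<in> K" unfolding K_def using e(1) by (rule hull_inc)
  define d where "d = e - \<kappa>0"
  have "convex K" by (simp add: K_def)
  then have "(1 - s) *\<^sub>R \<kappa>0 + s *\<^sub>R e \<in> K"
    using \<kappa>0(1) \<open>e \<in> K\<close> s by (intro convexD_alt) auto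
  then have "m \<le> q ((1 - s) *\<^sub>R \<kappa>0 + s *\<^sub>R e - \<mu>) ((1 - s) *\<^sub>R \<kappa>0 + s *\<^sub>R e - \<mu>)"
    unfolding m_def by (rule cINF_lower[OF bdd])
  also have "(1 - s) *\<^sub>R \<kappa>0 + s *\<^sub>R e - \<mu> = s *\<^sub>R d - w"
    by (simp add: d_def w_def algebra_simps)
  also have "q (s *\<^sub>R d - w) (s *\<^sub>R d - w) = q w w - 2 * s * q w d + s * (s * q d d)"
    by (simp add: q_simps q_commute[of d w] algebra_simps)
  also have "\<dots> \<le> q w w - 2 * s * (3 / 4 * r) + s * (r / 2)"
  proof -
    have "q w d = q w e - q w \<mu> + q w w"
      by (simp add: d_def w_def q_simps)
    with e(2) w(1) have "3 / 4 * r \<le> q w d" by linarith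
    then have 1: "2 * s * (3 / 4 * r) \<le> 2 * s * q w d" using s by (intro mult_left_mono) auto
    have "norm e \<le> 1" "norm \<kappa>0 \<le> 1" using \<open>K \<subseteq> cball 0 1\<close> \<open>e \<in> K\<close> \<kappa>0(1) by auto
    then have "norm d \<le> 2" using norm_triangle_ineq4[of e \<kappa>0] unfolding d_def by linarith
    then have "(norm d)\<^sup>2 \<le> 2\<^sup>2" by (intro power_mono) auto
    then have "C * (norm d)\<^sup>2 \<le> C * 4" using \<open>0 \<le> C\<close> by (intro mult_left_mono) auto
    then have "q d d \<le> D" using q_le[of d] assms(3) unfolding C_def[symmetric] D_def by linarith
    then have "s * q d d \<le> s * D" using s by (intro mult_left_mono) auto
    also have "\<dots> = r / 2" using D by (simp add: s_def)
    finally have "s * (s * q d d) \<le> s * (r / 2)" using s by (intro mult_left_mono) auto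
    with 1 show ?thesis by linarith
  qed
  also have "\<dots> = q w w - s * r" by (simp add: algebra_simps)
  finally have "m \<le> q w w - s * r" .
  moreover have "0 < s * r" using s assms(3) by simp
  ultimately show False using w(2) by linarith
qed

end

lemma convex_combination_of_slices_weakly_near:
  fixes \<mu> :: "'b::banach" and F :: "('b \<Rightarrow>\<^sub>L real) set"
  assumes "finite F" "norm \<mu> \<le> 1" "0 < \<eta>" and nontrivial: "\<exists>\<psi> :: 'b \<Rightarrow>\<^sub>L real. \<psi> \<noteq> 0"
  shows "\<exists>(n :: nat) c (S :: nat \<Rightarrow> 'b set). 1 \<le> n \<and> (\<forall>i\<in>{1..n}. 0 \<le> c i \<and> is_slice (S i)) \<and>
    (\<Sum>i=1..n. c i) = 1 \<and> (\<forall>s. (\<forall>i\<in>{1..n}. s i \<in> S i) \<longrightarrow>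
      (\<forall>\<phi>\<in>F. \<bar>blinfun_apply \<phi> (\<Sum>i=1..n. c i *\<^sub>R s i) - \<phi> \<mu>\<bar> < \<eta>))"
proof -
  obtain \<psi> :: "'b \<Rightarrow>\<^sub>L real" and z where "\<psi> z \<noteq> 0"
    using nontrivial by (metis blinfun_eqI zero_blinfun.rep_eq)
  let ?F = "insert \<psi> F" and ?r = "(\<eta> / 2)\<^sup>2"
  interpret functionals_seminorm ?F by unfold_locales (simp add: assms(1))
  have "0 < (\<psi> z)\<^sup>2" using \<open>\<psi> z \<noteq> 0\<close> by simp
  also have "\<dots> \<le> q z z" by (rule square_le_q) simp
  finally have "0 < q z z" .
  moreover have "0 < ?r" using assms(3) by simp
  ultimately obtain \<kappa> where \<kappa>: "\<kappa> \<in> convex hull small_slice_points ?r" "q (\<kappa> - \<mu>) (\<kappa> - \<mu>) < ?r"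
    using small_slice_points_nearly_fill_ball[OF _ assms(2)] by blast
  from \<kappa>(1) obtain n :: nat and c e where n: "\<forall>i\<in>{1..n}. 0 \<le> c i \<and> e i \<in> small_slice_points ?r"
    "sum c {1..n} = 1" "(\<Sum>i=1..n. c i *\<^sub>R e i) = \<kappa>"
    unfolding convex_hull_indexed by auto
  have "\<forall>i\<in>{1..n}. \<exists>S. is_slice S \<and> (\<forall>u\<in>S. q (u - e i) (u - e i) < ?r)"
    using n(1) by (simp add: small_slice_points_def)
  then obtain S where S: "\<And>i. i \<in> {1..n} \<Longrightarrow> is_slice (S i)"
    "\<And>i u. i \<in> {1..n} \<Longrightarrow> u \<in> S i \<Longrightarrow> q (u - e i) (u - e i) < ?r"
    by metis
  show ?thesis
  proof (intro exI[of _ n] exI[of _ c] exI[of _ S] conjI allI impI ballI)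
    show "1 \<le> n" using n(2) by (cases n) auto
    show "0 \<le> c i" if "i \<in> {1..n}" for i using n(1) that by blast
    show "is_slice (S i)" if "i \<in> {1..n}" for i using S(1) that by blast
    show "(\<Sum>i=1..n. c i) = 1" by (rule n(2))
    fix s \<phi>
    assume "\<forall>i\<in>{1..n}. s i \<in> S i" and "\<phi> \<in> F"
    then have s: "s i \<in> S i" if "i \<in> {1..n}" for i using that by blast
    have "\<phi> \<in> ?F" using \<open>\<phi> \<in> F\<close> by simp
    have near: "\<bar>\<phi> (s i) - \<phi> (e i)\<bar> < \<eta> / 2" if "i \<in> {1..n}" for i
      using abs_less_if_q_less[OF \<open>\<phi> \<in> ?F\<close> S(2)[OF that s[OF that]]] assms(3) by (simp add: blinfun.diff_right)
    have "\<bar>\<phi> (\<Sum>i=1..n. c i *\<^sub>R s i) - \<phi> \<kappa>\<bar> = \<bar>\<Sum>i=1..n. c i * (\<phi> (s i) - \<phi> (e i))\<bar>"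
      by (simp add: n(3)[symmetric] blinfun.sum_right blinfun.scaleR_right right_diff_distrib sum_subtractf)
    also have "\<dots> \<le> (\<Sum>i=1..n. c i * (\<eta> / 2))"
    proof (rule order_trans[OF sum_abs], rule sum_mono)
      fix i
      assume i: "i \<in> {1..n}"
      show "\<bar>c i * (\<phi> (s i) - \<phi> (e i))\<bar> \<le> c i * (\<eta> / 2)"
        using mult_left_mono[OF less_imp_le[OF near[OF i]], of "c i"] n(1) i by (simp add: abs_mult)
    qed
    also have "\<dots> = \<eta> / 2" unfolding sum_distrib_right[symmetric] n(2) by simp
    finally show "\<bar>\<phi> (\<Sum>i=1..n. c i *\<^sub>R s i) - \<phi> \<mu>\<bar> < \<eta>"
      using abs_less_if_q_less[OF \<open>\<phi> \<in> ?F\<close> \<kappa>(2)] assms(3) unfolding blinfun.diff_right by linarith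
  qed
qed

lemma weak_neighbourhood:
  fixes V :: "'b::banach set"
  assumes "openin weak_topology V" "u \<in> V"
  shows "\<exists>(F :: ('b \<Rightarrow>\<^sub>L real) set) \<eta>. finite F \<and> 0 < \<eta> \<and> (\<forall>v. (\<forall>\<phi>\<in>F. \<bar>blinfun_apply \<phi> v - blinfun_apply \<phi> u\<bar> < \<eta>) \<longrightarrow> v \<in> V)"
proof -
  have "generate_topology_on {blinfun_apply \<phi> -` U | (\<phi> :: 'b \<Rightarrow>\<^sub>L real) U. open U} V"
    using assms(1) unfolding weak_topology_def by (simp add: openin_topology_generated_by_iff)
  then show ?thesis
    using assms(2)
  proof (induction V arbitrary: u rule: generate_topology_on.induct)
    case Empty
    then show ?case by simp
  next
    case (Int A B)
    then have u: "u \<in> A" "u \<in> B" by auto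
    from Int.IH(1)[OF u(1)] obtain F :: "('b \<Rightarrow>\<^sub>L real) set" and \<eta> where F: "finite F" "0 < \<eta>"
      "\<forall>v. (\<forall>\<phi>\<in>F. \<bar>blinfun_apply \<phi> v - blinfun_apply \<phi> u\<bar> < \<eta>) \<longrightarrow> v \<in> A" by auto
    from Int.IH(2)[OF u(2)] obtain G :: "('b \<Rightarrow>\<^sub>L real) set" and \<theta> where G: "finite G" "0 < \<theta>"
      "\<forall>v. (\<forall>\<phi>\<in>G. \<bar>blinfun_apply \<phi> v - blinfun_apply \<phi> u\<bar> < \<theta>) \<longrightarrow> v \<in> B" by auto
    show ?case
    proof (intro exI[of _ "F \<union> G"] exI[of _ "min \<eta> \<theta>"] conjI allI impI IntI)
      fix v
      assume "\<forall>\<phi>\<in>F \<union> G. \<bar>blinfun_apply \<phi> v - blinfun_apply \<phi> u\<bar> < min \<eta> \<theta>"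
      then show "v \<in> A" "v \<in> B" by (auto intro!: F(3)[rule_format] G(3)[rule_format])
    qed (use F G in auto)
  next
    case (UN K)
    then obtain k where "k \<in> K" "u \<in> k" by blast
    with UN.IH obtain F :: "('b \<Rightarrow>\<^sub>L real) set" and \<eta> where "finite F" "0 < \<eta>"
      "\<forall>v. (\<forall>\<phi>\<in>F. \<bar>blinfun_apply \<phi> v - blinfun_apply \<phi> u\<bar> < \<eta>) \<longrightarrow> v \<in> k" by meson
    with \<open>k \<in> K\<close> show ?case by (intro exI[of _ F] exI[of _ \<eta>]) blast
  next
    case (Basis A)
    then obtain \<phi> :: "'b \<Rightarrow>\<^sub>L real" and U where A: "A = blinfun_apply \<phi> -` U" "open U" by blast
    with Basis obtain \<eta> where "0 < \<eta>" "ball (\<phi> u) \<eta> \<subseteq> U" using open_contains_ball by blast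
    with A show ?case
      by (intro exI[of _ "{\<phi>}"] exI[of _ \<eta>]) (auto simp: dist_real_def abs_minus_commute subset_iff)
  qed
qed

lemma diameter_2_if_strong_diameter_2:
  assumes "strong_diameter_2_property TYPE('b::banach)" "\<exists>\<psi> :: 'b \<Rightarrow>\<^sub>L real. \<psi> \<noteq> 0"
  shows "diameter_2_property TYPE('b)"
  unfolding diameter_2_property_def
proof (intro allI impI)
  fix W :: "'b set"
  assume W: "openin (subtopology weak_topology (cball 0 1)) W \<and> W \<noteq> {}"
  then obtain V where V: "openin weak_topology V" "W = V \<inter> cball 0 1" by (auto simp: openin_subtopology)
  from W obtain \<mu> where "\<mu> \<in> W" by blast
  with V have \<mu>: "\<mu> \<in> V" "norm \<mu> \<le> 1" by auto
  obtain F :: "('b \<Rightarrow>\<^sub>L real) set" and \<eta> where F: "finite F" "0 < \<eta>"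
    "\<forall>v. (\<forall>\<phi>\<in>F. \<bar>blinfun_apply \<phi> v - blinfun_apply \<phi> \<mu>\<bar> < \<eta>) \<longrightarrow> v \<in> V"
    using weak_neighbourhood[OF V(1) \<mu>(1)] by auto
  obtain n :: nat and c and S :: "nat \<Rightarrow> 'b set"
    where S: "1 \<le> n" "\<forall>i\<in>{1..n}. 0 \<le> c i \<and> is_slice (S i)" "(\<Sum>i=1..n. c i) = 1"
    "\<forall>s. (\<forall>i\<in>{1..n}. s i \<in> S i) \<longrightarrow>
      (\<forall>\<phi>\<in>F. \<bar>blinfun_apply \<phi> (\<Sum>i=1..n. c i *\<^sub>R s i) - \<phi> \<mu>\<bar> < \<eta>)"
    using convex_combination_of_slices_weakly_near[OF F(1) \<mu>(2) F(2) assms(2)] by blast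
  let ?T = "{\<Sum>i=1..n. c i *\<^sub>R s i | s. \<forall>i\<in>{1..n}. s i \<in> S i}"
  have "diameter ?T = 2"
    using assms(1) S(1-3) unfolding strong_diameter_2_property_def by blast
  have "?T \<subseteq> W"
  proof
    fix v
    assume "v \<in> ?T"
    then obtain s where s: "v = (\<Sum>i=1..n. c i *\<^sub>R s i)" "\<forall>i\<in>{1..n}. s i \<in> S i" by blast
    have "v \<in> V" unfolding s(1) using F(3) S(4) s(2) by blast
    moreover have "norm (s i) \<le> 1" if "i \<in> {1..n}" for i
    proof -
      have "is_slice (S i)" "s i \<in> S i" using S(2) s(2) that by blast+
      then show ?thesis by (auto simp: is_slice_def)
    qed
    then have "norm v \<le> (\<Sum>i=1..n. c i)"
      unfolding s(1) using S(2) by (intro norm_convex_combination_le) auto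
    ultimately show "v \<in> W" using V(2) S(3) by simp
  qed
  have sub: "W \<subseteq> cball 0 1" using V(2) by blast
  then have "bounded W" using bounded_cball bounded_subset by blast
  then have "2 \<le> diameter W"
    using diameter_subset[OF \<open>?T \<subseteq> W\<close>] \<open>diameter ?T = 2\<close> by simp
  moreover have "diameter W \<le> 2" by (rule diameter_le_2[OF sub])
  ultimately show "diameter W = 2" by simp
qed

lemma slice_diameter_2_if_strong_diameter_2:
  assumes "strong_diameter_2_property TYPE('b::banach)"
  shows "slice_diameter_2_property TYPE('b)"
  unfolding slice_diameter_2_property_def
proof (intro allI impI)
  fix S :: "'b set"
  assume "is_slice S"
  then have "diameter {\<Sum>i=1..1::nat. 1 *\<^sub>R s i | s. \<forall>i\<in>{1..1}. s i \<in> S} = 2"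
    using assms[unfolded strong_diameter_2_property_def, rule_format, of 1 "\<lambda>_. 1" "\<lambda>_. S"] by simp
  also have "{\<Sum>i=1..1::nat. 1 *\<^sub>R s i | s. \<forall>i\<in>{1..1}. s i \<in> S} = S"
    by auto
  finally show "diameter S = 2" .
qed

lemma not_strongly_exposed_if_slice_diameter_2:
  fixes x :: "'b::banach"
  assumes "slice_diameter_2_property TYPE('b)"
  shows "\<not> strongly_exposed_point x"
proof
  assume "strongly_exposed_point x"
  then obtain \<phi> :: "'b \<Rightarrow>\<^sub>L real" where \<phi>: "\<phi> \<noteq> 0" "\<phi> x = norm \<phi>"
    and exposed: "\<And>u :: nat \<Rightarrow> 'b. (\<And>n. u n \<in> cball 0 1) \<Longrightarrow> (\<lambda>n. \<phi> (u n)) \<longlonglongrightarrow> \<phi> x \<Longrightarrow> (\<lambda>n. norm (u n - x)) \<longlonglongrightarrow> 0"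
    unfolding strongly_exposed_point_def SUP_unit_ball_blinfun by blast
  have "\<exists>u. norm u \<le> 1 \<and> norm \<phi> - 1 / (real n + 1) < \<phi> u \<and> 1 / 2 < norm (u - x)" for n :: nat
  proof (rule ccontr)
    let ?S = "{u \<in> cball 0 1. norm \<phi> - 1 / (real n + 1) < \<phi> u}"
    assume "\<not> ?thesis"
    then have near: "norm (u - x) \<le> 1 / 2" if "u \<in> ?S" for u using that by (auto simp: not_less)
    have "(0::real) < 1 / (real n + 1)" by simp
    with \<phi>(1) have "is_slice ?S" unfolding is_slice_iff by blast
    then have "diameter ?S = 2" using assms unfolding slice_diameter_2_property_def by blast
    moreover have "diameter ?S \<le> 1"
    proof (rule diameter_le)
      fix u v
      assume "u \<in> ?S" "v \<in> ?S"
      then show "norm (u - v) \<le> 1"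
        using near[of u] near[of v] norm_triangle_ineq4[of "u - x" "v - x"] by simp
    qed simp
    ultimately show False by simp
  qed
  then obtain u where u: "\<And>n. norm (u n) \<le> 1" "\<And>n. norm \<phi> - 1 / (real n + 1) < \<phi> (u n)"
    "\<And>n. 1 / 2 < norm (u n - x)" by metis
  have "(\<lambda>n. norm \<phi> - 1 / (real n + 1)) \<longlonglongrightarrow> norm \<phi> - 0"
    by (intro tendsto_intros LIMSEQ_inverse_real_of_nat[unfolded inverse_eq_divide of_nat_Suc add.commute[of 1]])
  then have lower: "(\<lambda>n. norm \<phi> - 1 / (real n + 1)) \<longlonglongrightarrow> norm \<phi>" by simp
  have "\<phi> (u n) \<le> norm \<phi>" for n
    using abs_blinfun_le[OF u(1), of \<phi> n] by simp
  then have "(\<lambda>n. \<phi> (u n)) \<longlonglongrightarrow> norm \<phi>"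
    using less_imp_le[OF u(2)]
    by (intro tendsto_sandwich[OF always_eventually always_eventually lower tendsto_const]) auto
  then have "(\<lambda>n. norm (u n - x)) \<longlonglongrightarrow> 0" using exposed[of u] u(1) by (simp add: \<phi>(2))
  then have "1 / 2 \<le> (0::real)"
    by (rule tendsto_lowerbound) (use less_imp_le[OF u(3)] in auto)
  then show False by simp
qed

section \<open>Preserved extreme points\<close>

text \<open>The points \<open>v\<close> of the hypothesis accumulate weak\<open>*\<close> at a point \<open>V\<close> of the bidual ball with \<open>V(\<psi>) = 0\<close>, and
  \<open>\<mu> - \<kappa> V\<close> has norm at most \<open>1 - \<kappa>\<close>. So \<open>\<mu>\<close> is a proper convex combination of \<open>V\<close> and another point of the
  ball.\<close>

lemma not_preserved_extreme_if_weakly_split: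
  fixes \<mu> :: "'b::banach" and \<psi> :: "'b \<Rightarrow>\<^sub>L real"
  assumes "0 < \<kappa>" "\<kappa> < 1" "\<psi> \<mu> \<noteq> 0"
    and split: "\<And>G \<eta>. finite G \<Longrightarrow> 0 < \<eta> \<Longrightarrow> \<exists>v. norm v \<le> 1 \<and> \<psi> v = 0 \<and>
      (\<forall>\<phi>\<in>G. \<bar>blinfun_apply \<phi> \<mu> - \<kappa> * blinfun_apply \<phi> v\<bar> \<le> (1 - \<kappa>) * norm \<phi> + \<eta>)"
  shows "\<not> preserved_extreme_point \<mu>"
proof -
  define K where "K = (PiE UNIV (\<lambda>\<phi> :: 'b \<Rightarrow>\<^sub>L real. {- norm \<phi>..norm \<phi>}))"
  have "compactin (product_topology (\<lambda>_. euclidean) UNIV) K"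
    unfolding K_def by (subst compactin_PiE) (auto simp: compactin_euclidean_iff)
  then have "compact K" by (simp add: euclidean_product_topology compactin_euclidean_iff)
  define L where "L = {V :: ('b \<Rightarrow>\<^sub>L real) \<Rightarrow> real. V \<psi> = 0} \<inter>
    ((\<Inter>\<phi>. \<Inter>\<theta>. {V. V (\<phi> + \<theta>) = V \<phi> + V \<theta>}) \<inter> (\<Inter>c. \<Inter>\<phi>. {V. V (c *\<^sub>R \<phi>) = c * V \<phi>}))"
  have "closed L"
    unfolding L_def
    by (intro closed_Int closed_INT ballI closed_Collect_eq continuous_intros continuous_on_product_coordinates)
  define Q where "Q = (\<lambda>(\<phi>, \<eta>). {V :: ('b \<Rightarrow>\<^sub>L real) \<Rightarrow> real. \<bar>blinfun_apply \<phi> \<mu> - \<kappa> * V \<phi>\<bar> \<le> (1 - \<kappa>) * norm \<phi> + \<eta>})"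
  have "(K \<inter> L) \<inter> (\<Inter>p\<in>UNIV \<times> {0<..}. Q p) \<noteq> {}"
  proof (rule compact_imp_fip_image)
    show "compact (K \<inter> L)" using \<open>compact K\<close> \<open>closed L\<close> by (rule compact_Int_closed)
    show "closed (Q p)" for p
      unfolding Q_def case_prod_beta
      by (intro closed_Collect_le continuous_intros continuous_on_product_coordinates)
    fix I :: "(('b \<Rightarrow>\<^sub>L real) \<times> real) set"
    assume I: "finite I" "I \<subseteq> UNIV \<times> {0::real<..}"
    define \<eta> where "\<eta> = Min (insert 1 (snd ` I))"
    have "0 < \<eta>" using I by (auto simp: \<eta>_def)
    moreover have "finite (fst ` I)" using I(1) by simp
    ultimately obtain v where v: "norm v \<le> 1" "\<psi> v = 0"
      "\<And>\<phi>. \<phi> \<in> fst ` I \<Longrightarrow> \<bar>blinfun_apply \<phi> \<mu> - \<kappa> * \<phi> v\<bar> \<le> (1 - \<kappa>) * norm \<phi> + \<eta>"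
      using split[of "fst ` I" \<eta>] by blast
    have "\<bar>\<phi> v\<bar> \<le> norm \<phi>" for \<phi> :: "'b \<Rightarrow>\<^sub>L real"
      by (rule abs_blinfun_le[OF v(1)])
    then have "(\<lambda>\<phi>. blinfun_apply \<phi> v) \<in> K" by (auto simp: K_def abs_le_iff minus_le_iff)
    moreover have "(\<lambda>\<phi>. blinfun_apply \<phi> v) \<in> L"
      by (simp add: L_def v(2) blinfun.add_left blinfun.scaleR_left)
    moreover have "(\<lambda>\<phi>. blinfun_apply \<phi> v) \<in> Q p" if "p \<in> I" for p
    proof -
      have "\<eta> \<le> snd p" unfolding \<eta>_def using I(1) that by (intro Min_le) auto
      moreover have "fst p \<in> fst ` I" using that by simp
      ultimately show ?thesis using v(3)[of "fst p"] by (simp add: Q_def case_prod_beta)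
    qed
    ultimately show "K \<inter> L \<inter> (\<Inter>p\<in>I. Q p) \<noteq> {}" by blast
  qed
  then obtain V where V: "V \<in> K" "V \<in> L" "\<And>p. p \<in> UNIV \<times> {0<..} \<Longrightarrow> V \<in> Q p" by blast
  have V_bound: "\<bar>V \<phi>\<bar> \<le> norm \<phi>" for \<phi> using V(1) by (auto simp: K_def PiE_iff abs_le_iff minus_le_iff)
  have V_split: "\<bar>\<phi> \<mu> - \<kappa> * V \<phi>\<bar> \<le> (1 - \<kappa>) * norm \<phi>" for \<phi> :: "'b \<Rightarrow>\<^sub>L real"
  proof (rule field_le_epsilon)
    fix \<eta> :: real
    assume "0 < \<eta>"
    then show "\<bar>\<phi> \<mu> - \<kappa> * V \<phi>\<bar> \<le> (1 - \<kappa>) * norm \<phi> + \<eta>" using V(3)[of "(\<phi>, \<eta>)"] by (simp add: Q_def)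
  qed
  have "bounded_linear V"
    using V(2) V_bound by (intro bounded_linear_intro[where K = 1]) (auto simp: L_def)
  define V' where "V' = Blinfun V"
  have V': "blinfun_apply V' = V" unfolding V'_def using \<open>bounded_linear V\<close> by (rule bounded_linear_Blinfun_apply)
  define J where "J = bidual_embedding \<mu>"
  have J: "J \<phi> = \<phi> \<mu>" for \<phi> by (simp add: J_def bidual_embedding.rep_eq)
  define W where "W = (1 / (1 - \<kappa>)) *\<^sub>R (J - \<kappa> *\<^sub>R V')"
  have "norm V' \<le> 1" using V_bound by (intro norm_blinfun_bound) (auto simp: V')
  moreover have "norm W \<le> 1"
  proof -
    have "norm (J - \<kappa> *\<^sub>R V') \<le> 1 - \<kappa>"
      using V_split assms(2) by (intro norm_blinfun_bound) (auto simp: blinfun.diff_left blinfun.scaleR_left J V')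
    then show ?thesis using assms(2) by (simp add: W_def divide_le_eq)
  qed
  moreover have J_eq: "J = (1 - \<kappa>) *\<^sub>R W + \<kappa> *\<^sub>R V'" using assms(2) by (simp add: W_def)
  moreover have "W \<noteq> V'"
  proof
    assume "W = V'"
    with J_eq have "J = V'" by (simp add: algebra_simps)
    then have "\<psi> \<mu> = V \<psi>" using J[of \<psi>] V' by simp
    with V(2) assms(3) show False by (simp add: L_def)
  qed
  ultimately have "J \<in> open_segment W V'" "W \<in> cball 0 1" "V' \<in> cball 0 1"
    using assms(1,2) unfolding in_segment by auto
  then show ?thesis unfolding preserved_extreme_point_def extreme_point_of_def J_def by blast
qed

text \<open>Truncating \<open>g\<close> at level \<open>s\<close> keeps what happens below \<open>s\<close> and forgets what happens above.\<close>

lemma truncation_exists: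
  fixes g :: "'a::{metric_space, zero} lip0"
  assumes "norm g \<le> 1"
  shows "\<exists>T. (\<forall>s x. lip0_apply (T s) x = min (lip0_apply g x) s - min 0 s) \<and> (\<forall>s. norm (T s) \<le> 1)"
proof -
  have "\<exists>t. lip0_apply t = (\<lambda>x. min (lip0_apply g x) s - min 0 s) \<and> norm t \<le> 1" for s
  proof -
    let ?k = "\<lambda>x. min (lip0_apply g x) s - min 0 s"
    have "\<bar>?k x - ?k y\<bar> \<le> 1 * dist x y" for x y
      using lip0_norm_bound[of g x y] mult_right_mono[OF assms, of "dist x y"] by (auto simp: min_def)
    then show ?thesis by (rule lip0_of_function) auto
  qed
  then show ?thesis by metis
qed

text \<open>As a function of the level, the pairing with the truncations is continuous and runs from values near 0 to
  values near the pairing with \<open>g\<close>. So some level cuts \<open>\<mu>\<close> into two substantial parts.\<close>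

lemma truncation_levels:
  fixes \<mu> :: "'a::{metric_space, zero} lip_free"
  assumes T: "\<And>s x. lip0_apply (T s) x = min (lip0_apply g x) s - min 0 s" "\<And>s. norm (T s) \<le> 1"
    and "norm g \<le> 1" "0 < pairing \<mu> g"
  obtains s1 s2 where "s1 < s2" "0 < pairing \<mu> (T s1)" "pairing \<mu> (T s2) = pairing \<mu> g / 2"
proof -
  define \<gamma> where "\<gamma> = pairing \<mu> g"
  have "0 < \<gamma>" using assms(4) by (simp add: \<gamma>_def)
  let ?P = "\<lambda>s. pairing \<mu> (T s)"
  have cont: "continuous_on UNIV ?P"
    unfolding continuous_on_iff
  proof (intro ballI allI impI)
    fix s e :: real
    assume "0 < e"
    then have "0 < e / 4" by simp
    then obtain N c where N: "finite N"
      "\<And>f. \<bar>pairing \<mu> f - (\<Sum>z\<in>N. c z * lip0_apply f z)\<bar> \<le> e / 4 * norm f"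
      using pairing_finite_approximation[of "e / 4" \<mu>] by blast
    define B where "B = (\<Sum>z\<in>N. \<bar>c z\<bar>)"
    have "0 \<le> B" by (simp add: B_def sum_nonneg)
    have "dist (?P s') (?P s) < e" if "\<bar>s' - s\<bar> < e / (4 * (B + 1))" for s'
    proof -
      have approx: "\<bar>?P r - (\<Sum>z\<in>N. c z * lip0_apply (T r) z)\<bar> \<le> e / 4" for r
      proof -
        have "e / 4 * norm (T r) \<le> e / 4 * 1" using T(2) \<open>0 < e\<close> by (intro mult_left_mono) auto
        with N(2)[of "T r"] show ?thesis by linarith
      qed
      have "\<bar>(\<Sum>z\<in>N. c z * lip0_apply (T s') z) - (\<Sum>z\<in>N. c z * lip0_apply (T s) z)\<bar>
          = \<bar>\<Sum>z\<in>N. c z * (lip0_apply (T s') z - lip0_apply (T s) z)\<bar>"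
        by (simp add: right_diff_distrib sum_subtractf)
      also have "\<dots> \<le> (\<Sum>z\<in>N. \<bar>c z\<bar> * (2 * \<bar>s' - s\<bar>))"
      proof (rule order_trans[OF sum_abs], rule sum_mono)
        fix z
        have "\<bar>lip0_apply (T s') z - lip0_apply (T s) z\<bar> \<le> 2 * \<bar>s' - s\<bar>"
          unfolding T(1) by (auto simp: min_def abs_if)
        then show "\<bar>c z * (lip0_apply (T s') z - lip0_apply (T s) z)\<bar> \<le> \<bar>c z\<bar> * (2 * \<bar>s' - s\<bar>)"
          unfolding abs_mult by (rule mult_left_mono) simp
      qed
      also have "\<dots> = B * (2 * \<bar>s' - s\<bar>)" by (simp add: B_def sum_distrib_right)
      also have "\<dots> \<le> (B + 1) * (2 * \<bar>s' - s\<bar>)" by (intro mult_right_mono) auto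
      also have "\<dots> < e / 2"
      proof -
        have "\<bar>s' - s\<bar> * (4 * (B + 1)) < e" using that \<open>0 \<le> B\<close> by (simp add: less_divide_eq)
        then show ?thesis by (simp add: algebra_simps)
      qed
      finally show ?thesis using approx[of s] approx[of s'] unfolding dist_real_def by linarith
    qed
    moreover have "0 < e / (4 * (B + 1))" using \<open>0 < e\<close> \<open>0 \<le> B\<close> by simp
    ultimately show "\<exists>d>0. \<forall>s'\<in>UNIV. dist s' s < d \<longrightarrow> dist (?P s') (?P s) < e"
      by (auto simp: dist_real_def)
  qed
  have "0 < \<gamma> / 8" using \<open>0 < \<gamma>\<close> by simp
  then obtain N c where N: "finite N"
    "\<And>f. \<bar>pairing \<mu> f - (\<Sum>z\<in>N. c z * lip0_apply f z)\<bar> \<le> \<gamma> / 8 * norm f"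
    using pairing_finite_approximation[of "\<gamma> / 8" \<mu>] by blast
  have approx: "\<bar>pairing \<mu> f - (\<Sum>z\<in>N. c z * lip0_apply f z)\<bar> \<le> \<gamma> / 8" if "norm f \<le> 1" for f
  proof -
    have "\<gamma> / 8 * norm f \<le> \<gamma> / 8 * 1" using that \<open>0 < \<gamma>\<close> by (intro mult_left_mono) auto
    with N(2)[of f] show ?thesis by linarith
  qed
  define B where "B = (\<Sum>z\<in>N. \<bar>lip0_apply g z\<bar>)"
  have "0 \<le> B" by (simp add: B_def sum_nonneg)
  have B: "\<bar>lip0_apply g z\<bar> \<le> B" if "z \<in> N" for z
    unfolding B_def using that N(1) by (intro member_le_sum) auto
  have "lip0_apply (T (- B)) z = 0" if "z \<in> N" for z
    using B[OF that] \<open>0 \<le> B\<close> by (auto simp: T(1) min_def)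
  then have "(\<Sum>z\<in>N. c z * lip0_apply (T (- B)) z) = 0" by (intro sum.neutral) auto
  with approx[OF T(2), of "- B"] have low: "?P (- B) \<le> \<gamma> / 2" using \<open>0 < \<gamma>\<close> by linarith
  have "lip0_apply (T B) z = lip0_apply g z" if "z \<in> N" for z
    using B[OF that] \<open>0 \<le> B\<close> by (auto simp: T(1) min_def)
  then have "(\<Sum>z\<in>N. c z * lip0_apply (T B) z) = (\<Sum>z\<in>N. c z * lip0_apply g z)" by (intro sum.cong) auto
  with approx[OF T(2), of B] approx[OF assms(3)] have high: "\<gamma> / 2 \<le> ?P B"
    using \<open>0 < \<gamma>\<close> unfolding \<gamma>_def by linarith
  obtain s2 where s2: "?P s2 = \<gamma> / 2"
    using IVT'[of ?P "- B" "\<gamma> / 2" B] low high \<open>0 \<le> B\<close> continuous_on_subset[OF cont] by auto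
  obtain d where d: "0 < d" "\<And>s. \<bar>s - s2\<bar> < d \<Longrightarrow> \<bar>?P s - ?P s2\<bar> < \<gamma> / 4"
    using cont \<open>0 < \<gamma>\<close> unfolding continuous_on_iff dist_real_def
    by (metis UNIV_I zero_less_divide_iff zero_less_numeral)
  have "\<bar>?P (s2 - d / 2) - ?P s2\<bar> < \<gamma> / 4" using d(1) by (intro d(2)) simp
  then have "0 < ?P (s2 - d / 2)" using s2 \<open>0 < \<gamma>\<close> by linarith
  with s2 d(1) show thesis unfolding \<gamma>_def by (intro that[of "s2 - d / 2" s2]) auto
qed

lemma slice_contains_short_molecule:
  assumes "length_space TYPE('a::{complete_space, zero})" "is_slice S" "0 < d"
  shows "\<exists>x y :: 'a. dist x y < d \<and> molecule x y \<in> S"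
proof -
  obtain \<phi> \<alpha> where \<phi>: "\<phi> \<noteq> 0" "0 < \<alpha>" "S = {u \<in> cball 0 1. norm \<phi> - \<alpha> < blinfun_apply \<phi> u}"
    using assms(2) unfolding is_slice_iff by blast
  obtain f :: "'a lip0" where f: "\<phi> = lip0_functional f" using lip0_functional_surj .
  have "f \<noteq> 0" "0 < min \<alpha> d" using \<phi> assms(3) by (auto simp: f)
  moreover have "norm (0 :: 'a lip0) \<le> 1" "\<bar>0 :: real\<bar> \<le> 1" by auto
  ultimately have "\<exists>x y h. norm f - min \<alpha> d < slope f x y \<and> dist x y < min \<alpha> d \<and>
      norm h \<le> 1 + min \<alpha> d \<and> slope h x y = 0 \<and> (\<forall>z\<in>{}. lip0_apply h z = lip0_apply 0 z)"
    by (intro prescribe_slope_at_steep_pair[OF assms(1) _ finite.emptyI] order_refl)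
  then obtain x y where "norm f - min \<alpha> d < slope f x y" "dist x y < min \<alpha> d" by blast
  then show ?thesis
    by (intro exI[of _ x] exI[of _ y]) (auto simp: \<phi>(3) f lip0_functional.rep_eq norm_molecule_le)
qed

text \<open>Approximate \<open>\<mu>\<close> by convex combinations of molecules shorter than the gap between two levels \<open>s1 < s2\<close> of \<open>g\<close>.
  A molecule that is not contained in \<open>{g \<ge> s1}\<close> does not reach the level \<open>s2\<close>, so the molecules contained in
  \<open>{g \<ge> s1}\<close> carry a substantial part of \<open>\<mu>\<close>; and they are annihilated by the truncation of \<open>g\<close> at \<open>s1\<close>, unlike \<open>\<mu>\<close>.\<close>

lemma not_preserved_extreme_if_length_space:
  fixes \<mu> :: "'a::{complete_space, zero} lip_free"
  assumes length: "length_space TYPE('a)" and nontrivial: "\<exists>x :: 'a. x \<noteq> 0"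
  shows "\<not> preserved_extreme_point \<mu>"
proof
  assume extreme: "preserved_extreme_point \<mu>"
  then have "norm \<mu> \<le> 1" by (simp add: preserved_extreme_point_def)
  obtain x0 :: 'a where "x0 \<noteq> 0" using nontrivial by blast
  obtain f0 where slope_f0: "slope f0 x0 0 = 1" using slope_eq_1_exists[OF \<open>x0 \<noteq> 0\<close>] .
  then have "f0 \<noteq> 0" by (auto simp: slope_def zero_lip0.rep_eq)
  then have functional_ne: "\<exists>\<psi> :: 'a lip_free \<Rightarrow>\<^sub>L real. \<psi> \<noteq> 0"
    by (intro exI[of _ "lip0_functional f0"]) simp
  have "\<mu> \<noteq> 0"
  proof
    assume "\<mu> = 0"
    let ?U = "bidual_embedding (molecule x0 0)"
    have "norm ?U \<le> 1"
    proof (rule norm_blinfun_bound)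
      fix \<phi> :: "'a lip_free \<Rightarrow>\<^sub>L real"
      show "norm (?U \<phi>) \<le> 1 * norm \<phi>"
        using abs_blinfun_le[OF norm_molecule_le] by (simp add: bidual_embedding.rep_eq)
    qed simp
    have U1: "?U (lip0_functional f0) = 1" using slope_f0 by (simp add: bidual_embedding.rep_eq lip0_functional.rep_eq)
    have "?U \<noteq> - ?U"
    proof
      assume "?U = - ?U"
      then have "?U (lip0_functional f0) = (- ?U) (lip0_functional f0)"
        by (rule arg_cong[where f = "\<lambda>V. blinfun_apply V (lip0_functional f0)"])
      then have "1 = - (1 :: real)" unfolding blinfun.minus_left U1 .
      then show False by simp
    qed
    moreover have "bidual_embedding \<mu> = 0"
      by (rule blinfun_eqI) (simp add: bidual_embedding.rep_eq \<open>\<mu> = 0\<close>)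
    ultimately have "bidual_embedding \<mu> \<in> open_segment ?U (- ?U)"
      by (auto simp: in_segment intro!: exI[of _ "1/2"])
    with extreme \<open>norm ?U \<le> 1\<close> show False
      unfolding preserved_extreme_point_def extreme_point_of_def by auto
  qed
  then have "0 < norm \<mu>" by simp
  then obtain g where g: "norm g \<le> 1" "0 < pairing \<mu> g" by (rule norm_lip_free_less_witness)
  define \<gamma> where "\<gamma> = pairing \<mu> g"
  have \<gamma>: "0 < \<gamma>" "\<gamma> \<le> 1"
    using g pairing_le[OF \<open>norm \<mu> \<le> 1\<close>, of g] by (auto simp: \<gamma>_def)
  obtain T where T: "\<And>s x. lip0_apply (T s) x = min (lip0_apply g x) s - min 0 s" "\<And>s. norm (T s) \<le> 1"
    using truncation_exists[OF g(1)] by blast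
  obtain s1 s2 where s: "s1 < s2" "0 < pairing \<mu> (T s1)" "pairing \<mu> (T s2) = \<gamma> / 2"
    unfolding \<gamma>_def by (rule truncation_levels[OF T g])
  define \<kappa> where "\<kappa> = \<gamma> / 8"
  have \<kappa>: "0 < \<kappa>" "\<kappa> < 1" using \<gamma> by (auto simp: \<kappa>_def)
  let ?\<psi> = "lip0_functional (T s1)"
  have "\<not> preserved_extreme_point \<mu>"
  proof (rule not_preserved_extreme_if_weakly_split[OF \<kappa>])
    show "?\<psi> \<mu> \<noteq> 0" using s(2) by (simp add: lip0_functional.rep_eq)
    fix G :: "('a lip_free \<Rightarrow>\<^sub>L real) set" and \<eta> :: real
    assume G: "finite G" "0 < \<eta>"
    let ?above = "g - T s2"
    have "finite (insert (lip0_functional ?above) G)" "0 < min \<eta> (\<gamma> / 4)" using G \<gamma> by auto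
    note near = convex_combination_of_slices_weakly_near[OF this(1) \<open>norm \<mu> \<le> 1\<close> this(2) functional_ne]
    obtain n :: nat and c and S :: "nat \<Rightarrow> 'a lip_free set"
      where slices: "\<forall>i\<in>{1..n}. 0 \<le> c i \<and> is_slice (S i)" "(\<Sum>i=1..n. c i) = 1"
      and near: "\<forall>s. (\<forall>i\<in>{1..n}. s i \<in> S i) \<longrightarrow> (\<forall>\<phi>\<in>insert (lip0_functional ?above) G.
        \<bar>blinfun_apply \<phi> (\<Sum>i=1..n. c i *\<^sub>R s i) - \<phi> \<mu>\<bar> < min \<eta> (\<gamma> / 4))"
      using near by blast
    have "\<forall>i\<in>{1..n}. \<exists>x y :: 'a. dist x y < s2 - s1 \<and> molecule x y \<in> S i"
      using slice_contains_short_molecule[OF length] slices(1) s(1) by simp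
    then obtain x y where xy: "\<And>i. i \<in> {1..n} \<Longrightarrow> dist (x i) (y i) < s2 - s1"
      "\<And>i. i \<in> {1..n} \<Longrightarrow> molecule (x i) (y i) \<in> S i" by metis
    let ?m = "\<lambda>i. molecule (x i) (y i)"
    have near_m: "\<bar>\<phi> (\<Sum>i=1..n. c i *\<^sub>R ?m i) - \<phi> \<mu>\<bar> < min \<eta> (\<gamma> / 4)"
      if "\<phi> \<in> insert (lip0_functional ?above) G" for \<phi>
      using near[rule_format, of ?m \<phi>] xy(2) that by blast
    define I where "I = {i\<in>{1..n}. s1 \<le> lip0_apply g (x i) \<and> s1 \<le> lip0_apply g (y i)}"
    have I: "I \<subseteq> {1..n}" "finite I" by (auto simp: I_def)
    have split: "(\<Sum>i=1..n. h i) = (\<Sum>i\<in>I. h i) + (\<Sum>i\<in>{1..n} - I. h i)" for h :: "nat \<Rightarrow> real"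
      using sum.subset_diff[OF I(1), of h] by simp
    define t where "t = (\<Sum>i\<in>I. c i)"
    have rest: "(\<Sum>i\<in>{1..n} - I. c i) = 1 - t" using split[of c] slices(2) by (simp add: t_def)
    have above: "slope ?above (x i) (y i) = 0" if "i \<in> {1..n} - I" for i
    proof -
      have "\<bar>lip0_apply g (x i) - lip0_apply g (y i)\<bar> \<le> dist (x i) (y i)"
        using lip0_norm_bound[of g "x i" "y i"] mult_right_mono[OF g(1), of "dist (x i) (y i)"] by simp
      moreover have "lip0_apply g (x i) < s1 \<or> lip0_apply g (y i) < s1" using that by (auto simp: I_def)
      ultimately have "lip0_apply g (x i) \<le> s2" "lip0_apply g (y i) \<le> s2" using xy(1)[of i] that s(1) by auto
      then show ?thesis by (simp add: slope_def minus_lip0.rep_eq T(1))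
    qed
    have below: "slope (T s1) (x i) (y i) = 0" if "i \<in> I" for i
      using that by (auto simp: I_def slope_def T(1))
    \<comment> \<open>Half of \<open>\<gamma>\<close> comes from above the level \<open>s2\<close>, at least a quarter of \<open>\<gamma>\<close> if the approximation error is taken
      into account, and the slopes there are at most 2.\<close>
    have "\<kappa> \<le> t"
    proof -
      have "\<bar>(\<Sum>i=1..n. c i * slope ?above (x i) (y i)) - pairing \<mu> ?above\<bar> < \<gamma> / 4"
        using near_m[of "lip0_functional ?above"]
        by (simp add: lip0_functional.rep_eq pairing_sum_left pairing_scaleR_left)
      moreover have "pairing \<mu> ?above = \<gamma> / 2" using s(3) by (simp add: pairing_simps \<gamma>_def)
      moreover have "(\<Sum>i=1..n. c i * slope ?above (x i) (y i)) = (\<Sum>i\<in>I. c i * slope ?above (x i) (y i))"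
        unfolding split using above by (simp add: sum.neutral)
      moreover have "(\<Sum>i\<in>I. c i * slope ?above (x i) (y i)) \<le> (\<Sum>i\<in>I. c i * 2)"
      proof (intro sum_mono mult_left_mono)
        fix i
        assume "i \<in> I"
        then show "0 \<le> c i" using slices(1) I(1) by blast
        show "slope ?above (x i) (y i) \<le> 2"
          using slope_le_norm[of ?above "x i" "y i"] norm_triangle_ineq4[of g "T s2"] g(1) T(2)[of s2] by linarith
      qed
      ultimately have "\<gamma> / 4 \<le> (\<Sum>i\<in>I. c i * 2)" by linarith
      then show ?thesis by (simp add: t_def \<kappa>_def sum_distrib_right[symmetric])
    qed
    then have "0 < t" using \<kappa> by linarith
    define v where "v = (1 / t) *\<^sub>R (\<Sum>i\<in>I. c i *\<^sub>R ?m i)"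
    have "norm v \<le> 1"
    proof -
      have "norm (\<Sum>i\<in>I. c i *\<^sub>R ?m i) \<le> t"
        unfolding t_def using slices(1) I(1) by (intro norm_convex_combination_le norm_molecule_le) auto
      then show ?thesis using \<open>0 < t\<close> by (simp add: v_def divide_le_eq)
    qed
    moreover have "?\<psi> v = 0"
      using below by (simp add: v_def lip0_functional.rep_eq pairing_scaleR_left pairing_sum_left)
    moreover have "\<bar>\<phi> \<mu> - \<kappa> * \<phi> v\<bar> \<le> (1 - \<kappa>) * norm \<phi> + \<eta>" if "\<phi> \<in> G" for \<phi>
    proof -
      have "\<phi> (\<Sum>i=1..n. c i *\<^sub>R ?m i) = (\<Sum>i=1..n. c i * \<phi> (?m i))"
        by (simp add: blinfun.sum_right blinfun.scaleR_right)
      also have "\<dots> = t * \<phi> v + (\<Sum>i\<in>{1..n} - I. c i * \<phi> (?m i))"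
        unfolding split using \<open>0 < t\<close> by (simp add: v_def blinfun.sum_right blinfun.scaleR_right)
      finally have eq: "\<phi> (\<Sum>i=1..n. c i *\<^sub>R ?m i) = t * \<phi> v + (\<Sum>i\<in>{1..n} - I. c i * \<phi> (?m i))" .
      have "\<bar>\<Sum>i\<in>{1..n} - I. c i * \<phi> (?m i)\<bar> \<le> (\<Sum>i\<in>{1..n} - I. c i * norm \<phi>)"
      proof (rule order_trans[OF sum_abs], rule sum_mono)
        fix i
        assume "i \<in> {1..n} - I"
        then show "\<bar>c i * \<phi> (?m i)\<bar> \<le> c i * norm \<phi>"
          using slices(1) mult_left_mono[OF abs_blinfun_le[OF norm_molecule_le, of \<phi> "x i" "y i"], of "c i"]
          by (simp add: abs_mult)
      qed
      also have "\<dots> = (1 - t) * norm \<phi>" by (simp only: sum_distrib_right[symmetric] rest)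
      finally have 1: "\<bar>\<Sum>i\<in>{1..n} - I. c i * \<phi> (?m i)\<bar> \<le> (1 - t) * norm \<phi>" .
      have 2: "\<bar>(t - \<kappa>) * \<phi> v\<bar> \<le> (t - \<kappa>) * norm \<phi>"
        using \<open>\<kappa> \<le> t\<close> abs_blinfun_le[OF \<open>norm v \<le> 1\<close>] by (simp add: abs_mult mult_left_mono)
      have 3: "\<bar>\<phi> (\<Sum>i=1..n. c i *\<^sub>R ?m i) - \<phi> \<mu>\<bar> < \<eta>"
        using near_m[of \<phi>] that by simp
      have "t * \<phi> v = (t - \<kappa>) * \<phi> v + \<kappa> * \<phi> v" "(1 - t) * norm \<phi> + (t - \<kappa>) * norm \<phi> = (1 - \<kappa>) * norm \<phi>"
        by (simp_all add: algebra_simps)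
      with eq 1 2 3 show ?thesis by linarith
    qed
    ultimately show "\<exists>v. norm v \<le> 1 \<and> ?\<psi> v = 0 \<and>
        (\<forall>\<phi>\<in>G. \<bar>blinfun_apply \<phi> \<mu> - \<kappa> * blinfun_apply \<phi> v\<bar> \<le> (1 - \<kappa>) * norm \<phi> + \<eta>)" by blast
  qed
  with extreme show False by blast
qed

section \<open>The equivalences\<close>

theorem theorem1p5:
  assumes "\<exists>x :: 'a::{complete_space, zero}. x \<noteq> 0"
  shows "(property_Z TYPE('a) \<longleftrightarrow> length_space TYPE('a))
    \<and> (property_Z TYPE('a) \<longleftrightarrow> \<not> (\<exists>\<mu> :: 'a lip_free. strongly_exposed_point \<mu>))
    \<and> (property_Z TYPE('a) \<longleftrightarrow> \<not> (\<exists>\<mu> :: 'a lip_free. preserved_extreme_point \<mu>))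
    \<and> (property_Z TYPE('a) \<longleftrightarrow> daugavet_property TYPE('a lip_free))
    \<and> (property_Z TYPE('a) \<longleftrightarrow> daugavet_property TYPE('a lip0))
    \<and> (property_Z TYPE('a) \<longleftrightarrow> \<not> (\<exists>f :: 'a lip0. norm_gateaux_differentiable_at f))
    \<and> (property_Z TYPE('a) \<longleftrightarrow> \<not> (\<exists>f :: 'a lip0. norm_frechet_differentiable_at f))
    \<and> (property_Z TYPE('a) \<longleftrightarrow> slice_diameter_2_property TYPE('a lip_free))
    \<and> (property_Z TYPE('a) \<longleftrightarrow> diameter_2_property TYPE('a lip_free))
    \<and> (property_Z TYPE('a) \<longleftrightarrow> strong_diameter_2_property TYPE('a lip_free))"
proof (cases "property_Z TYPE('a)")
  case True
  then have length: "length_space TYPE('a)" by (simp add: property_Z_iff_length_space)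
  have sd2p: "strong_diameter_2_property TYPE('a lip_free)"
    by (rule strong_diameter_2_if_length_space[OF length])
  obtain x :: 'a where "x \<noteq> 0" using assms by blast
  then obtain h where "slope h x 0 = 1" by (rule slope_eq_1_exists)
  then have "h \<noteq> 0" by (auto simp: slope_def zero_lip0.rep_eq)
  then have "lip0_functional h \<noteq> 0" by simp
  then have "\<exists>\<psi> :: 'a lip_free \<Rightarrow>\<^sub>L real. \<psi> \<noteq> 0" by blast
  then have d2p: "diameter_2_property TYPE('a lip_free)"
    by (rule diameter_2_if_strong_diameter_2[OF sd2p])
  have sld2p: "slice_diameter_2_property TYPE('a lip_free)"
    by (rule slice_diameter_2_if_strong_diameter_2[OF sd2p])
  have gateaux: "\<not> norm_gateaux_differentiable_at f" for f :: "'a lip0"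
    by (rule not_gateaux_differentiable_if_length_space[OF length assms])
  then have frechet: "\<not> norm_frechet_differentiable_at f" for f :: "'a lip0"
    by (simp add: norm_frechet_differentiable_at_def)
  show ?thesis
    using True length sd2p d2p sld2p gateaux frechet
      not_strongly_exposed_if_slice_diameter_2[OF sld2p]
      not_preserved_extreme_if_length_space[OF length assms]
      daugavet_lip_free_if_length_space[OF length] daugavet_lip0_if_length_space[OF length]
    by blast
next
  case False
  then obtain x y :: 'a where "x \<noteq> y" "\<not> property_Z_pair x y" unfolding property_Z_def by blast
  then obtain f t where peak: "affine_peak f x y t" by (rule affine_peak_if_not_property_Z_pair)
  note slice = affine_peak_slice[OF peak]
  have "\<not> length_space TYPE('a)" using False by (simp add: property_Z_iff_length_space)
  moreover have not_sld2p: "\<not> slice_diameter_2_property TYPE('a lip_free)"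
    using slice(1,4) unfolding slice_diameter_2_property_def by force
  moreover have "\<not> strong_diameter_2_property TYPE('a lip_free)"
    using not_sld2p slice_diameter_2_if_strong_diameter_2 by blast
  moreover have "\<not> diameter_2_property TYPE('a lip_free)"
    using slice(2-4) unfolding diameter_2_property_def by force
  moreover have "norm_gateaux_differentiable_at f" "norm_frechet_differentiable_at f"
    using affine_peak_frechet_differentiable[OF peak] by (simp_all add: norm_frechet_differentiable_at_def)
  ultimately show ?thesis
    using False affine_peak_strongly_exposed_point[OF peak] affine_peak_preserved_extreme_point[OF peak]
      affine_peak_not_daugavet_lip_free[OF peak] affine_peak_not_daugavet_lip0[OF peak]
    by blast
qed

end
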